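(* For each $\varepsilon\in(0,1]$ let $\lambda_\varepsilon:\mathbb R\to\mathbb R$ have a bounded continuous derivative, and suppose $0<c_-\le\lambda_\varepsilon(q)\le c_+<\infty$ for all $q\in\mathbb R$ and $\varepsilon\in(0,1]$, with constants $c_\pm$ independent of $\varepsilon$. Let $q_t^{\mu,\delta,\varepsilon}$ be the solution of $$\mu\ddot q_t^{\mu,\delta,\varepsilon}=b(q_t^{\mu,\delta,\varepsilon})-\lambda_\varepsilon(q_t^{\mu,\delta,\varepsilon})\dot q_t^{\mu,\delta,\varepsilon}+\dot W_t^\delta,\qquad q_0^{\mu,\delta,\varepsilon}=q,\ \dot q_0^{\mu,\delta,\varepsilon}=p.$$ Assume that the functions $\lambda_\varepsilon$ converge weakly as $\varepsilon\downarrow0$ on each finite interval $[\alpha,\beta]\subset\mathbb R$ to a function $\overline\lambda(q)$ (maybe discontinuous). Then the processes $q_t^{\mu,\delta,\varepsilon}$ converge weakly on each finite time interval to the diffusion process $\overline q_t$ (started at $q$) governed by the generator $D_{\overline v}D_{\overline u}$, as first $\mu\downarrow0$, then $\delta\downarrow0$, and then $\varepsilon\downarrow0$. Here $$\overline u(q)=\int_0^q\overline\lambda(x)\exp\Big(-2\int_0^xb(y)\overline\lambda(y)\,dy\Big)dx,\qquad \overline v(q)=2\int_0^q\overline\lambda(x)\exp\Big(2\int_0^xb(y)\overline\lambda(y)\,dy\Big)dx.$$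
   Context: The function $b:\mathbb R\to\mathbb R$ is continuously differentiable and bounded together with its first derivative. $W_t$ is a standard one-dimensional Wiener process and $W_t^\delta=\frac1\delta\int_0^\infty W_s\,\rho\big(\frac{s-t}{\delta}\big)ds$, where $\rho$ is a $C^\infty$ function with support in $[0,1]$ and $\int_0^1\rho(s)ds=1$; $\dot W_t^\delta$ is its time derivative. Weak convergence of the uniformly bounded functions $\lambda_\varepsilon$ on $[\alpha,\beta]$ to $\overline\lambda$ means $\int_\alpha^\beta\lambda_\varepsilon\varphi\,dx\to\int_\alpha^\beta\overline\lambda\varphi\,dx$ for integrable test functions $\varphi$. For a continuous strictly increasing function $u$, $D_u$ denotes differentiation with respect to $u$: $D_uf(q)=\lim_{h\to0}\frac{f(q+h)-f(q)}{u(q+h)-u(q)}$; $D_v$ is defined similarly. $D_vD_u$ is the generalized second order differential operator of Feller, which, for continuous strictly increasing $u,v$ of the form $u(q)=\int_0^q\lambda(x)\exp\big(-2\int_0^xb(y)\lambda(y)\,dy\big)dx$, $v(q)=2\int_0^q\lambda(x)\exp\big(2\int_0^xb(y)\lambda(y)\,dy\big)dx$, with $\lambda$ a measurable function bounded between two positive constants, is the generator of a one-dimensional diffusion process. Weak convergence of processes means weak convergence of their laws; the limits in $\mu$, $\delta$, $\varepsilon$ are taken successively (iterated limits). *)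

theory Defs
  imports "HOL-Probability.Probability"
begin

definition C1_bounded_deriv :: "(real \<Rightarrow> real) \<Rightarrow> bool" where
  "C1_bounded_deriv f \<longleftrightarrow>
     (\<exists>f'. (\<forall>x. (f has_real_derivative f' x) (at x)) \<and> continuous_on UNIV f' \<and> bounded (range f'))"

definition smooth :: "(real \<Rightarrow> real) \<Rightarrow> bool" where
  "smooth f \<longleftrightarrow> (\<forall>n x. ((deriv ^^ n) f) field_differentiable (at x))"

definition smoothing_kernel :: "(real \<Rightarrow> real) \<Rightarrow> bool" where
  "smoothing_kernel \<rho> \<longleftrightarrow>
     smooth \<rho> \<and> (\<forall>x. x \<notin> {0..1} \<longrightarrow> \<rho> x = 0) \<and> (LBINT s:{0..1}. \<rho> s) = 1"

text \<open>Convention: every path, not only almost every one, is continuous and starts at 0.\<close>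

definition wiener_process :: "'a measure \<Rightarrow> (real \<Rightarrow> 'a \<Rightarrow> real) \<Rightarrow> bool" where
  "wiener_process M W \<longleftrightarrow>
     prob_space M \<and>
     (\<forall>t\<ge>0. W t \<in> borel_measurable M) \<and>
     (\<forall>\<omega>\<in>space M. W 0 \<omega> = 0) \<and>
     (\<forall>\<omega>\<in>space M. continuous_on {0..} (\<lambda>t. W t \<omega>)) \<and>
     (\<forall>s t. 0 \<le> s \<and> s < t \<longrightarrow>
        distributed M lborel (\<lambda>\<omega>. W t \<omega> - W s \<omega>) (normal_density 0 (sqrt (t - s)))) \<and>
     (\<forall>(\<tau> :: nat \<Rightarrow> real) n. 0 \<le> \<tau> 0 \<and> (\<forall>i<n. \<tau> i < \<tau> (Suc i)) \<longrightarrow>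
        prob_space.indep_vars M (\<lambda>_. borel) (\<lambda>i \<omega>. W (\<tau> (Suc i)) \<omega> - W (\<tau> i) \<omega>) {..<n})"

definition mollified :: "(real \<Rightarrow> real) \<Rightarrow> real \<Rightarrow> (real \<Rightarrow> real) \<Rightarrow> real \<Rightarrow> real" where
  "mollified \<rho> \<delta> w t = 1 / \<delta> * (LBINT s:{0..}. w s * \<rho> ((s - t) / \<delta>))"

text \<open>\<open>x\<close> solves \<open>\<mu> x'' = b(x) - l(x) x' + w'\<close>, \<open>x(0) = q\<close>, \<open>x'(0) = p\<close> on \<open>[0,\<infinity>)\<close>;
  derivatives of \<open>x\<close> at time 0 are one-sided.\<close>

definition newton_solution ::
  "real \<Rightarrow> (real \<Rightarrow> real) \<Rightarrow> (real \<Rightarrow> real) \<Rightarrow> (real \<Rightarrow> real) \<Rightarrow> real \<Rightarrow> real \<Rightarrow> (real \<Rightarrow> real) \<Rightarrow> bool"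
where
  "newton_solution \<mu> b l w q p x \<longleftrightarrow>
     (\<exists>x' x''. x 0 = q \<and> x' 0 = p \<and>
        (\<forall>t\<ge>0. (x has_real_derivative x' t) (at t within {0..}) \<and>
                (x' has_real_derivative x'' t) (at t within {0..}) \<and>
                \<mu> * x'' t = b (x t) - l (x t) * x' t + deriv w t))"

definition weakly_converges_on_intervals ::
  "(real \<Rightarrow> real \<Rightarrow> real) \<Rightarrow> (real \<Rightarrow> real) \<Rightarrow> bool" where
  "weakly_converges_on_intervals lam lbar \<longleftrightarrow>
     lbar \<in> borel_measurable borel \<and>
     (\<forall>\<alpha> \<beta> \<phi>. \<alpha> < \<beta> \<longrightarrow> set_integrable lborel {\<alpha>..\<beta>} (\<phi> :: real \<Rightarrow> real) \<longrightarrow>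
        ((\<lambda>\<epsilon>. LBINT x:{\<alpha>..\<beta>}. lam \<epsilon> x * \<phi> x) \<longlongrightarrow> (LBINT x:{\<alpha>..\<beta>}. lbar x * \<phi> x)) (at_right 0))"

text \<open>The integral \<open>LBINT x=a..b\<close> is oriented, so these formulas also cover \<open>q < 0\<close>.\<close>

definition u_fun :: "(real \<Rightarrow> real) \<Rightarrow> (real \<Rightarrow> real) \<Rightarrow> real \<Rightarrow> real" where
  "u_fun b l q = (LBINT x=0..ereal q. l x * exp (- 2 * (LBINT y=0..ereal x. b y * l y)))"

definition v_fun :: "(real \<Rightarrow> real) \<Rightarrow> (real \<Rightarrow> real) \<Rightarrow> real \<Rightarrow> real" where
  "v_fun b l q = 2 * (LBINT x=0..ereal q. l x * exp (2 * (LBINT y=0..ereal x. b y * l y)))"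

text \<open>\<open>D_u f (x) = d\<close>\<close>

definition has_D :: "(real \<Rightarrow> real) \<Rightarrow> (real \<Rightarrow> real) \<Rightarrow> real \<Rightarrow> real \<Rightarrow> bool" where
  "has_D u f d x \<longleftrightarrow> ((\<lambda>h. (f (x + h) - f x) / (u (x + h) - u x)) \<longlongrightarrow> d) (at 0)"

text \<open>\<open>D_v D_u f\<close> exists everywhere and equals \<open>g\<close>.\<close>

definition has_DD ::
  "(real \<Rightarrow> real) \<Rightarrow> (real \<Rightarrow> real) \<Rightarrow> (real \<Rightarrow> real) \<Rightarrow> (real \<Rightarrow> real) \<Rightarrow> bool" where
  "has_DD v u f g \<longleftrightarrow> (\<exists>f\<^sub>1. \<forall>x. has_D u f (f\<^sub>1 x) x \<and> has_D v f\<^sub>1 (g x) x)"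

definition C0 :: "(real \<Rightarrow> real) set" where
  "C0 = {f. continuous_on UNIV f \<and> (f \<longlongrightarrow> 0) at_infinity}"

definition feller_transition :: "(real \<Rightarrow> real \<Rightarrow> real measure) \<Rightarrow> bool" where
  "feller_transition P \<longleftrightarrow>
     (\<forall>t\<ge>0. P t \<in> borel \<rightarrow>\<^sub>M prob_algebra borel) \<and>
     (\<forall>x. P 0 x = return borel x) \<and>
     (\<forall>s\<ge>0. \<forall>t\<ge>0. \<forall>x. P (s + t) x = P s x \<bind> P t) \<and>
     (\<forall>f\<in>C0. \<forall>t\<ge>0. (\<lambda>x. \<integral>y. f y \<partial>P t x) \<in> C0) \<and>
     (\<forall>f\<in>C0. uniform_limit UNIV (\<lambda>t x. \<integral>y. f y \<partial>P t x) f (at_right 0))"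

text \<open>The graph of the infinitesimal generator of the semigroup on \<open>C0\<close>.\<close>

definition generator ::
  "(real \<Rightarrow> real \<Rightarrow> real measure) \<Rightarrow> ((real \<Rightarrow> real) \<times> (real \<Rightarrow> real)) set" where
  "generator P = {(f, g). f \<in> C0 \<and> g \<in> C0 \<and>
     uniform_limit UNIV (\<lambda>t x. ((\<integral>y. f y \<partial>P t x) - f x) / t) g (at_right 0)}"

definition natural_filtration :: "'a measure \<Rightarrow> (real \<Rightarrow> 'a \<Rightarrow> real) \<Rightarrow> real \<Rightarrow> 'a measure" where
  "natural_filtration N X s =
     sigma (space N) {X r -` B \<inter> space N | r B. 0 \<le> r \<and> r \<le> s \<and> B \<in> sets borel}"

definition continuous_markov_process ::
  "(real \<Rightarrow> real \<Rightarrow> real measure) \<Rightarrow> real \<Rightarrow> 'a measure \<Rightarrow> (real \<Rightarrow> 'a \<Rightarrow> real) \<Rightarrow> bool" where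
  "continuous_markov_process P q N X \<longleftrightarrow>
     prob_space N \<and>
     (\<forall>t\<ge>0. X t \<in> borel_measurable N) \<and>
     (\<forall>\<omega>\<in>space N. X 0 \<omega> = q) \<and>
     (\<forall>\<omega>\<in>space N. continuous_on {0..} (\<lambda>t. X t \<omega>)) \<and>
     (\<forall>s\<ge>0. \<forall>t\<ge>0. \<forall>A\<in>sets borel. AE \<omega> in N.
        real_cond_exp N (natural_filtration N X s)
          (indicator (X (s + t) -` A \<inter> space N)) \<omega> = measure (P t (X s \<omega>)) A)"

text \<open>The diffusion started at \<open>q\<close> with generator \<open>D_v D_u\<close>. The domain of the generator is
  the maximal one in \<open>C0\<close>: for the functions \<open>u\<close>, \<open>v\<close> considered here both \<open>-\<infinity>\<close> and \<open>+\<infinity>\<close> are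
  natural boundaries in Feller's classification, so that no boundary conditions occur.\<close>

definition diffusion_governed_by ::
  "(real \<Rightarrow> real) \<Rightarrow> (real \<Rightarrow> real) \<Rightarrow> real \<Rightarrow> 'a measure \<Rightarrow> (real \<Rightarrow> 'a \<Rightarrow> real) \<Rightarrow> bool" where
  "diffusion_governed_by v u q N X \<longleftrightarrow>
     (\<exists>P. feller_transition P \<and>
          generator P = {(f, g). f \<in> C0 \<and> g \<in> C0 \<and> has_DD v u f g} \<and>
          continuous_markov_process P q N X)"

text \<open>\<open>C[0,T]\<close> with the uniform metric; its elements are extensional on \<open>{0..T}\<close>.\<close>

definition path_space :: "real \<Rightarrow> (real \<Rightarrow> real) metric" where
  "path_space T = cfunspace (top_of_set {0..T}) euclidean_metric"

definition path_borel :: "real \<Rightarrow> (real \<Rightarrow> real) measure" where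
  "path_borel T = sigma (mspace (path_space T)) {U. openin (mtopology_of (path_space T)) U}"

definition path_law :: "real \<Rightarrow> 'a measure \<Rightarrow> (real \<Rightarrow> 'a \<Rightarrow> real) \<Rightarrow> (real \<Rightarrow> real) measure" where
  "path_law T M X = distr M (path_borel T) (\<lambda>\<omega>. restrict (\<lambda>t. X t \<omega>) {0..T})"

definition weak_conv_law ::
  "real \<Rightarrow> (real \<Rightarrow> (real \<Rightarrow> real) measure) \<Rightarrow> (real \<Rightarrow> real) measure \<Rightarrow> real filter \<Rightarrow> bool" where
  "weak_conv_law T \<nu> \<nu>\<^sub>0 F \<longleftrightarrow>
     (\<forall>G. continuous_map (mtopology_of (path_space T)) euclideanreal G \<and>
          bounded (G ` mspace (path_space T)) \<longrightarrow>
          ((\<lambda>i. \<integral>x. G x \<partial>\<nu> i) \<longlongrightarrow> (\<integral>x. G x \<partial>\<nu>\<^sub>0)) F)"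

text \<open>Weak convergence of \<open>\<nu> \<mu> \<delta> \<epsilon>\<close> to \<open>\<nu>\<^sub>0\<close> as first \<open>\<mu> \<down> 0\<close>, then \<open>\<delta> \<down> 0\<close>, then \<open>\<epsilon> \<down> 0\<close>, the
  intermediate weak limits \<open>\<nu>\<^sub>1 \<delta> \<epsilon>\<close> and \<open>\<nu>\<^sub>2 \<epsilon>\<close> being probability laws on \<open>C[0,T]\<close>.\<close>

definition iterated_weak_conv ::
  "real \<Rightarrow> (real \<Rightarrow> real \<Rightarrow> real \<Rightarrow> (real \<Rightarrow> real) measure) \<Rightarrow> (real \<Rightarrow> real) measure \<Rightarrow> bool" where
  "iterated_weak_conv T \<nu> \<nu>\<^sub>0 \<longleftrightarrow>
     (\<exists>\<nu>\<^sub>1 \<nu>\<^sub>2.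
        (\<forall>\<epsilon>\<in>{0<..1}. \<forall>\<delta>>0. \<nu>\<^sub>1 \<delta> \<epsilon> \<in> space (prob_algebra (path_borel T)) \<and>
           weak_conv_law T (\<lambda>\<mu>. \<nu> \<mu> \<delta> \<epsilon>) (\<nu>\<^sub>1 \<delta> \<epsilon>) (at_right 0)) \<and>
        (\<forall>\<epsilon>\<in>{0<..1}. \<nu>\<^sub>2 \<epsilon> \<in> space (prob_algebra (path_borel T)) \<and>
           weak_conv_law T (\<lambda>\<delta>. \<nu>\<^sub>1 \<delta> \<epsilon>) (\<nu>\<^sub>2 \<epsilon>) (at_right 0)) \<and>
        weak_conv_law T \<nu>\<^sub>2 \<nu>\<^sub>0 (at_right 0))"

end

theory Submission
  imports Defs
begin

text \<open>In the variable \<open>y = \<Lambda>(x)\<close> with \<open>\<Lambda>' = \<lambda>\<close> the equation \<open>\<lambda>(x) x' = b(x) + W'\<close> becomes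
  \<open>y' = b(\<Lambda>\<^sup>-\<^sup>1 y) + W'\<close>, an integral equation with additive noise and a Lipschitz drift, which
  is solved path by path. Newton's equation integrates to
  \<open>\<mu> x' + \<Lambda>(x) = \<mu> p + \<Lambda>(q) + \<integral> b(x) + W\<^sup>\<delta> - W\<^sup>\<delta>\<^sub>0\<close> with \<open>x'\<close> bounded in \<open>\<mu>\<close>; moreover
  \<open>W\<^sup>\<delta> \<rightarrow> W\<close> and \<open>\<Lambda>\<^sub>\<epsilon> \<rightarrow> \<Lambda>\<close> locally uniformly. So Gronwall's inequality turns each of the three limits into
  uniform convergence of the paths, for every \<open>\<omega>\<close>, and weak convergence follows by dominated convergence.

  The limit \<open>\<Lambda>\<^sup>-\<^sup>1(y)\<close> is a Feller process because the increments of \<open>W\<close> after a time are independent of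
  its past. In the variable \<open>y\<close> Feller's operator \<open>D\<^sub>v D\<^sub>u\<close> is \<open>h''/2 + b(\<Lambda>\<^sup>-\<^sup>1 y) h'\<close>; Taylor expansion
  shows that it is a restriction of the generator. As its resolvent equation is solvable in \<open>C0\<close> and
  generators are dissipative, it is the whole generator.\<close>


section \<open>Measurability in the space of continuous paths\<close>

text \<open>Four obstacles shape the proof. The solutions \<open>X\<close> are given for each
  \<omega> separately and nothing is said about their measurability; it is recovered from the kind
  of stability estimate that also gives the limits, by
  \<open>borel_measurable_path_dominated\<close>. The function \<open>lbar\<close> is only
  measurable and may take arbitrary values on null sets, so neither the change of variable nor
  Feller's operator can use it pointwise: it enters only through bounds on its integrals, which make
  its primitive bi-Lipschitz. Since Feller's operator is imposed with its maximal domain in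
  \<open>C0\<close>, an inclusion of operators does not suffice; the gap is closed at a single
  spectral parameter, \<open>(4 * K + 2)^2 / 2\<close> with \<open>K\<close> a bound of the drift,
  chosen so large that the drift is a small perturbation of \<open>h''/2\<close>. Finally, the limit
  process has to live on a measure over functions \<open>real \<Rightarrow> real\<close> while
  \<open>M\<close> is arbitrary, so \<open>W\<close> is transported to a canonical space of
  paths.\<close>

lemma mspace_path_space_iff:
  "f \<in> mspace (path_space T) \<longleftrightarrow> f \<in> extensional {0..T} \<and> continuous_on {0..T} f"
  by (auto simp: path_space_def compact_imp_bounded compact_continuous_image)

lemma restrict_in_path_space:
  "continuous_on {0..T} f \<Longrightarrow> restrict f {0..T} \<in> mspace (path_space T)"
  by (auto simp: mspace_path_space_iff cong: continuous_on_cong_simp)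

lemma mdist_path_space_le:
  assumes "f \<in> mspace (path_space T)" "g \<in> mspace (path_space T)" "0 \<le> T"
  shows "mdist (path_space T) f g \<le> a \<longleftrightarrow> (\<forall>t\<in>{0..T}. \<bar>f t - g t\<bar> \<le> a)"
  using cfunspace_mdist_le[of f "top_of_set {0..T}" euclidean_metric g a] assms
  by (simp add: path_space_def dist_real_def del: mspace_cfunspace)

text \<open>Neighbourhoods are closed balls because a non-strict bound on a supremum is the same as
  a bound at every time. After this lemma the metric itself no longer appears.\<close>

lemma openin_path_space:
  assumes "0 \<le> T"
  shows "openin (mtopology_of (path_space T)) U \<longleftrightarrow> U \<subseteq> mspace (path_space T) \<and>
    (\<forall>f\<in>U. \<exists>r>0. \<forall>g\<in>mspace (path_space T). (\<forall>t\<in>{0..T}. \<bar>f t - g t\<bar> \<le> r) \<longrightarrow> g \<in> U)"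
proof -
  interpret P: Metric_space "mspace (path_space T)" "mdist (path_space T)"
    by (rule Metric_space_mspace_mdist)
  have eq: "P.mcball f r \<subseteq> U \<longleftrightarrow>
      (\<forall>g\<in>mspace (path_space T). (\<forall>t\<in>{0..T}. \<bar>f t - g t\<bar> \<le> r) \<longrightarrow> g \<in> U)"
    if "f \<in> mspace (path_space T)" for f r
    using that mdist_path_space_le[OF that _ assms] by (auto simp: subset_iff)
  show ?thesis
    unfolding mtopology_of_def P.openin_mtopology_mcball
  proof (rule conj_cong[OF refl])
    assume "U \<subseteq> mspace (path_space T)"
    then show "(\<forall>x. x \<in> U \<longrightarrow> (\<exists>r. 0 < r \<and> P.mcball x r \<subseteq> U)) \<longleftrightarrow>
      (\<forall>f\<in>U. \<exists>r>0. \<forall>g\<in>mspace (path_space T). (\<forall>t\<in>{0..T}. \<bar>f t - g t\<bar> \<le> r) \<longrightarrow> g \<in> U)"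
      unfolding Ball_def[of U] by (intro all_cong1 imp_cong refl ex_cong1 conj_cong eq) auto
  qed
qed

lemma space_path_borel [simp]: "space (path_borel T) = mspace (path_space T)"
  by (simp add: path_borel_def space_measure_of_conv)

lemma openin_in_path_borel:
  "openin (mtopology_of (path_space T)) U \<Longrightarrow> U \<in> sets (path_borel T)"
  unfolding path_borel_def using openin_subset
  by (subst sets_measure_of) (force simp: topspace_mtopology_of)+

lemma continuous_map_path_borel_measurable:
  assumes "continuous_map (mtopology_of (path_space T)) euclideanreal G"
  shows "G \<in> borel_measurable (path_borel T)"
proof (rule borel_measurableI)
  fix S :: "real set" assume "open S"
  then have "openin (mtopology_of (path_space T)) {x \<in> mspace (path_space T). G x \<in> S}"
    using assms by (auto simp: continuous_map_def)
  moreover have "G -` S \<inter> space (path_borel T) = {x \<in> mspace (path_space T). G x \<in> S}" by auto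
  ultimately show "G -` S \<inter> space (path_borel T) \<in> sets (path_borel T)"
    using openin_in_path_borel by metis
qed

text \<open>Separability enters only through this lemma: Bernstein polynomials with coefficients rounded
  to multiples of \<open>1/n\<close> are countably many and approximate every path.\<close>

lemma rounded_Bernstein_approx:
  fixes f :: "real \<Rightarrow> real"
  assumes "0 < T" "continuous_on {0..T} f" "0 < e"
  shows "\<exists>N. \<forall>n\<ge>N. \<forall>t\<in>{0..T}.
    \<bar>f t - (\<Sum>k\<le>n. (of_int \<lfloor>real n * f (T * (real k / real n))\<rfloor> / real n) * Bernstein n k (t / T))\<bar> \<le> e"
proof -
  have "continuous_on {0..1} (\<lambda>x. f (T * x))"
    using assms by (intro continuous_on_compose2[OF assms(2)] continuous_intros) (auto simp: mult_left_le)
  from Bernstein_Weierstrass[OF this, of "e/2"] \<open>0 < e\<close>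
  obtain N where N: "\<And>n x. N \<le> n \<Longrightarrow> x \<in> {0..1} \<Longrightarrow>
      \<bar>f (T * x) - (\<Sum>k\<le>n. f (T * (real k / real n)) * Bernstein n k x)\<bar> < e/2"
    by auto
  obtain N' :: nat where N': "2 / e < real N'" using reals_Archimedean2 by blast
  have N'pos: "0 < N'" using N' \<open>0 < e\<close> by (cases N') (auto simp: not_less divide_le_0_iff)
  show ?thesis
  proof (intro exI[of _ "max N N'"] allI impI ballI)
    fix n t assume n: "max N N' \<le> n" and t: "t \<in> {0..T}"
    let ?x = "t / T"
    have x: "?x \<in> {0..1}" using t \<open>0 < T\<close> by auto
    have npos: "0 < n" using n N'pos by auto
    have "1 / real n \<le> 1 / real N'" using n N'pos by (auto simp: field_simps)
    also have "\<dots> \<le> e/2" using N' N'pos \<open>0 < e\<close> by (simp add: field_simps)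
    finally have ne: "1 / real n \<le> e / 2" .
    let ?c = "\<lambda>k. f (T * (real k / real n))"
    have "\<bar>(\<Sum>k\<le>n. ?c k * Bernstein n k ?x) - (\<Sum>k\<le>n. (of_int \<lfloor>real n * ?c k\<rfloor> / real n) * Bernstein n k ?x)\<bar>
      = \<bar>\<Sum>k\<le>n. (?c k - of_int \<lfloor>real n * ?c k\<rfloor> / real n) * Bernstein n k ?x\<bar>"
      by (simp add: sum_subtractf left_diff_distrib)
    \<comment> \<open>Bernstein polynomials are nonnegative with sum 1, so moving each coefficient
      by at most \<open>1/n\<close> moves the value by at most \<open>1/n\<close>.\<close>
    also have "\<dots> \<le> (\<Sum>k\<le>n. (1 / real n) * Bernstein n k ?x)"
    proof (intro order_trans[OF sum_abs] sum_mono)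
      fix k
      have "real n * ?c k - of_int \<lfloor>real n * ?c k\<rfloor> \<in> {0..1}" by (simp, linarith)
      then have "\<bar>(real n * ?c k - of_int \<lfloor>real n * ?c k\<rfloor>) / real n\<bar> \<le> 1 / real n"
        unfolding abs_divide by (intro frac_le) (use npos in auto)
      moreover have "(real n * ?c k - of_int \<lfloor>real n * ?c k\<rfloor>) / real n = ?c k - of_int \<lfloor>real n * ?c k\<rfloor> / real n"
        using npos by (simp add: diff_divide_distrib)
      ultimately have "\<bar>?c k - of_int \<lfloor>real n * ?c k\<rfloor> / real n\<bar> \<le> 1 / real n"
        by (simp only:)
      then show "\<bar>(?c k - of_int \<lfloor>real n * ?c k\<rfloor> / real n) * Bernstein n k ?x\<bar> \<le> (1 / real n) * Bernstein n k ?x"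
        using Bernstein_nonneg[of ?x n k] x by (simp only: abs_mult abs_of_nonneg atLeastAtMost_iff mult_right_mono)
    qed
    also have "\<dots> = 1 / real n"
      by (simp only: sum_distrib_left[symmetric] sum_Bernstein mult_1_right)
    finally have "\<bar>(\<Sum>k\<le>n. ?c k * Bernstein n k ?x) -
      (\<Sum>k\<le>n. (of_int \<lfloor>real n * ?c k\<rfloor> / real n) * Bernstein n k ?x)\<bar> \<le> e / 2"
      using ne by simp
    moreover have "\<bar>f t - (\<Sum>k\<le>n. ?c k * Bernstein n k ?x)\<bar> < e / 2"
      using N[of n ?x] n x \<open>0 < T\<close> by simp
    ultimately show "\<bar>f t - (\<Sum>k\<le>n. (of_int \<lfloor>real n * ?c k\<rfloor> / real n) * Bernstein n k ?x)\<bar> \<le> e"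
      by linarith
  qed
qed

text \<open>A path lies in an open \<open>U\<close> iff, for some radius, the closed balls of that
  radius around its rounded Bernstein approximations eventually lie in \<open>U\<close>. Each
  approximation is determined by finitely many integers, hence takes countably many values, each on
  a measurable event. So measurable evaluations suffice for the Borel sets of the uniform
  topology.\<close>

lemma measurable_path_borel:
  assumes T: "0 < T"
    and F: "\<And>\<omega>. \<omega> \<in> space M \<Longrightarrow> F \<omega> \<in> mspace (path_space T)"
    and ev: "\<And>t. 0 \<le> t \<Longrightarrow> t \<le> T \<Longrightarrow> (\<lambda>\<omega>. F \<omega> t) \<in> borel_measurable M"
  shows "F \<in> measurable M (path_borel T)"
  unfolding path_borel_def
proof (rule measurable_measure_of)
  show "{U. openin (mtopology_of (path_space T)) U} \<subseteq> Pow (mspace (path_space T))"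
    using openin_subset by (force simp: topspace_mtopology_of)
  show "F \<in> space M \<rightarrow> mspace (path_space T)" using F by auto
  fix U assume "U \<in> {U. openin (mtopology_of (path_space T)) U}"
  then have U: "U \<subseteq> mspace (path_space T)"
    "\<And>f. f \<in> U \<Longrightarrow> \<exists>r>0. \<forall>g\<in>mspace (path_space T). (\<forall>t\<in>{0..T}. \<bar>f t - g t\<bar> \<le> r) \<longrightarrow> g \<in> U"
    using T by (simp_all add: openin_path_space)
  define c where "c n k \<omega> = \<lfloor>real n * F \<omega> (T * (real k / real n))\<rfloor>" for n k :: nat and \<omega>
  define A where "A n c = (\<lambda>t. \<Sum>k\<le>n. (of_int (c k) / real n) * Bernstein n k (t / T))" for n :: nat and c :: "nat \<Rightarrow> int"
  \<comment> \<open>\<open>Q\<close> speaks of the paths near \<open>h\<close> instead of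
    \<open>h \<in> U\<close>, since a Bernstein sum is in general not extensional on
    \<open>{0..T}\<close> and then is no element of the path space.\<close>
  define Q where "Q m h \<longleftrightarrow> (\<forall>g\<in>mspace (path_space T). (\<forall>t\<in>{0..T}. \<bar>h t - g t\<bar> \<le> 1 / real (Suc m)) \<longrightarrow> g \<in> U)"
    for m and h :: "real \<Rightarrow> real"
  have approx: "\<exists>N. \<forall>n\<ge>N. \<forall>t\<in>{0..T}. \<bar>F \<omega> t - A n (\<lambda>k. c n k \<omega>) t\<bar> \<le> e"
    if "\<omega> \<in> space M" "0 < e" for \<omega> e
    using rounded_Bernstein_approx[OF T _ that(2), of "F \<omega>"] F[OF that(1)]
    unfolding A_def c_def mspace_path_space_iff by blast
  have key: "F \<omega> \<in> U \<longleftrightarrow> (\<exists>m N. \<forall>n\<ge>N. Q m (A n (\<lambda>k. c n k \<omega>)))" if \<omega>: "\<omega> \<in> space M" for \<omega>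
  proof
    assume "F \<omega> \<in> U"
    then obtain r where r: "0 < r"
      "\<And>g. g \<in> mspace (path_space T) \<Longrightarrow> (\<forall>t\<in>{0..T}. \<bar>F \<omega> t - g t\<bar> \<le> r) \<Longrightarrow> g \<in> U"
      using U(2) by blast
    obtain m :: nat where m: "1 / real (Suc m) < r / 2"
      using r(1) reals_Archimedean[of "r/2"] by (auto simp: inverse_eq_divide)
    obtain N where N: "\<And>n t. n \<ge> N \<Longrightarrow> t \<in> {0..T} \<Longrightarrow> \<bar>F \<omega> t - A n (\<lambda>k. c n k \<omega>) t\<bar> \<le> r / 2"
      using approx[OF \<omega>, of "r/2"] r(1) by (meson half_gt_zero)
    have "Q m (A n (\<lambda>k. c n k \<omega>))" if "n \<ge> N" for n
      unfolding Q_def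
    proof (intro ballI impI r(2))
      fix g t assume "\<forall>t\<in>{0..T}. \<bar>A n (\<lambda>k. c n k \<omega>) t - g t\<bar> \<le> 1 / real (Suc m)" "t \<in> {0..T}"
      then have "\<bar>A n (\<lambda>k. c n k \<omega>) t - g t\<bar> \<le> r / 2" "\<bar>F \<omega> t - A n (\<lambda>k. c n k \<omega>) t\<bar> \<le> r / 2"
        using N[OF that, of t] m by (meson less_eq_real_def order_trans)+
      then show "\<bar>F \<omega> t - g t\<bar> \<le> r" by linarith
    qed
    then show "\<exists>m N. \<forall>n\<ge>N. Q m (A n (\<lambda>k. c n k \<omega>))" by blast
  next
    assume "\<exists>m N. \<forall>n\<ge>N. Q m (A n (\<lambda>k. c n k \<omega>))"
    then obtain m N where N: "\<And>n. n \<ge> N \<Longrightarrow> Q m (A n (\<lambda>k. c n k \<omega>))" by blast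
    obtain N' where N': "\<And>n t. n \<ge> N' \<Longrightarrow> t \<in> {0..T} \<Longrightarrow> \<bar>F \<omega> t - A n (\<lambda>k. c n k \<omega>) t\<bar> \<le> 1 / real (Suc m)"
      using approx[OF \<omega>, of "1 / real (Suc m)"] by (meson of_nat_0_less_iff zero_less_Suc zero_less_divide_1_iff)
    show "F \<omega> \<in> U"
    proof -
      have "\<forall>t\<in>{0..T}. \<bar>A (max N N') (\<lambda>k. c (max N N') k \<omega>) t - F \<omega> t\<bar> \<le> 1 / real (Suc m)"
        using N'[of "max N N'"] by (simp add: abs_minus_commute del: of_nat_Suc)
      then show ?thesis
        using N[of "max N N'"] F[OF \<omega>] unfolding Q_def by simp
    qed
  qed
  have c_meas [measurable]: "(\<lambda>\<omega>. c n k \<omega>) \<in> measurable M (count_space UNIV)" if "k \<le> n" for n k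
  proof -
    have [measurable]: "(\<lambda>\<omega>. F \<omega> (T * (real k / real n))) \<in> borel_measurable M"
      using that T by (intro ev) (auto simp: mult_left_le divide_le_eq)
    show ?thesis unfolding c_def by measurable
  qed
  have A_cong: "A n (\<lambda>k. c n k \<omega>) = A n (\<lambda>k. l ! k)" if "\<forall>k\<in>{..n}. c n k \<omega> = l ! k" for n l \<omega>
    using that by (auto simp: A_def intro!: ext sum.cong)
  \<comment> \<open>Integer lists, unlike functions \<open>nat \<Rightarrow> int\<close>, form a
    countable type, which turns the event into a countable union.\<close>
  have Q_eq: "Q m (A n (\<lambda>k. c n k \<omega>)) \<longleftrightarrow>
      (\<exists>l::int list. Q m (A n (\<lambda>k. l ! k)) \<and> (\<forall>k\<in>{..n}. c n k \<omega> = l ! k))" for m n \<omega>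
  proof
    assume Q: "Q m (A n (\<lambda>k. c n k \<omega>))"
    have "\<forall>k\<in>{..n}. c n k \<omega> = map (\<lambda>k. c n k \<omega>) [0..<Suc n] ! k" by (auto simp del: upt_Suc)
    then obtain l where l: "\<forall>k\<in>{..n}. c n k \<omega> = l ! k" ..
    show "\<exists>l::int list. Q m (A n (\<lambda>k. l ! k)) \<and> (\<forall>k\<in>{..n}. c n k \<omega> = l ! k)"
      using subst[OF A_cong[OF l], of "Q m"] Q l by blast
  qed (metis A_cong)
  have "Measurable.pred M (\<lambda>\<omega>. \<forall>k\<in>{..n}. c n k \<omega> = l ! k)" for n and l :: "int list"
  proof (rule pred_intros_finite)
    fix k assume "k \<in> {..n}"
    then have [measurable]: "(\<lambda>\<omega>. c n k \<omega>) \<in> measurable M (count_space UNIV)" by (auto intro: c_meas)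
    show "Measurable.pred M (\<lambda>\<omega>. c n k \<omega> = l ! k)" by measurable
  qed simp
  then have Q_pred: "Measurable.pred M (\<lambda>\<omega>. Q m (A n (\<lambda>k. c n k \<omega>)))" for m n
    unfolding Q_eq by (intro pred_intros_countable pred_intros_logic) auto
  have "F -` U \<inter> space M = {\<omega> \<in> space M. \<exists>m N. \<forall>n\<ge>N. Q m (A n (\<lambda>k. c n k \<omega>))}"
    using key by auto
  also have "\<dots> \<in> sets M"
    unfolding pred_def[symmetric] by (intro pred_intros_countable pred_intros_imp' Q_pred)
  finally show "F -` U \<inter> space M \<in> sets M" .
qed

text \<open>The premise \<open>dom\<close> makes \<open>f\<close> a Lipschitz function of the path
  \<open>F \<omega>\<close>, though only on the range of \<open>F\<close>. The lemma serves wherever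
  a quantity is known only through a stability estimate: solutions of integral equations, Newton
  trajectories, mollified noise, running maxima.\<close>

lemma borel_measurable_path_dominated:
  fixes f :: "'a \<Rightarrow> real"
  assumes T: "0 \<le> T" and C: "0 \<le> C" and F: "F \<in> measurable M (path_borel T)"
    and dom: "\<And>\<omega> \<omega>' e. \<omega> \<in> space M \<Longrightarrow> \<omega>' \<in> space M \<Longrightarrow> 0 \<le> e \<Longrightarrow>
      (\<And>t. 0 \<le> t \<Longrightarrow> t \<le> T \<Longrightarrow> \<bar>F \<omega> t - F \<omega>' t\<bar> \<le> e) \<Longrightarrow> \<bar>f \<omega> - f \<omega>'\<bar> \<le> C * e"
  shows "f \<in> borel_measurable M"
  unfolding borel_measurable_iff_greater
proof
  fix a
  have Fm: "F \<omega> \<in> mspace (path_space T)" if "\<omega> \<in> space M" for \<omega>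
    using measurable_space[OF F that] by simp
  \<comment> \<open>\<open>V\<close> is where the McShane extension of \<open>f\<close> exceeds
    \<open>a\<close>: the supremum over \<omega> of \<open>f \<omega>\<close> minus \<open>C\<close>
    times the distance from \<open>F \<omega>\<close> to the path. It is open in the whole path
    space, not only relative to the range of \<open>F\<close>.\<close>
  define V where "V = {g \<in> mspace (path_space T). \<exists>\<omega>\<in>space M. \<exists>e\<ge>0.
      (\<forall>t\<in>{0..T}. \<bar>F \<omega> t - g t\<bar> \<le> e) \<and> f \<omega> - C * e > a}"
  have "openin (mtopology_of (path_space T)) V"
    unfolding openin_path_space[OF T]
  proof (intro conjI ballI)
    show "V \<subseteq> mspace (path_space T)" by (auto simp: V_def)
    fix g assume "g \<in> V"
    then obtain \<omega> e where \<omega>: "\<omega> \<in> space M" "0 \<le> e"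
      "\<And>t. t \<in> {0..T} \<Longrightarrow> \<bar>F \<omega> t - g t\<bar> \<le> e" "f \<omega> - C * e > a"
      by (auto simp: V_def)
    \<comment> \<open>The summand 1 keeps the denominator positive when
      \<open>C = 0\<close>.\<close>
    define r where "r = (f \<omega> - C * e - a) / (2 * (C + 1))"
    have r: "0 < r" using \<omega>(4) C by (simp add: r_def)
    have "C * r < f \<omega> - C * e - a"
    proof -
      have "C * r \<le> (C + 1) * r" using r by (simp add: mult_right_mono)
      also have "\<dots> = (f \<omega> - C * e - a) / 2" using C by (simp add: r_def field_simps)
      finally have le: "C * r \<le> (f \<omega> - C * e - a) / 2" .
      have "(f \<omega> - C * e - a) / 2 < f \<omega> - C * e - a" using \<omega>(4) by (simp add: field_simps)
      with le show ?thesis by simp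
    qed
    then have "f \<omega> - C * (e + r) > a" by (simp add: algebra_simps)
    moreover have "\<bar>F \<omega> t - g' t\<bar> \<le> e + r" if "\<forall>t\<in>{0..T}. \<bar>g t - g' t\<bar> \<le> r" "t \<in> {0..T}" for g' t
      using \<omega>(3)[OF that(2)] that by fastforce
    ultimately show "\<exists>r>0. \<forall>h\<in>mspace (path_space T). (\<forall>t\<in>{0..T}. \<bar>g t - h t\<bar> \<le> r) \<longrightarrow> h \<in> V"
      using r \<omega>(1,2) unfolding V_def
      by (intro exI[of _ r] conjI ballI impI CollectI bexI[of _ \<omega>] exI[of _ "e + r"]) auto
  qed
  then have "F -` V \<inter> space M \<in> sets M"
    using F openin_in_path_borel by (blast intro: measurable_sets)
  moreover have "F -` V \<inter> space M = {\<omega> \<in> space M. a < f \<omega>}"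
  proof (intro set_eqI iffI)
    fix \<omega> assume "\<omega> \<in> F -` V \<inter> space M"
    then obtain \<omega>' e where "\<omega> \<in> space M" "\<omega>' \<in> space M" "0 \<le> e"
      "\<And>t. t \<in> {0..T} \<Longrightarrow> \<bar>F \<omega>' t - F \<omega> t\<bar> \<le> e" "f \<omega>' - C * e > a" by (auto simp: V_def)
    moreover from this dom[of \<omega>' \<omega> e] have "\<bar>f \<omega>' - f \<omega>\<bar> \<le> C * e" by auto
    ultimately show "\<omega> \<in> {\<omega> \<in> space M. a < f \<omega>}" by auto
  next
    fix \<omega> assume "\<omega> \<in> {\<omega> \<in> space M. a < f \<omega>}"
    then show "\<omega> \<in> F -` V \<inter> space M"
      using Fm by (auto simp: V_def intro!: bexI[of _ \<omega>] exI[of _ 0])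
  qed
  ultimately show "{\<omega> \<in> space M. a < f \<omega>} \<in> sets M" by simp
qed

lemma path_eval_measurable:
  assumes "0 \<le> t" "t \<le> T"
  shows "(\<lambda>f. f t) \<in> borel_measurable (path_borel T)"
  using assms by (intro borel_measurable_path_dominated[where C=1 and F="\<lambda>f. f" and T=T]) auto


section \<open>Integral equations with additive noise\<close>

text \<open>\<open>G\<close> is the right-hand side of the hypothesis times the integrating factor
  \<open>exp (- K * t)\<close>, and the hypothesis makes its derivative nonpositive.\<close>

lemma gronwall:
  fixes u :: "real \<Rightarrow> real"
  assumes u: "continuous_on {0..T} u" and K: "0 \<le> K"
    and le: "\<And>t. 0 \<le> t \<Longrightarrow> t \<le> T \<Longrightarrow> u t \<le> a + K * integral {0..t} u"
    and t: "0 \<le> t" "t \<le> T"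
  shows "u t \<le> a * exp (K * t)"
proof -
  define G where "G = (\<lambda>t. (a + K * integral {0..t} u) * exp (- K * t))"
  have der: "((\<lambda>t. integral {0..t} u) has_real_derivative u s) (at s within {0..T})"
    if "s \<in> {0..T}" for s
    using integral_has_real_derivative[OF u that] .
  have cont: "continuous_on {0..T} (\<lambda>t. integral {0..t} u)"
    using der by (intro DERIV_continuous_on) auto
  have "G t \<le> G 0"
  proof (cases "t = 0")
    case False
    show ?thesis
    proof (rule DERIV_nonpos_imp_decreasing_open[of 0 t G])
      show "0 \<le> t" using t by simp
      show "continuous_on {0..t} G"
        unfolding G_def by (intro continuous_intros continuous_on_subset[OF cont]) (use t in auto)
      fix s assume s: "0 < s" "s < t"
      then have "at s within {0..T} = at s" using t by (intro at_within_Icc_at) auto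
      with der[of s] s t have d: "((\<lambda>t. integral {0..t} u) has_real_derivative u s) (at s)" by auto
      have "(G has_real_derivative (K * u s * exp (- K * s) - K * (a + K * integral {0..s} u) * exp (- K * s))) (at s)"
        unfolding G_def by (auto intro!: derivative_eq_intros d simp: algebra_simps)
      moreover have "K * u s * exp (- K * s) - K * (a + K * integral {0..s} u) * exp (- K * s)
        = K * exp (- K * s) * (u s - (a + K * integral {0..s} u))" by (simp add: algebra_simps)
      moreover have "K * exp (- K * s) * (u s - (a + K * integral {0..s} u)) \<le> 0"
        using le[of s] s t K by (intro mult_nonneg_nonpos) auto
      ultimately show "\<exists>y. (G has_real_derivative y) (at s) \<and> y \<le> 0" by metis
    qed
  qed simp
  then have "(a + K * integral {0..t} u) * exp (- K * t) \<le> a" by (simp add: G_def)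
  then have "a + K * integral {0..t} u \<le> a * exp (K * t)"
    by (simp add: exp_minus field_simps)
  with le[OF t] show ?thesis by simp
qed

lemma abs_integral_bound:
  fixes f :: "real \<Rightarrow> real"
  assumes "continuous_on {a..b} f" "\<And>x. x \<in> {a..b} \<Longrightarrow> \<bar>f x\<bar> \<le> B" "a \<le> b"
  shows "\<bar>integral {a..b} f\<bar> \<le> B * (b - a)"
  using integral_bound[of a b f B] assms by simp

lemma shift_continuous:
  fixes w :: "real \<Rightarrow> real"
  assumes w: "continuous_on {0..} w" and s: "0 \<le> s"
  shows "continuous_on {0..} (\<lambda>r. x + (w (s + r) - w s))"
proof -
  have "continuous_on {0..} (\<lambda>r. w (s + r))"
    by (rule continuous_on_compose2[OF w]) (use s in \<open>auto intro!: continuous_intros\<close>)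
  then show ?thesis by (intro continuous_intros)
qed

locale drift =
  fixes \<beta> :: "real \<Rightarrow> real" and L K :: real
  assumes L: "0 < L" and Lip: "\<bar>\<beta> x - \<beta> y\<bar> \<le> L * \<bar>x - y\<bar>" and bdd: "\<bar>\<beta> x\<bar> \<le> K"
begin

lemma K_nonneg: "0 \<le> K"
  using bdd[of 0] by linarith

lemma continuous_drift [continuous_intros]:
  assumes "continuous_on S f"
  shows "continuous_on S (\<lambda>x. \<beta> (f x))"
proof -
  have "L-lipschitz_on UNIV \<beta>"
    using L Lip by (auto simp: lipschitz_on_def dist_real_def)
  then have "continuous_on UNIV \<beta>" by (rule lipschitz_on_continuous_on)
  then show ?thesis using assms by (rule continuous_on_compose2) auto
qed

lemma continuous_drift_UNIV: "continuous_on UNIV \<beta>"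
  using continuous_drift[of UNIV "\<lambda>x. x"] by simp

text \<open>The finite horizon allows the comparison of solutions whose noises agree or are close
  only on \<open>{0..T}\<close>.\<close>

definition is_sol :: "(real \<Rightarrow> real) \<Rightarrow> (real \<Rightarrow> real) \<Rightarrow> real \<Rightarrow> bool" where
  "is_sol w y T \<longleftrightarrow> continuous_on {0..T} y \<and> (\<forall>t\<in>{0..T}. y t = w t + integral {0..t} (\<lambda>s. \<beta> (y s)))"

text \<open>Neither function has to be a solution: \<open>e\<close> bounds the difference of the two
  residuals. This is what lets a Newton trajectory, or the flow of another coefficient, be inserted
  into an equation that it solves only approximately.\<close>

lemma stability:
  assumes y: "continuous_on {0..T} y" and z: "continuous_on {0..T} z"
    and e: "\<And>t. 0 \<le> t \<Longrightarrow> t \<le> T \<Longrightarrow>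
      \<bar>(y t - integral {0..t} (\<lambda>s. \<beta> (y s))) - (z t - integral {0..t} (\<lambda>s. \<beta> (z s)))\<bar> \<le> e"
    and t: "0 \<le> t" "t \<le> T"
  shows "\<bar>y t - z t\<bar> \<le> e * exp (L * t)"
proof (rule gronwall[OF _ _ _ t, of "\<lambda>t. \<bar>y t - z t\<bar>"])
  show "continuous_on {0..T} (\<lambda>t. \<bar>y t - z t\<bar>)" by (intro continuous_intros y z)
  show "0 \<le> L" using L by simp
  fix t assume t: "0 \<le> t" "t \<le> T"
  have [intro]: "continuous_on {0..t} y" "continuous_on {0..t} z"
    using t by (auto intro: continuous_on_subset[OF y] continuous_on_subset[OF z])
  have i1: "(\<lambda>s. \<beta> (y s)) integrable_on {0..t}" and i2: "(\<lambda>s. \<beta> (z s)) integrable_on {0..t}"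
    by (auto intro!: integrable_continuous_real continuous_intros)
  have "\<bar>integral {0..t} (\<lambda>s. \<beta> (y s)) - integral {0..t} (\<lambda>s. \<beta> (z s))\<bar>
      = norm (integral {0..t} (\<lambda>s. \<beta> (y s) - \<beta> (z s)))"
    by (simp add: integral_diff i1 i2)
  also have "\<dots> \<le> integral {0..t} (\<lambda>s. L * \<bar>y s - z s\<bar>)"
    by (intro integral_norm_bound_integral)
      (auto intro!: integrable_continuous_real continuous_intros Lip)
  also have "\<dots> = L * integral {0..t} (\<lambda>s. \<bar>y s - z s\<bar>)" by simp
  finally show "\<bar>y t - z t\<bar> \<le> e + L * integral {0..t} (\<lambda>s. \<bar>y s - z s\<bar>)"
    using e[OF t] by linarith
qed

lemma is_sol_stability:
  assumes "is_sol w y T" "is_sol w' z T" "\<And>t. 0 \<le> t \<Longrightarrow> t \<le> T \<Longrightarrow> \<bar>w t - w' t\<bar> \<le> e"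
    and "0 \<le> t" "t \<le> T"
  shows "\<bar>y t - z t\<bar> \<le> e * exp (L * t)"
proof (rule stability[OF _ _ _ assms(4,5)])
  fix t assume "0 \<le> t" "t \<le> T"
  then have "y t = w t + integral {0..t} (\<lambda>s. \<beta> (y s))" "z t = w' t + integral {0..t} (\<lambda>s. \<beta> (z s))"
    using assms by (auto simp: is_sol_def)
  then show "\<bar>(y t - integral {0..t} (\<lambda>s. \<beta> (y s))) - (z t - integral {0..t} (\<lambda>s. \<beta> (z s)))\<bar> \<le> e"
    using assms(3)[of t] \<open>0 \<le> t\<close> \<open>t \<le> T\<close> by simp
qed (use assms in \<open>auto simp: is_sol_def\<close>)

lemma is_sol_unique:
  assumes "is_sol w y T" "is_sol w' z T" "\<And>t. 0 \<le> t \<Longrightarrow> t \<le> T \<Longrightarrow> w t = w' t" "0 \<le> t" "t \<le> T"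
  shows "y t = z t"
  using is_sol_stability[OF assms(1,2) _ assms(4,5), of 0] assms(3) by simp

text \<open>In the variable \<open>exp (- 2 * L * t) * (y t - w t)\<close> the Picard map is a contraction on all of
  \<open>[0,\<infinity>)\<close> with constant \<open>1/2\<close>.\<close>

lemma sol_exists:
  fixes w :: "real \<Rightarrow> real"
  assumes w: "continuous_on {0..} w"
  shows "\<exists>y. continuous_on {0..} y \<and> (\<forall>t\<ge>0. y t = w t + integral {0..t} (\<lambda>s. \<beta> (y s)))"
proof -
  define I where "I = (\<lambda>(z::real \<Rightarrow> real) t. integral {0..t} (\<lambda>s. \<beta> (w s + exp (2 * L * s) * z s)))"
  \<comment> \<open>The Picard map in the weighted variable. \<open>max 0 t\<close> continues it
    constantly to negative times, because the fixed point is sought among bounded continuous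
    functions on all of \<open>real\<close>.\<close>
  define A where "A = (\<lambda>z t. exp (- (2 * L * max 0 t)) * I z (max 0 t))"
  have cint: "continuous_on {0..t} (\<lambda>s. \<beta> (w s + exp (2 * L * s) * z s))"
    if "continuous_on UNIV z" for z t
    by (intro continuous_intros continuous_on_subset[OF w] continuous_on_subset[OF that]) auto
  have I_cont: "continuous_on {0..} (I z)" if "continuous_on UNIV z" for z
  proof -
    have "continuous (at t within {0..}) (I z)" if "t \<in> {0..}" for t
    proof -
      have "continuous_on {0..t+1} (I z)"
        unfolding I_def using cint[OF \<open>continuous_on UNIV z\<close>]
        by (intro indefinite_integral_continuous_1 integrable_continuous_real)
      then have "continuous (at t within {0..t+1}) (I z)"
        using that by (auto simp: continuous_on_eq_continuous_within)
      moreover have "at t within {0..t+1} = at t within {0..}"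
        using that by (intro at_within_nhd[of t "{..<t+1}"]) auto
      ultimately show ?thesis by simp
    qed
    then show ?thesis by (auto simp: continuous_on_eq_continuous_within)
  qed
  have A_bound: "\<bar>A z t\<bar> \<le> K / (2 * L)" if "continuous_on UNIV z" for z t
  proof -
    let ?m = "max 0 t"
    have "\<bar>I z ?m\<bar> \<le> K * (?m - 0)"
      unfolding I_def by (intro abs_integral_bound cint[OF that] bdd) auto
    also have "2 * L * ?m \<le> exp (2 * L * ?m)"
      using exp_ge_add_one_self[of "2 * L * ?m"] by linarith
    then have "K * (?m - 0) \<le> (K / (2 * L)) * exp (2 * L * ?m)"
      using K_nonneg L mult_left_mono[of "2 * L * ?m" "exp (2 * L * ?m)" "K / (2*L)"] by simp
    finally show ?thesis
      unfolding A_def abs_mult by (simp add: exp_minus field_simps)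
  qed
  have A_in: "A z \<in> bcontfun" if "continuous_on UNIV z" for z
  proof (rule bcontfun_normI)
    show "continuous_on UNIV (A z)"
      unfolding A_def by (intro continuous_intros continuous_on_compose2[OF I_cont[OF that]]) auto
    show "norm (A z t) \<le> K / (2 * L)" for t using A_bound[OF that] by simp
  qed
  have cz: "continuous_on UNIV (apply_bcontfun z)" for z :: "real \<Rightarrow>\<^sub>C real"
    using apply_bcontfun[of z] by (auto simp: bcontfun_def)
  define F where "F = (\<lambda>z :: real \<Rightarrow>\<^sub>C real. Bcontfun (A (apply_bcontfun z)))"
  have F_app: "apply_bcontfun (F z) t = A (apply_bcontfun z) t" for z t
    unfolding F_def using A_in[OF cz] by (simp add: Bcontfun_inverse)
  have contr: "dist (F z) (F z') \<le> 1/2 * dist z z'" for z z'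
  proof (rule dist_bound)
    fix t :: real
    let ?m = "max 0 t" let ?d = "dist z z'" let ?z = "apply_bcontfun z" let ?z' = "apply_bcontfun z'"
    have "\<bar>I ?z ?m - I ?z' ?m\<bar> = norm (integral {0..?m} (\<lambda>s. \<beta> (w s + exp (2 * L * s) * ?z s) - \<beta> (w s + exp (2 * L * s) * ?z' s)))"
      unfolding I_def by (subst integral_diff) (auto intro!: integrable_continuous_real cint cz)
    also have "\<dots> \<le> integral {0..?m} (\<lambda>s. L * ?d * exp (2 * L * s))"
    proof (rule integral_norm_bound_integral)
      fix s assume "s \<in> {0..?m}"
      have "norm (\<beta> (w s + exp (2 * L * s) * ?z s) - \<beta> (w s + exp (2 * L * s) * ?z' s))
        \<le> L * \<bar>exp (2 * L * s) * ?z s - exp (2 * L * s) * ?z' s\<bar>"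
        using Lip[of "w s + exp (2 * L * s) * ?z s" "w s + exp (2 * L * s) * ?z' s"] by simp
      also have "\<bar>exp (2 * L * s) * ?z s - exp (2 * L * s) * ?z' s\<bar> = exp (2 * L * s) * \<bar>?z s - ?z' s\<bar>"
        by (simp add: abs_mult flip: right_diff_distrib)
      also have "\<dots> \<le> exp (2 * L * s) * ?d"
        using dist_bounded[of z s z'] by (simp add: dist_real_def)
      finally show "norm (\<beta> (w s + exp (2 * L * s) * ?z s) - \<beta> (w s + exp (2 * L * s) * ?z' s)) \<le> L * ?d * exp (2 * L * s)"
        using L by (simp add: mult_ac)
    qed (intro integrable_diff integrable_continuous_real cint cz continuous_intros)+
    \<comment> \<open>The factor 1/2 is the Lipschitz constant \<open>L\<close> divided by the
      exponent \<open>2 * L\<close> of the weight.\<close>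
    also have "((\<lambda>s. L * ?d * exp (2 * L * s)) has_integral
        (?d / 2 * exp (2 * L * ?m) - ?d / 2 * exp (2 * L * 0))) {0..?m}"
      using L by (intro fundamental_theorem_of_calculus)
        (auto intro!: derivative_eq_intros simp flip: has_real_derivative_iff_has_vector_derivative)
    then have "integral {0..?m} (\<lambda>s. L * ?d * exp (2 * L * s)) = ?d / 2 * exp (2 * L * ?m) - ?d / 2"
      by (simp only: integral_unique mult_zero_right exp_zero mult_1_right)
    finally have "\<bar>I ?z ?m - I ?z' ?m\<bar> \<le> ?d / 2 * exp (2 * L * ?m)"
      using zero_le_dist[of z z'] by linarith
    then have "exp (- (2 * L * ?m)) * \<bar>I ?z ?m - I ?z' ?m\<bar> \<le> ?d / 2"
      by (simp add: exp_minus field_simps)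
    then show "dist (apply_bcontfun (F z) t) (apply_bcontfun (F z') t) \<le> 1/2 * ?d"
      unfolding F_app A_def dist_real_def right_diff_distrib[symmetric] abs_mult by simp
  qed
  obtain z where z: "F z = z"
    using banach_fix_type[of "1/2" F] contr by auto
  define y where "y = (\<lambda>t. w t + exp (2 * L * t) * apply_bcontfun z t)"
  have "continuous_on {0..} y"
    unfolding y_def by (intro continuous_intros w continuous_on_subset[OF cz]) auto
  moreover have "y t = w t + integral {0..t} (\<lambda>s. \<beta> (y s))" if "0 \<le> t" for t
  proof -
    have "apply_bcontfun z t = exp (- (2 * L * t)) * I z t"
      using F_app[of z t] that by (simp add: z A_def)
    then have "exp (2 * L * t) * apply_bcontfun z t = I z t" by (simp add: exp_minus)
    then show ?thesis by (simp add: y_def I_def)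
  qed
  ultimately show ?thesis by blast
qed

text \<open>For continuous \<open>w\<close> the values on \<open>[0,\<infinity>)\<close> are
  determined, by \<open>is_sol_unique\<close>; the values at negative times are arbitrary.\<close>

definition sol :: "(real \<Rightarrow> real) \<Rightarrow> real \<Rightarrow> real" where
  "sol w = (SOME y. continuous_on {0..} y \<and> (\<forall>t\<ge>0. y t = w t + integral {0..t} (\<lambda>s. \<beta> (y s))))"

lemma sol_props:
  assumes "continuous_on {0..} w"
  shows "continuous_on {0..} (sol w)" "0 \<le> t \<Longrightarrow> sol w t = w t + integral {0..t} (\<lambda>s. \<beta> (sol w s))"
  using someI_ex[OF sol_exists[OF assms]] unfolding sol_def by auto

lemma is_sol_sol: "continuous_on {0..} w \<Longrightarrow> is_sol w (sol w) T"
  unfolding is_sol_def using sol_props[of w] by (auto intro: continuous_on_subset)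

lemma sol_stability:
  assumes "continuous_on {0..} w" "continuous_on {0..} w'" "0 \<le> t"
    "\<And>s. 0 \<le> s \<Longrightarrow> s \<le> t \<Longrightarrow> \<bar>w s - w' s\<bar> \<le> e"
  shows "\<bar>sol w t - sol w' t\<bar> \<le> e * exp (L * t)"
  using assms by (intro is_sol_stability[where T=t and w=w and w'=w'] is_sol_sol) auto

lemma sol_cong:
  assumes "continuous_on {0..} w" "continuous_on {0..} w'" "0 \<le> t"
    "\<And>s. 0 \<le> s \<Longrightarrow> s \<le> t \<Longrightarrow> w s = w' s"
  shows "sol w t = sol w' t"
  using sol_stability[OF assms(1-3), of 0] assms(4) by simp

lemma sol_minus_noise:
  assumes "continuous_on {0..} w" "0 \<le> t"
  shows "\<bar>sol w t - w t\<bar> \<le> K * t"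
proof -
  have "\<bar>integral {0..t} (\<lambda>s. \<beta> (sol w s))\<bar> \<le> K * (t - 0)"
    using assms by (intro abs_integral_bound bdd continuous_intros continuous_on_subset[OF sol_props(1)]) auto
  then show ?thesis using sol_props(2)[OF assms] by simp
qed

lemma sol_0: "continuous_on {0..} w \<Longrightarrow> sol w 0 = w 0"
  using sol_props(2)[of w 0] by simp

text \<open>The deterministic core of the Markov property: after time \<open>s\<close> the solution
  depends on the past only through its value at \<open>s\<close>, and otherwise on the increments of
  \<open>w\<close> after \<open>s\<close>.\<close>

lemma sol_flow:
  assumes w: "continuous_on {0..} w" and st: "0 \<le> s" "0 \<le> t"
  shows "sol w (s + t) = sol (\<lambda>r. sol w s + (w (s + r) - w s)) t"
proof (rule is_sol_unique[where T=t and y="\<lambda>r. sol w (s + r)" and w'="\<lambda>r. sol w s + (w (s + r) - w s)"])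
  let ?w = "\<lambda>r. sol w s + (w (s + r) - w s)"
  show "is_sol ?w (sol ?w) t" by (intro is_sol_sol shift_continuous w st)
  have c: "continuous_on {0..} (\<lambda>r. \<beta> (sol w r))" by (intro continuous_intros sol_props(1) w)
  show "is_sol ?w (\<lambda>r. sol w (s + r)) t"
    unfolding is_sol_def
  proof (intro conjI ballI)
    show "continuous_on {0..t} (\<lambda>r. sol w (s + r))"
      using st by (intro continuous_intros continuous_on_compose2[OF sol_props(1)[OF w]]) auto
    fix r assume r: "r \<in> {0..t}"
    have "integral {0..s} (\<lambda>r. \<beta> (sol w r)) + integral {s..s+r} (\<lambda>r. \<beta> (sol w r)) = integral {0..s+r} (\<lambda>r. \<beta> (sol w r))"
      using st r by (intro Henstock_Kurzweil_Integration.integral_combine integrable_continuous_real continuous_on_subset[OF c]) auto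
    moreover have "integral {s..s+r} (\<lambda>r. \<beta> (sol w r)) = integral {0..r} (\<lambda>x. \<beta> (sol w (s + x)))"
      using integral_shift_Icc_real[of 0 r "\<lambda>r. \<beta> (sol w r)" s] by (simp add: o_def add.commute)
    ultimately show "sol w (s + r) = ?w r + integral {0..r} (\<lambda>x. \<beta> (sol w (s + x)))"
      using sol_props(2)[OF w, of "s+r"] sol_props(2)[OF w, of s] st r by simp
  qed
qed (use st in auto)

end


section \<open>Mollified paths and Newton's equation\<close>

lemma continuous_on_Icc_abs_bounded:
  fixes f :: "real \<Rightarrow> real"
  assumes "continuous_on {a..b} f"
  obtains C where "0 \<le> C" "\<And>x. a \<le> x \<Longrightarrow> x \<le> b \<Longrightarrow> \<bar>f x\<bar> \<le> C"
proof -
  have "bounded (f ` {a..b})"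
    using assms by (intro compact_imp_bounded compact_continuous_image) auto
  then obtain C where "0 < C" "\<forall>x\<in>f ` {a..b}. norm x \<le> C"
    by (auto simp: bounded_pos)
  then show ?thesis using that[of C] by simp
qed

lemma smoothing_kernel_deriv:
  assumes "smoothing_kernel \<rho>"
  shows "(\<rho> has_real_derivative deriv \<rho> x) (at x)" "continuous_on UNIV (deriv \<rho>)"
proof -
  have s: "((deriv ^^ n) \<rho>) field_differentiable (at x)" for n x
    using assms by (auto simp: smoothing_kernel_def smooth_def)
  show "(\<rho> has_real_derivative deriv \<rho> x) (at x)"
    using s[of 0 x] by (simp add: DERIV_deriv_iff_field_differentiable)
  show "continuous_on UNIV (deriv \<rho>)"
    using s[of 1] by (auto intro!: continuous_at_imp_continuous_on field_differentiable_imp_continuous_at)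
qed

lemma smoothing_kernel_continuous:
  assumes "smoothing_kernel \<rho>" shows "continuous_on S \<rho>"
proof -
  have "continuous_on UNIV \<rho>"
    using smoothing_kernel_deriv(1)[OF assms] by (intro DERIV_continuous_on) (auto intro: DERIV_subset)
  then show ?thesis by (rule continuous_on_subset) auto
qed

lemma smoothing_kernel_outside: "smoothing_kernel \<rho> \<Longrightarrow> x \<notin> {0..1} \<Longrightarrow> \<rho> x = 0"
  unfolding smoothing_kernel_def by blast

lemma smoothing_kernel_integral:
  assumes "smoothing_kernel \<rho>" shows "integral {0..1} \<rho> = 1"
  using assms set_borel_integral_eq_integral(2)[OF borel_integrable_atLeastAtMost'[OF smoothing_kernel_continuous[OF assms]], of 0 1]
  by (simp add: smoothing_kernel_def)

lemma smoothing_kernel_bounded: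
  assumes "smoothing_kernel \<rho>"
  obtains R where "0 \<le> R" "\<And>x. \<bar>\<rho> x\<bar> \<le> R"
proof -
  obtain R where "0 \<le> R" and R: "\<And>x. 0 \<le> x \<Longrightarrow> x \<le> 1 \<Longrightarrow> \<bar>\<rho> x\<bar> \<le> R"
    using continuous_on_Icc_abs_bounded[OF smoothing_kernel_continuous[OF assms]] by blast
  have "\<bar>\<rho> x\<bar> \<le> R" for x
    using R[of x] smoothing_kernel_outside[OF assms, of x] \<open>0 \<le> R\<close> by (cases "x \<in> {0..1}") auto
  then show ?thesis using that \<open>0 \<le> R\<close> by blast
qed

text \<open>The window \<open>{a..b}\<close> is left free for two uses:
  \<open>{t..t + \<delta>}\<close> gives an average, and a window that does not depend on
  \<open>t\<close> allows differentiation under the integral.\<close>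

lemma mollified_eq_integral:
  assumes \<rho>: "smoothing_kernel \<rho>" and \<delta>: "0 < \<delta>" and w: "continuous_on {0..} w"
    and sub: "0 \<le> a" and vanish: "\<And>s. 0 \<le> s \<Longrightarrow> s \<notin> {a..b} \<Longrightarrow> (s - t) / \<delta> \<notin> {0..1}"
  shows "mollified \<rho> \<delta> w t = 1 / \<delta> * integral {a..b} (\<lambda>s. w s * \<rho> ((s - t) / \<delta>))"
proof -
  have "(LBINT s:{0..}. w s * \<rho> ((s - t) / \<delta>)) = (LBINT s:{a..b}. w s * \<rho> ((s - t) / \<delta>))"
    unfolding set_lebesgue_integral_def
  proof (rule Bochner_Integration.integral_cong[OF refl])
    fix s :: real
    show "indicator {0..} s *\<^sub>R (w s * \<rho> ((s - t) / \<delta>)) = indicator {a..b} s *\<^sub>R (w s * \<rho> ((s - t) / \<delta>))"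
    proof (cases "0 \<le> s \<and> s \<notin> {a..b}")
      case True
      then have "\<rho> ((s - t) / \<delta>) = 0" using vanish smoothing_kernel_outside[OF \<rho>] by blast
      then show ?thesis by simp
    qed (use sub in \<open>auto simp: indicator_def\<close>)
  qed
  also have "\<dots> = integral {a..b} (\<lambda>s. w s * \<rho> ((s - t) / \<delta>))"
    using \<delta> sub by (intro set_borel_integral_eq_integral(2) borel_integrable_atLeastAtMost' continuous_intros
      continuous_on_subset[OF w] continuous_on_compose2[OF smoothing_kernel_continuous[OF \<rho>, of UNIV]]) auto
  finally show ?thesis by (simp add: mollified_def)
qed

text \<open>For \<open>t \<ge> 0\<close> the support \<open>[t, t + \<delta>]\<close> of the kernel
  is not cut off at time 0. The kernel looks ahead, which is why the path up to
  \<open>T + \<delta>\<close> matters in what follows.\<close>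

lemma mollified_average:
  assumes \<rho>: "smoothing_kernel \<rho>" and \<delta>: "0 < \<delta>" and w: "continuous_on {0..} w" and t: "0 \<le> t"
  shows "mollified \<rho> \<delta> w t = integral {0..1} (\<lambda>r. w (t + \<delta> * r) * \<rho> r)"
proof -
  let ?f = "\<lambda>s. w s * \<rho> ((s - t) / \<delta>)"
  have 1: "mollified \<rho> \<delta> w t = 1 / \<delta> * integral {t..t+\<delta>} ?f"
    using \<delta> t by (intro mollified_eq_integral[OF \<rho> \<delta> w]) (auto simp: field_simps)
  have "continuous_on {t..t+\<delta>} ?f"
    using \<delta> t by (intro continuous_intros continuous_on_subset[OF w] continuous_on_compose2[OF smoothing_kernel_continuous[OF \<rho>, of UNIV]]) auto
  then have "(?f has_integral integral {t..t+\<delta>} ?f) (cbox t (t+\<delta>))"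
    by (auto intro!: integrable_integral integrable_continuous_real)
  moreover have "(\<delta> * x + t - t) / \<delta> = x" for x using \<delta> by simp
  ultimately have "((\<lambda>x. w (\<delta> * x + t) * \<rho> x) has_integral (integral {t..t+\<delta>} ?f / \<delta>)) {0..1}"
    using has_integral_affinity'[of ?f "integral {t..t+\<delta>} ?f" t "t+\<delta>" \<delta> t] \<delta>
    by (simp only: box_real real_scaleR_def DIM_real power_one_right divide_inverse_commute)
      (simp add: mult.assoc[symmetric])
  then show ?thesis unfolding 1 by (simp add: integral_unique add.commute)
qed

text \<open>The kernel may change sign, so its supremum bound \<open>R\<close> appears where a
  probability density would give the constant 1.\<close>

lemma mollified_diff_le:
  assumes \<rho>: "smoothing_kernel \<rho>" and R: "\<And>x. \<bar>\<rho> x\<bar> \<le> R" and \<delta>: "0 < \<delta>"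
    and w: "continuous_on {0..} w" and w': "continuous_on {0..} w'" and t: "0 \<le> t" "t \<le> T"
    and e: "\<And>s. 0 \<le> s \<Longrightarrow> s \<le> T + \<delta> \<Longrightarrow> \<bar>w s - w' s\<bar> \<le> e"
  shows "\<bar>mollified \<rho> \<delta> w t - mollified \<rho> \<delta> w' t\<bar> \<le> R * e"
proof -
  have c: "continuous_on {0..1} (\<lambda>r. f (t + \<delta> * r) * \<rho> r)" if "continuous_on {0..} f" for f :: "real \<Rightarrow> real"
    by (intro continuous_on_mult smoothing_kernel_continuous[OF \<rho>] continuous_on_compose2[OF that])
      (use t \<delta> in \<open>auto intro!: continuous_intros\<close>)
  have "mollified \<rho> \<delta> w t - mollified \<rho> \<delta> w' t = integral {0..1} (\<lambda>r. w (t + \<delta> * r) * \<rho> r - w' (t + \<delta> * r) * \<rho> r)"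
    unfolding mollified_average[OF \<rho> \<delta> w t(1)] mollified_average[OF \<rho> \<delta> w' t(1)]
    by (subst integral_diff) (auto intro!: integrable_continuous_real c w w')
  moreover have "\<bar>\<dots>\<bar> \<le> R * e * (1 - 0)"
  proof (rule abs_integral_bound)
    show "continuous_on {0..1} (\<lambda>r. w (t + \<delta> * r) * \<rho> r - w' (t + \<delta> * r) * \<rho> r)"
      by (intro continuous_on_diff c w w')
    fix r :: real assume r: "r \<in> {0..1}"
    have "\<delta> * r \<le> \<delta>" using r \<delta> by (simp add: mult_left_le)
    then have "\<bar>w (t + \<delta> * r) - w' (t + \<delta> * r)\<bar> \<le> e"
      using t r \<delta> by (intro e add_mono) auto
    then have "\<bar>\<rho> r\<bar> * \<bar>w (t + \<delta> * r) - w' (t + \<delta> * r)\<bar> \<le> R * e"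
      using R[of r] by (intro mult_mono) auto
    then show "\<bar>w (t + \<delta> * r) * \<rho> r - w' (t + \<delta> * r) * \<rho> r\<bar> \<le> R * e"
      by (simp add: abs_mult[symmetric] algebra_simps)
  qed simp
  ultimately show ?thesis by simp
qed

lemma mollified_approx:
  assumes \<rho>: "smoothing_kernel \<rho>" and R: "\<And>x. \<bar>\<rho> x\<bar> \<le> R" and \<delta>: "0 < \<delta>"
    and w: "continuous_on {0..} w" and t: "0 \<le> t"
    and e: "\<And>s. t \<le> s \<Longrightarrow> s \<le> t + \<delta> \<Longrightarrow> \<bar>w s - w t\<bar> \<le> e"
  shows "\<bar>mollified \<rho> \<delta> w t - w t\<bar> \<le> R * e"
proof -
  have c: "continuous_on {0..1} (\<lambda>r. w (t + \<delta> * r) * \<rho> r)"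
    by (intro continuous_on_mult smoothing_kernel_continuous[OF \<rho>] continuous_on_compose2[OF w])
      (use t \<delta> in \<open>auto intro!: continuous_intros\<close>)
  have c': "continuous_on {0..1} (\<lambda>r. w t * \<rho> r)"
    by (intro continuous_intros smoothing_kernel_continuous[OF \<rho>])
  have "integral {0..1} (\<lambda>r. w t * \<rho> r) = w t"
    by (simp add: smoothing_kernel_integral[OF \<rho>])
  then have "mollified \<rho> \<delta> w t - w t = integral {0..1} (\<lambda>r. w (t + \<delta> * r) * \<rho> r - w t * \<rho> r)"
    unfolding mollified_average[OF \<rho> \<delta> w t]
    by (subst integral_diff) (auto intro!: integrable_continuous_real c c')
  moreover have "\<bar>\<dots>\<bar> \<le> R * e * (1 - 0)"
  proof (rule abs_integral_bound)
    show "continuous_on {0..1} (\<lambda>r. w (t + \<delta> * r) * \<rho> r - w t * \<rho> r)"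
      by (intro continuous_on_diff c c')
    fix r :: real assume r: "r \<in> {0..1}"
    have "\<bar>w (t + \<delta> * r) - w t\<bar> \<le> e"
      using t r \<delta> mult_left_mono[of r 1 \<delta>] by (intro e) auto
    then have "\<bar>\<rho> r\<bar> * \<bar>w (t + \<delta> * r) - w t\<bar> \<le> R * e"
      using R[of r] by (intro mult_mono) auto
    then show "\<bar>w (t + \<delta> * r) * \<rho> r - w t * \<rho> r\<bar> \<le> R * e"
      by (simp add: abs_mult[symmetric] algebra_simps)
  qed simp
  ultimately show ?thesis by simp
qed

text \<open>\<open>deriv\<close> in Newton's equation is two-sided even at time 0, so the mollified
  path has to be differentiated in a neighbourhood of \<open>{0..T}\<close> that contains negative
  times.\<close>

lemma mollified_deriv:
  assumes \<rho>: "smoothing_kernel \<rho>" and \<delta>: "0 < \<delta>" and w: "continuous_on {0..} w" and T: "0 \<le> T"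
  shows "\<exists>C. \<forall>t\<in>{0..T}. (mollified \<rho> \<delta> w has_real_derivative deriv (mollified \<rho> \<delta> w) t) (at t)
    \<and> \<bar>deriv (mollified \<rho> \<delta> w) t\<bar> \<le> C"
proof -
  \<comment> \<open>\<open>T + 1 + \<delta>\<close> lies beyond the support of the kernel for every
    \<open>t < T + 1\<close>.\<close>
  define B where "B = T + 1 + \<delta>"
  define g where "g = (\<lambda>t s. w s * (deriv \<rho> ((s - t) / \<delta>) * (- 1 / \<delta>)))"
  define D where "D = (\<lambda>t. 1 / \<delta> * integral {0..B} (g t))"
  have eq: "mollified \<rho> \<delta> w t = 1 / \<delta> * integral {0..B} (\<lambda>s. w s * \<rho> ((s - t) / \<delta>))" if "t \<in> {-1<..<T+1}" for t
    using \<delta> T that by (intro mollified_eq_integral[OF \<rho> \<delta> w]) (auto simp: B_def field_simps)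
  have cg: "continuous_on {0..B} (g t)" for t
    unfolding g_def using \<delta>
    by (intro continuous_intros continuous_on_subset[OF w] continuous_on_compose2[OF smoothing_kernel_deriv(2)[OF \<rho>]]) auto
  have D: "(mollified \<rho> \<delta> w has_real_derivative D t) (at t)" if t: "t \<in> {0..T}" for t
  proof -
    have "((\<lambda>t. integral (cbox 0 B) (\<lambda>s. w s * \<rho> ((s - t) / \<delta>))) has_real_derivative integral (cbox 0 B) (g t)) (at t within {-1<..<T+1})"
    proof (rule leibniz_rule_field_derivative)
      show "((\<lambda>t. w s * \<rho> ((s - t) / \<delta>)) has_real_derivative g t s) (at t within {-1<..<T+1})" for t s
        unfolding g_def
        by (intro DERIV_cmult DERIV_chain2[where f=\<rho>, OF smoothing_kernel_deriv(1)[OF \<rho>]])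
          (use \<delta> in \<open>auto intro!: derivative_eq_intros\<close>)
      show "(\<lambda>s. w s * \<rho> ((s - t) / \<delta>)) integrable_on cbox 0 B" for t
        unfolding box_real using \<delta>
        by (intro integrable_continuous_real continuous_intros continuous_on_subset[OF w]
            continuous_on_compose2[OF smoothing_kernel_continuous[OF \<rho>, of UNIV]]) auto
      show "continuous_on ({- 1<..<T + 1} \<times> cbox 0 B) (\<lambda>(t, s). g t s)"
        unfolding g_def split_beta using \<delta>
        by (intro continuous_intros continuous_on_compose2[OF w] continuous_on_compose2[OF smoothing_kernel_deriv(2)[OF \<rho>]]) auto
    qed (use t in auto)
    then have "((\<lambda>t. 1 / \<delta> * integral {0..B} (\<lambda>s. w s * \<rho> ((s - t) / \<delta>))) has_real_derivative D t) (at t)"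
      unfolding D_def using t by (intro DERIV_cmult) (auto simp: at_within_open[of t "{-1<..<T+1}"])
    then show ?thesis
      by (rule has_field_derivative_transform_within_open[of _ _ _ "{-1<..<T+1}"]) (use t eq in auto)
  qed
  have B0: "0 \<le> B" using T \<delta> by (simp add: B_def)
  obtain C1 where C10: "0 \<le> C1" and C1: "\<And>s. 0 \<le> s \<Longrightarrow> s \<le> B \<Longrightarrow> \<bar>w s\<bar> \<le> C1"
    using continuous_on_Icc_abs_bounded[OF continuous_on_subset[OF w, of "{0..B}"]] by auto
  obtain C2 where C2: "\<And>s. -T/\<delta> \<le> s \<Longrightarrow> s \<le> B/\<delta> \<Longrightarrow> \<bar>deriv \<rho> s\<bar> \<le> C2"
    using continuous_on_Icc_abs_bounded[OF continuous_on_subset[OF smoothing_kernel_deriv(2)[OF \<rho>], of "{-T/\<delta>..B/\<delta>}"]] by auto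
  have "\<bar>D t\<bar> \<le> 1 / \<delta> * (C1 * (C2 * (1 / \<delta>)) * (B - 0))" if t: "t \<in> {0..T}" for t
  proof -
    have "\<bar>integral {0..B} (g t)\<bar> \<le> C1 * (C2 * (1 / \<delta>)) * (B - 0)"
    proof (rule abs_integral_bound[OF cg _ B0])
      fix s assume s: "s \<in> {0..B}"
      have "-T/\<delta> \<le> (s - t) / \<delta>" "(s - t) / \<delta> \<le> B/\<delta>"
        using s t \<delta> T B0 by (intro divide_right_mono; simp)+
      from C2[OF this] C1[of s] s C10 show "\<bar>g t s\<bar> \<le> C1 * (C2 * (1 / \<delta>))"
        unfolding g_def abs_mult using \<delta> by (intro mult_mono) (auto simp: divide_right_mono)
    qed
    then show ?thesis unfolding D_def abs_mult using \<delta> by (intro mult_mono) auto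
  qed
  with D show ?thesis by (metis DERIV_imp_deriv)
qed

text \<open>The velocity bound in the last conclusion does not involve \<mu>: friction relaxes
  \<open>x'\<close> at a rate of at least \<open>c / \<mu>\<close>, while the force contributes at
  most \<open>C / \<mu>\<close>. Hence the inertial term \<open>\<mu> * x'\<close> disappears in the
  limit.\<close>

lemma newton_solution_integrated:
  assumes sol: "newton_solution \<mu> b l w q p x" and \<mu>: "0 < \<mu>"
    and \<Lambda>: "\<And>x. (\<Lambda> has_real_derivative l x) (at x)" and l: "continuous_on UNIV l"
    and b: "continuous_on UNIV b" and c: "0 < c" "\<And>x. c \<le> l x"
    and w: "\<And>t. 0 \<le> t \<Longrightarrow> (w has_real_derivative deriv w t) (at t)"
  obtains x' where "continuous_on {0..} x" "continuous_on {0..} x'" "x 0 = q" "x' 0 = p"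
    "\<And>t. 0 \<le> t \<Longrightarrow> (x has_real_derivative x' t) (at t within {0..})"
    "\<And>t. 0 \<le> t \<Longrightarrow> \<mu> * x' t + \<Lambda> (x t) = \<mu> * p + \<Lambda> q + integral {0..t} (\<lambda>s. b (x s)) + (w t - w 0)"
    "\<And>t T C. 0 \<le> t \<Longrightarrow> t \<le> T \<Longrightarrow> (\<And>s. 0 \<le> s \<Longrightarrow> s \<le> T \<Longrightarrow> \<bar>b (x s) + deriv w s\<bar> \<le> C) \<Longrightarrow> \<bar>x' t\<bar> \<le> \<bar>p\<bar> + C / c"
proof -
  from sol obtain x' x'' where ini: "x 0 = q" "x' 0 = p"
    and dx: "\<And>t. 0 \<le> t \<Longrightarrow> (x has_real_derivative x' t) (at t within {0..})"
    and dx': "\<And>t. 0 \<le> t \<Longrightarrow> (x' has_real_derivative x'' t) (at t within {0..})"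
    and eq: "\<And>t. 0 \<le> t \<Longrightarrow> \<mu> * x'' t = b (x t) - l (x t) * x' t + deriv w t"
    unfolding newton_solution_def by auto
  have cx: "continuous_on {0..} x" and cx': "continuous_on {0..} x'"
    using dx dx' by (auto intro!: DERIV_continuous_on)
  have cbx: "continuous_on {0..T} (\<lambda>s. b (x s))" and clx: "continuous_on {0..T} (\<lambda>s. l (x s))" for T
    by (auto intro!: continuous_on_compose2[OF b] continuous_on_compose2[OF l] continuous_on_subset[OF cx])
  have int_eq: "\<mu> * x' t + \<Lambda> (x t) = \<mu> * p + \<Lambda> q + integral {0..t} (\<lambda>s. b (x s)) + (w t - w 0)" if t: "0 \<le> t" for t
  proof -
    define G where "G = (\<lambda>t. \<mu> * x' t + \<Lambda> (x t) - integral {0..t} (\<lambda>s. b (x s)) - w t)"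
    have "\<exists>c. \<forall>s\<in>{0..t}. G s = c"
    proof (rule has_field_derivative_zero_constant)
      fix s assume s: "s \<in> {0..t}"
      have 1: "(x has_real_derivative x' s) (at s within {0..t})" "(x' has_real_derivative x'' s) (at s within {0..t})"
        using dx[of s] dx'[of s] s by (auto intro: DERIV_subset)
      have 2: "((\<lambda>s. \<Lambda> (x s)) has_real_derivative l (x s) * x' s) (at s within {0..t})"
        using DERIV_chain2[OF \<Lambda> 1(1)] .
      have 3: "((\<lambda>u. integral {0..u} (\<lambda>s. b (x s))) has_real_derivative b (x s)) (at s within {0..t})"
        by (rule integral_has_real_derivative[OF cbx s])
      have 4: "(w has_real_derivative deriv w s) (at s within {0..t})"
        using w[of s] s by (auto intro: DERIV_subset)
      have "(G has_real_derivative (\<mu> * x'' s + l (x s) * x' s - b (x s) - deriv w s)) (at s within {0..t})"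
        unfolding G_def by (intro DERIV_diff DERIV_add DERIV_cmult 1 2 3 4)
      then show "(G has_real_derivative 0) (at s within {0..t})" using eq[of s] s by simp
    qed simp
    then have "G t = G 0" using t by (metis atLeastAtMost_iff order_refl)
    then show ?thesis by (simp add: G_def ini)
  qed
  have bound: "\<bar>x' t\<bar> \<le> \<bar>p\<bar> + C / c" if t: "0 \<le> t" "t \<le> T"
    and C: "\<And>s. 0 \<le> s \<Longrightarrow> s \<le> T \<Longrightarrow> \<bar>b (x s) + deriv w s\<bar> \<le> C" for t T C
  proof -
    \<comment> \<open>\<open>exp A\<close> is the integrating factor of the linear equation for
      \<open>x'\<close>. At the speed \<open>C / c\<close> the friction balances any force up to
      \<open>C\<close>, so the deviation from this speed is what \<open>G\<close> below
      tracks.\<close>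
    define A where "A = (\<lambda>t. integral {0..t} (\<lambda>s. l (x s)) / \<mu>)"
    have dA: "(A has_real_derivative l (x s) / \<mu>) (at s within {0..T})" if "s \<in> {0..T}" for s
      unfolding A_def by (intro DERIV_cdivide integral_has_real_derivative[OF clx that])
    have cA: "continuous_on {0..T} A" using dA by (rule DERIV_continuous_on)
    have A0: "0 \<le> A t"
      unfolding A_def using \<mu> c less_imp_le[OF order_less_le_trans[OF c(1) c(2)]]
      by (intro divide_nonneg_pos integral_nonneg integrable_continuous_real clx) auto
    have C0: "0 \<le> C" using C[of 0] t by auto
    \<comment> \<open>\<sigma> is a sign, so that one argument bounds \<open>x'\<close> from above
      and from below.\<close>
    have half: "\<sigma> * x' t \<le> \<bar>p\<bar> + C / c" if \<sigma>: "\<sigma> = 1 \<or> \<sigma> = -1" for \<sigma> :: real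
    proof -
      define G where "G = (\<lambda>t. C / c * exp (A t) - \<sigma> * x' t * exp (A t))"
      have "G 0 \<le> G t"
      proof (cases "t = 0")
        case False
        show ?thesis
        proof (rule DERIV_nonneg_imp_increasing_open[of 0 t G])
          show "0 \<le> t" using t by simp
          show "continuous_on {0..t} G"
            unfolding G_def using t by (intro continuous_intros continuous_on_subset[OF cA] continuous_on_subset[OF cx']) auto
          fix s assume s: "0 < s" "s < t"
          have a1: "at s within {0..T} = at s" using s t by (intro at_within_Icc_at) auto
          have a2: "at s within {0..} = at s" using s by (intro at_within_interior) auto
          have 1: "(A has_real_derivative l (x s) / \<mu>) (at s)" "(x' has_real_derivative x'' s) (at s)"
            using dA[of s] dx'[of s] s t by (auto simp: a1 a2)
          have "(G has_real_derivative (C / c * (exp (A s) * (l (x s) / \<mu>)) -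
              (\<sigma> * x'' s * exp (A s) + exp (A s) * (l (x s) / \<mu>) * (\<sigma> * x' s)))) (at s)"
            unfolding G_def by (intro DERIV_diff DERIV_mult DERIV_cmult DERIV_fun_exp 1)
          moreover have "C / c * (exp (A s) * (l (x s) / \<mu>)) -
              (\<sigma> * x'' s * exp (A s) + exp (A s) * (l (x s) / \<mu>) * (\<sigma> * x' s))
            = exp (A s) / \<mu> * (C / c * l (x s) - \<sigma> * (\<mu> * x'' s + l (x s) * x' s))"
            using \<mu> c(1) by (simp add: field_simps)
          moreover have "\<mu> * x'' s + l (x s) * x' s = b (x s) + deriv w s" using eq[of s] s by simp
          moreover have "\<sigma> * (b (x s) + deriv w s) \<le> C / c * l (x s)"
          proof -
            have "\<sigma> * (b (x s) + deriv w s) \<le> C" using C[of s] s t \<sigma> by auto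
            also have "C = C / c * c" using c by simp
            also have "\<dots> \<le> C / c * l (x s)" using C0 c by (intro mult_left_mono) auto
            finally show ?thesis .
          qed
          ultimately show "\<exists>y. (G has_real_derivative y) (at s) \<and> 0 \<le> y"
            using \<mu> by (intro exI[of _ "C / c * (exp (A s) * (l (x s) / \<mu>)) -
              (\<sigma> * x'' s * exp (A s) + exp (A s) * (l (x s) / \<mu>) * (\<sigma> * x' s))"]) (auto intro!: mult_nonneg_nonneg)
        qed
      qed simp
      then have "\<sigma> * x' t * exp (A t) \<le> C / c * exp (A t) - C / c + \<sigma> * p"
        by (simp add: G_def A_def ini)
      also have "\<dots> \<le> C / c * exp (A t) + \<bar>p\<bar>"
      proof -
        have "\<sigma> * p \<le> \<bar>p\<bar>" using \<sigma> by auto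
        moreover have "0 \<le> C / c" using C0 c(1) by simp
        ultimately show ?thesis by linarith
      qed
      also have "\<dots> \<le> C / c * exp (A t) + \<bar>p\<bar> * exp (A t)"
        using A0 by (simp add: mult_le_cancel_left1)
      finally have "\<sigma> * x' t * exp (A t) \<le> (\<bar>p\<bar> + C / c) * exp (A t)"
        by (simp add: distrib_right)
      then show ?thesis by (rule mult_right_le_imp_le) simp
    qed
    from half[of 1] half[of "-1"] show ?thesis by auto
  qed
  show ?thesis
    by (rule that[OF cx cx' ini]) (erule dx | erule int_eq | (rule bound, assumption, assumption, blast))+
qed

text \<open>The constants degenerate as \<mu> tends to 0. The estimate is meant for fixed \<mu>: it
  makes the trajectory a Lipschitz function of the noise, from which its measurability in \<omega>
  follows.\<close>

lemma newton_solution_stability: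
  assumes x: "continuous_on {0..} x" "continuous_on {0..} x'" "x 0 = q"
      "\<And>t. 0 \<le> t \<Longrightarrow> (x has_real_derivative x' t) (at t within {0..})"
      "\<And>t. 0 \<le> t \<Longrightarrow> \<mu> * x' t + \<Lambda> (x t) = a + integral {0..t} (\<lambda>s. b (x s)) + w t"
    and z: "continuous_on {0..} z" "continuous_on {0..} z'" "z 0 = q"
      "\<And>t. 0 \<le> t \<Longrightarrow> (z has_real_derivative z' t) (at t within {0..})"
      "\<And>t. 0 \<le> t \<Longrightarrow> \<mu> * z' t + \<Lambda> (z t) = a + integral {0..t} (\<lambda>s. b (z s)) + v t"
    and \<mu>: "0 < \<mu>" and L: "0 \<le> L" "\<And>x y. \<bar>b x - b y\<bar> \<le> L * \<bar>x - y\<bar>" "\<And>x y. \<bar>\<Lambda> x - \<Lambda> y\<bar> \<le> C * \<bar>x - y\<bar>"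
    and b: "continuous_on UNIV b"
    and e: "0 \<le> e" "\<And>t. 0 \<le> t \<Longrightarrow> t \<le> T \<Longrightarrow> \<bar>w t - v t\<bar> \<le> e"
    and t: "0 \<le> t" "t \<le> T"
  shows "\<bar>x t - z t\<bar> \<le> (T / \<mu> * e) * exp ((C + L * T) / \<mu> * t)"
proof (rule gronwall[OF _ _ _ t, of "\<lambda>t. \<bar>x t - z t\<bar>"])
  have C: "0 \<le> C" using L(3)[of 0 1] by auto
  show "continuous_on {0..T} (\<lambda>t. \<bar>x t - z t\<bar>)"
    by (intro continuous_intros continuous_on_subset[OF x(1)] continuous_on_subset[OF z(1)]) auto
  show "0 \<le> (C + L * T) / \<mu>" using C L(1) \<mu> t by simp
  fix t assume t: "0 \<le> t" "t \<le> T"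
  define J where "J = integral {0..t} (\<lambda>s. \<bar>x s - z s\<bar>)"
  have cd: "continuous_on {0..s} (\<lambda>s. \<bar>x s - z s\<bar>)" for s
    by (intro continuous_intros continuous_on_subset[OF x(1)] continuous_on_subset[OF z(1)]) auto
  have cb: "continuous_on {0..s} (\<lambda>s. b (x s))" "continuous_on {0..s} (\<lambda>s. b (z s))" for s
    by (auto intro!: continuous_on_compose2[OF b] continuous_on_subset[OF x(1)] continuous_on_subset[OF z(1)])
  have J0: "0 \<le> J" unfolding J_def by (intro integral_nonneg integrable_continuous_real cd) auto
  have "((\<lambda>s. x' s - z' s) has_integral ((x t - z t) - (x 0 - z 0))) {0..t}"
  proof (rule fundamental_theorem_of_calculus[OF t(1)])
    fix s assume "s \<in> {0..t}"
    then have "((\<lambda>t. x t - z t) has_real_derivative x' s - z' s) (at s within {0..t})"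
      using x(4)[of s] z(4)[of s] by (intro DERIV_diff) (auto intro: DERIV_subset)
    then show "((\<lambda>t. x t - z t) has_vector_derivative x' s - z' s) (at s within {0..t})"
      by (simp add: has_real_derivative_iff_has_vector_derivative)
  qed
  then have "\<bar>x t - z t\<bar> = norm (integral {0..t} (\<lambda>s. x' s - z' s))"
    using x(3) z(3) by (simp add: integral_unique)
  also have "\<dots> \<le> integral {0..t} (\<lambda>s. (C / \<mu>) * \<bar>x s - z s\<bar> + (L * J + e) / \<mu>)"
  proof (rule integral_norm_bound_integral)
    show "(\<lambda>s. x' s - z' s) integrable_on {0..t}"
      by (intro integrable_continuous_real continuous_intros continuous_on_subset[OF x(2)] continuous_on_subset[OF z(2)]) auto
    show "(\<lambda>s. (C / \<mu>) * \<bar>x s - z s\<bar> + (L * J + e) / \<mu>) integrable_on {0..t}"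
      by (intro integrable_continuous_real continuous_on_add continuous_on_mult continuous_on_const cd)
    fix s assume s: "s \<in> {0..t}"
    have "norm (integral {0..s} (\<lambda>s. b (x s) - b (z s))) \<le> integral {0..s} (\<lambda>s. L * \<bar>x s - z s\<bar>)"
      by (intro integral_norm_bound_integral integrable_diff integrable_continuous_real cb continuous_on_mult continuous_on_const cd)
        (simp add: L(2))
    also have "\<dots> = L * integral {0..s} (\<lambda>s. \<bar>x s - z s\<bar>)" by simp
    \<comment> \<open>Enlarging the inner integral from \<open>{0..s}\<close> to
      \<open>{0..t}\<close> replaces a double integral by a single one, at the price of a factor
      \<open>T\<close> in the rate of growth.\<close>
    also have "\<dots> \<le> L * J"
      unfolding J_def using s by (intro mult_left_mono[OF integral_subset_le L(1)] integrable_continuous_real cd) auto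
    finally have 1: "\<bar>integral {0..s} (\<lambda>s. b (x s)) - integral {0..s} (\<lambda>s. b (z s))\<bar> \<le> L * J"
      by (subst (asm) integral_diff) (auto intro!: integrable_continuous_real cb)
    have "\<mu> * (x' s - z' s) = - (\<Lambda> (x s) - \<Lambda> (z s)) + (integral {0..s} (\<lambda>s. b (x s)) - integral {0..s} (\<lambda>s. b (z s))) + (w s - v s)"
      using x(5)[of s] z(5)[of s] s by (simp add: algebra_simps)
    then have "\<bar>\<mu> * (x' s - z' s)\<bar> \<le> C * \<bar>x s - z s\<bar> + L * J + e"
      using 1 L(3)[of "x s" "z s"] e(2)[of s] s t by simp
    then have "\<bar>x' s - z' s\<bar> * \<mu> \<le> C * \<bar>x s - z s\<bar> + (L * J + e)"
      using \<mu> by (simp only: abs_mult mult.commute abs_of_pos add.assoc)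
    then have "\<bar>x' s - z' s\<bar> \<le> (C * \<bar>x s - z s\<bar> + (L * J + e)) / \<mu>"
      using \<mu> by (simp only: pos_le_divide_eq)
    then show "norm (x' s - z' s) \<le> (C / \<mu>) * \<bar>x s - z s\<bar> + (L * J + e) / \<mu>"
      by (simp add: add_divide_distrib)
  qed
  also have "\<dots> = C / \<mu> * J + (L * J + e) / \<mu> * t"
  proof -
    have "continuous_on {0..t} (\<lambda>s. C / \<mu> * \<bar>x s - z s\<bar>)"
      by (intro continuous_on_mult continuous_on_const cd)
    from integral_add[OF integrable_continuous_real[OF this] integrable_continuous_real[OF continuous_on_const]] t
    show ?thesis by (simp add: J_def mult.commute)
  qed
  also have "\<dots> \<le> C / \<mu> * J + (L * J + e) / \<mu> * T"
    using t J0 L(1) e(1) \<mu> by (intro add_left_mono mult_left_mono) auto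
  also have "\<dots> = T / \<mu> * e + (C + L * T) / \<mu> * J" using \<mu> by (simp add: field_simps)
  finally show "\<bar>x t - z t\<bar> \<le> T / \<mu> * e + (C + L * T) / \<mu> * integral {0..t} (\<lambda>s. \<bar>x s - z s\<bar>)"
    by (simp add: J_def)
qed


section \<open>Independence and stationarity of the increments of a Wiener process\<close>

text \<open>One encoding for three families: \<open>W\<close> up to a time, the increments of
  \<open>W\<close> after it, and the coordinates on \<open>C[0,T]\<close>. All sets
  \<open>A i\<close> are Borel, also for \<open>i\<close> outside \<open>J\<close>, which keeps the
  index sets of intersections simple.\<close>

definition cylinders :: "'a set \<Rightarrow> ('i \<Rightarrow> 'a \<Rightarrow> real) \<Rightarrow> 'i set \<Rightarrow> 'a set set" where
  "cylinders \<Omega> X I = {{\<omega>\<in>\<Omega>. \<forall>i\<in>J. X i \<omega> \<in> A i} | J A. finite J \<and> J \<subseteq> I \<and> (\<forall>i. A i \<in> sets borel)}"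

lemma cylinders_subset: "cylinders \<Omega> X I \<subseteq> Pow \<Omega>"
  by (auto simp: cylinders_def)

lemma cylindersI:
  "finite J \<Longrightarrow> J \<subseteq> I \<Longrightarrow> (\<And>i. A i \<in> sets borel) \<Longrightarrow> {\<omega>\<in>\<Omega>. \<forall>i\<in>J. X i \<omega> \<in> A i} \<in> cylinders \<Omega> X I"
  by (auto simp: cylinders_def)

lemma vimage_in_cylinders:
  assumes "i \<in> I" "A \<in> sets borel" shows "X i -` A \<inter> \<Omega> \<in> cylinders \<Omega> X I"
proof -
  have "X i -` A \<inter> \<Omega> = {\<omega>\<in>\<Omega>. \<forall>j\<in>{i}. X j \<omega> \<in> A}" by auto
  then show ?thesis using assms by (simp only:) (intro cylindersI, auto)
qed

lemma space_in_cylinders: "\<Omega> \<in> cylinders \<Omega> X I"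
  using cylindersI[of "{}" I "\<lambda>_. UNIV" \<Omega> X] by simp

lemma Int_stable_cylinders: "Int_stable (cylinders \<Omega> X I)"
proof (rule Int_stableI)
  fix a b assume "a \<in> cylinders \<Omega> X I" "b \<in> cylinders \<Omega> X I"
  then obtain J A J' A' where J: "finite J" "J \<subseteq> I" "\<And>i. A i \<in> sets borel" "a = {\<omega>\<in>\<Omega>. \<forall>i\<in>J. X i \<omega> \<in> A i}"
    and J': "finite J'" "J' \<subseteq> I" "\<And>i. A' i \<in> sets borel" "b = {\<omega>\<in>\<Omega>. \<forall>i\<in>J'. X i \<omega> \<in> A' i}"
    by (auto simp: cylinders_def)
  have "a \<inter> b = {\<omega>\<in>\<Omega>. \<forall>i\<in>J \<union> J'. X i \<omega> \<in> (if i \<in> J then A i else UNIV) \<inter> (if i \<in> J' then A' i else UNIV)}"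
    unfolding J(4) J'(4) by auto
  also have "\<dots> \<in> cylinders \<Omega> X I"
    using J J' by (intro cylindersI) auto
  finally show "a \<inter> b \<in> cylinders \<Omega> X I" .
qed

lemma cylinders_measurable:
  assumes "\<Omega> = space M" "\<And>i. i \<in> I \<Longrightarrow> X i \<in> borel_measurable M"
  shows "cylinders \<Omega> X I \<subseteq> sets M"
proof
  fix a assume "a \<in> cylinders \<Omega> X I"
  then obtain J A where J: "finite J" "J \<subseteq> I" "\<And>i. A i \<in> sets borel" "a = {\<omega>\<in>\<Omega>. \<forall>i\<in>J. X i \<omega> \<in> A i}"
    by (auto simp: cylinders_def)
  show "a \<in> sets M"
    unfolding J(4) assms(1) pred_def[symmetric]
  proof (rule pred_intros_finite(3)[OF J(1)])
    fix i assume "i \<in> J"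
    then have [measurable]: "X i \<in> borel_measurable M" using J assms by auto
    show "Measurable.pred M (\<lambda>\<omega>. X i \<omega> \<in> A i)" using J(3)[of i] by measurable
  qed
qed

lemma measurable_from_cylinders:
  assumes "i \<in> I" shows "X i \<in> borel_measurable (sigma \<Omega> (cylinders \<Omega> X I))"
proof (rule measurableI)
  fix A :: "real set" assume "A \<in> sets borel"
  then show "X i -` A \<inter> space (sigma \<Omega> (cylinders \<Omega> X I)) \<in> sets (sigma \<Omega> (cylinders \<Omega> X I))"
    using vimage_in_cylinders[OF assms, of A X \<Omega>] cylinders_subset[of \<Omega> X I]
    by (simp add: space_measure_of_conv)
qed simp

text \<open>The inclusion from left to right is \<open>measurable_path_borel\<close> for the
  identity. It follows that laws on \<open>C[0,T]\<close> are determined by their finite-dimensional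
  distributions.\<close>

lemma sets_path_borel_eq_sigma_cylinders:
  assumes "0 < T"
  shows "sets (path_borel T) = sigma_sets (mspace (path_space T)) (cylinders (mspace (path_space T)) (\<lambda>t f. f t) {0..T})"
    (is "_ = sigma_sets ?\<Omega> ?C")
proof
  have "(\<lambda>f. f) \<in> measurable (sigma ?\<Omega> ?C) (path_borel T)"
    using measurable_from_cylinders[of _ "{0..T}" "\<lambda>t f. f t" ?\<Omega>] assms
    by (intro measurable_path_borel) (auto simp: space_measure_of_conv)
  then show "sets (path_borel T) \<subseteq> sigma_sets ?\<Omega> ?C"
  proof (intro subsetI)
    fix A assume "(\<lambda>f. f) \<in> measurable (sigma ?\<Omega> ?C) (path_borel T)" "A \<in> sets (path_borel T)"
    from measurable_sets[OF this] sets.sets_into_space[OF this(2)]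
    show "A \<in> sigma_sets ?\<Omega> ?C"
      using cylinders_subset[of ?\<Omega> "\<lambda>t f. f t" "{0..T}"] by (simp add: space_measure_of_conv Int_absorb2)
  qed
  show "sigma_sets ?\<Omega> ?C \<subseteq> sets (path_borel T)"
    using sets.sigma_sets_subset[OF cylinders_measurable[of ?\<Omega> "path_borel T" "{0..T}" "\<lambda>t f. f t"]]
      path_eval_measurable by simp
qed

lemma ball_reindex:
  assumes "J \<subseteq> f ` K"
  shows "(\<forall>k\<in>K. f k \<in> J \<longrightarrow> P (f k)) \<longleftrightarrow> (\<forall>j\<in>J. P j)"
  using assms by blast

text \<open>Cylinders come with finite sets of times, the Wiener process with increasing sequences.
  Time 0 is included so that a value of the process is the sum of the increments before it.\<close>

lemma enumerate_times:
  fixes S :: "real set"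
  assumes S: "finite S" "0 \<in> S" "S \<subseteq> {0..}"
  obtains \<tau> :: "nat \<Rightarrow> real" and n where "\<tau> 0 = 0" "S = \<tau> ` {..n}" "\<And>i. i < n \<Longrightarrow> \<tau> i < \<tau> (Suc i)"
    "\<tau> n = Max S" "n = card S - 1"
proof -
  define xs where "xs = sorted_list_of_set S"
  have xs: "set xs = S" "sorted_wrt (<) xs" "length xs = card S"
    using S by (auto simp: xs_def)
  define n where "n = card S - 1"
  have len: "length xs = Suc n" using S xs(3) card_gt_0_iff[of S] by (auto simp: n_def)
  have mono: "xs ! i < xs ! j" if "i < j" "j \<le> n" for i j
    using sorted_wrt_nth_less[OF xs(2)] that len by auto
  have le: "xs ! i \<le> xs ! j" if "i \<le> j" "j \<le> n" for i j
    using mono[of i j] that by (cases "i = j") auto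
  have img: "S = (\<lambda>i. xs ! i) ` {..n}"
    unfolding xs(1)[symmetric] set_conv_nth len by (auto simp: less_Suc_eq_le)
  show thesis
  proof (rule that[of "\<lambda>i. xs ! i" n])
    show "S = (\<lambda>i. xs ! i) ` {..n}" by (rule img)
    obtain k where "k \<le> n" "xs ! k = 0" using S(2) unfolding img by auto
    with le[of 0 k] have "xs ! 0 \<le> 0" by auto
    moreover have "xs ! 0 \<in> S" unfolding img by auto
    ultimately show "xs ! 0 = 0" using S(3) by force
    show "xs ! n = Max S"
    proof (rule Max_eqI[symmetric, OF S(1)])
      show "xs ! n \<in> S" unfolding img by auto
      show "y \<le> xs ! n" if "y \<in> S" for y using that le unfolding img by auto
    qed
  qed (use mono n_def in auto)
qed

locale wiener =
  fixes M :: "'a measure" and W :: "real \<Rightarrow> 'a \<Rightarrow> real"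
  assumes wiener: "wiener_process M W"
begin

sublocale prob_space M
  using wiener by (simp add: wiener_process_def)

lemma W_measurable: "0 \<le> t \<Longrightarrow> W t \<in> borel_measurable M"
  and W_0: "\<omega> \<in> space M \<Longrightarrow> W 0 \<omega> = 0"
  and W_continuous: "\<omega> \<in> space M \<Longrightarrow> continuous_on {0..} (\<lambda>t. W t \<omega>)"
  and W_increment: "0 \<le> s \<Longrightarrow> s < t \<Longrightarrow>
    distributed M lborel (\<lambda>\<omega>. W t \<omega> - W s \<omega>) (normal_density 0 (sqrt (t - s)))"
  and W_indep: "0 \<le> \<tau> 0 \<Longrightarrow> (\<And>i. i < n \<Longrightarrow> \<tau> i < \<tau> (Suc i)) \<Longrightarrow>
    indep_vars (\<lambda>_. borel) (\<lambda>i \<omega>. W (\<tau> (Suc i)) \<omega> - W (\<tau> i) \<omega>) {..<n}"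
  using wiener by (auto simp: wiener_process_def)

text \<open>Order four is reached because the Taylor remainder used for the generator is quartic in
  the displacement.\<close>

lemma moments:
  assumes t: "0 < t"
  shows "integrable M (\<lambda>\<omega>. W t \<omega> ^ k)" "expectation (W t) = 0" "expectation (\<lambda>\<omega>. W t \<omega> ^ 2) = t"
    "expectation (\<lambda>\<omega>. W t \<omega> ^ 4) = 3 * t^2"
proof -
  have D: "distributed M lborel (\<lambda>\<omega>. W t \<omega> - W 0 \<omega>) (normal_density 0 (sqrt t))"
    using W_increment[of 0 t] t by simp
  have sq: "0 < sqrt t" using t by simp
  have "integrable M (\<lambda>\<omega>. (W t \<omega> - W 0 \<omega>) ^ k)"
    using distributed_integrable[OF D, of "\<lambda>x. x ^ k"] integrable_normal_moment[OF sq, of 0 k] by simp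
  then show "integrable M (\<lambda>\<omega>. W t \<omega> ^ k)"
    by (rule Bochner_Integration.integrable_cong[THEN iffD1, rotated -1]) (auto simp: W_0)
  have E: "expectation (\<lambda>\<omega>. g (W t \<omega>)) = expectation (\<lambda>\<omega>. g (W t \<omega> - W 0 \<omega>))" for g :: "real \<Rightarrow> real"
    by (intro Bochner_Integration.integral_cong) (auto simp: W_0)
  show "expectation (W t) = 0"
    using normal_distributed_expectation[OF sq D] E[of "\<lambda>x. x"] by simp
  have "expectation (\<lambda>\<omega>. (W t \<omega> - W 0 \<omega>) ^ (2 * k)) = fact (2 * k) / ((2 / (sqrt t)\<^sup>2)^k * fact k)" for k
    using distributed_integral[OF D, of "\<lambda>x. x ^ (2 * k)"] integral_normal_moment_even[OF sq, of 0 k] by simp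
  from this[of 1] this[of 2] E[of "\<lambda>x. x ^ 2"] E[of "\<lambda>x. x ^ 4"]
  show "expectation (\<lambda>\<omega>. W t \<omega> ^ 2) = t" "expectation (\<lambda>\<omega>. W t \<omega> ^ 4) = 3 * t^2"
    using t by (simp_all add: fact_numeral power_divide)
qed

lemma increments_law:
  assumes \<tau>: "0 \<le> \<tau> 0" "\<And>i. i < n \<Longrightarrow> \<tau> i < \<tau> (Suc i)" and n: "0 < n"
  shows "distr M (PiM {..<n} (\<lambda>_. borel)) (\<lambda>\<omega>. \<lambda>i\<in>{..<n}. W (\<tau> (Suc i)) \<omega> - W (\<tau> i) \<omega>)
    = PiM {..<n} (\<lambda>i. density lborel (\<lambda>x. ennreal (normal_density 0 (sqrt (\<tau> (Suc i) - \<tau> i)) x)))"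
proof -
  have \<tau>0: "0 \<le> \<tau> i" if "i \<le> n" for i
    using that
  proof (induction i)
    case (Suc i) then show ?case using \<tau>(2)[of i] by simp
  qed (use \<tau> in simp)
  have "distr M (PiM {..<n} (\<lambda>_. borel)) (\<lambda>\<omega>. \<lambda>i\<in>{..<n}. W (\<tau> (Suc i)) \<omega> - W (\<tau> i) \<omega>)
    = PiM {..<n} (\<lambda>i. distr M borel (\<lambda>\<omega>. W (\<tau> (Suc i)) \<omega> - W (\<tau> i) \<omega>))"
    using W_indep[of \<tau> n] \<tau> n \<tau>0 by (subst indep_vars_iff_distr_eq_PiM'[symmetric])
      (auto intro!: borel_measurable_diff W_measurable simp: lessThan_empty_iff)
  also have "\<dots> = PiM {..<n} (\<lambda>i. density lborel (\<lambda>x. ennreal (normal_density 0 (sqrt (\<tau> (Suc i) - \<tau> i)) x)))"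
  proof (rule PiM_cong[OF refl])
    fix i assume "i \<in> {..<n}"
    then have "distributed M lborel (\<lambda>\<omega>. W (\<tau> (Suc i)) \<omega> - W (\<tau> i) \<omega>) (normal_density 0 (sqrt (\<tau> (Suc i) - \<tau> i)))"
      using \<tau> \<tau>0 by (intro W_increment) auto
    from distributed_distr_eq_density[OF this]
    show "distr M borel (\<lambda>\<omega>. W (\<tau> (Suc i)) \<omega> - W (\<tau> i) \<omega>) = density lborel (\<lambda>x. ennreal (normal_density 0 (sqrt (\<tau> (Suc i) - \<tau> i)) x))"
      by (simp cong: distr_cong)
  qed
  finally show ?thesis .
qed

text \<open>Both sides are the measure of the same set \<open>D\<close> of increment vectors under
  the same product of normal laws, because the lengths of the time steps do not change under the
  shift.\<close>

lemma cylinder_shift_law: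
  assumes s: "0 \<le> s" and J: "finite J" "J \<subseteq> {0..}" and A: "\<And>j. A j \<in> sets borel"
  shows "prob {\<omega>\<in>space M. \<forall>j\<in>J. W (s + j) \<omega> - W s \<omega> \<in> A j} = prob {\<omega>\<in>space M. \<forall>j\<in>J. W j \<omega> \<in> A j}"
proof -
  \<comment> \<open>The additional time 1 guarantees at least one increment, as
    \<open>increments_law\<close> asks for \<open>0 < n\<close>.\<close>
  have times: "finite (J \<union> {0,1})" "0 \<in> J \<union> {0,1}" "J \<union> {0,1} \<subseteq> {0..}" using J by auto
  obtain \<sigma> m where \<sigma>: "\<sigma> 0 = 0" "J \<union> {0,1} = \<sigma> ` {..m}" "\<And>i. i < m \<Longrightarrow> \<sigma> i < \<sigma> (Suc i)" and m: "m = card (J \<union> {0,1}) - 1"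
    by (rule enumerate_times[OF times], blast)
  have "card {0,1::real} \<le> card (J \<union> {0,1})" using J by (intro card_mono) auto
  then have m0: "0 < m" using m by simp
  have \<sigma>0: "0 \<le> \<sigma> i" if "i \<le> m" for i
    using that
  proof (induction i)
    case (Suc i) then show ?case using \<sigma>(3)[of i] by simp
  qed (use \<sigma> in simp)
  define D where "D = {f \<in> space (PiM {..<m} (\<lambda>_. borel)). \<forall>k\<in>{..m}. \<sigma> k \<in> J \<longrightarrow> (\<Sum>i<k. f i) \<in> A (\<sigma> k)}"
  have D: "D \<in> sets (PiM {..<m} (\<lambda>_. borel :: real measure))"
    unfolding D_def pred_def[symmetric]
  proof (intro pred_intros_finite pred_intros_imp')
    fix k assume "k \<in> {..m}"
    then have [measurable]: "(\<lambda>f. (\<Sum>i<k. f i)) \<in> borel_measurable (PiM {..<m} (\<lambda>_. borel :: real measure))"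
      by (intro borel_measurable_sum measurable_component_singleton) auto
    show "Measurable.pred (PiM {..<m} (\<lambda>_. borel)) (\<lambda>f. (\<Sum>i<k. f i) \<in> A (\<sigma> k))"
      using A[of "\<sigma> k"] by measurable
  qed simp
  have law: "prob {\<omega>\<in>space M. \<forall>j\<in>J. W (s + j) \<omega> - W s \<omega> \<in> A j} =
     measure (PiM {..<m} (\<lambda>i. density lborel (\<lambda>x. ennreal (normal_density 0 (sqrt (\<sigma> (Suc i) - \<sigma> i)) x)))) D"
    if s: "0 \<le> s" for s
  proof -
    define V where "V = (\<lambda>\<omega>. \<lambda>i\<in>{..<m}. W (s + \<sigma> (Suc i)) \<omega> - W (s + \<sigma> i) \<omega>)"
    have V: "V \<in> measurable M (PiM {..<m} (\<lambda>_. borel))"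
      unfolding V_def using s \<sigma>0 by (intro measurable_restrict borel_measurable_diff W_measurable) auto
    have tel: "(\<Sum>i<k. W (s + \<sigma> (Suc i)) \<omega> - W (s + \<sigma> i) \<omega>) = W (s + \<sigma> k) \<omega> - W s \<omega>" for k \<omega>
      using sum_lessThan_telescope[of "\<lambda>i. W (s + \<sigma> i) \<omega>" k] \<sigma>(1) by simp
    have sumV: "(\<Sum>i<k. V \<omega> i) = W (s + \<sigma> k) \<omega> - W s \<omega>" if "k \<le> m" for k \<omega>
      unfolding tel[symmetric] V_def using that by (intro sum.cong) auto
    have inD: "V \<omega> \<in> D \<longleftrightarrow> (\<forall>j\<in>J. W (s + j) \<omega> - W s \<omega> \<in> A j)" for \<omega>
    proof -
      have "V \<omega> \<in> space (PiM {..<m} (\<lambda>_. borel))" by (auto simp: space_PiM V_def)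
      then have "V \<omega> \<in> D \<longleftrightarrow> (\<forall>k\<in>{..m}. \<sigma> k \<in> J \<longrightarrow> W (s + \<sigma> k) \<omega> - W s \<omega> \<in> A (\<sigma> k))"
        unfolding D_def using sumV[of _ \<omega>] by simp
      also have "\<dots> \<longleftrightarrow> (\<forall>j\<in>J. W (s + j) \<omega> - W s \<omega> \<in> A j)"
        using \<sigma>(2) by (intro ball_reindex[where P="\<lambda>j. W (s + j) \<omega> - W s \<omega> \<in> A j"]) auto
      finally show ?thesis .
    qed
    have "V -` D \<inter> space M = {\<omega>\<in>space M. \<forall>j\<in>J. W (s + j) \<omega> - W s \<omega> \<in> A j}"
      by (intro set_eqI) (simp only: vimage_eq Int_iff mem_Collect_eq inD conj_commute)
    then have "prob {\<omega>\<in>space M. \<forall>j\<in>J. W (s + j) \<omega> - W s \<omega> \<in> A j} = measure (distr M (PiM {..<m} (\<lambda>_. borel)) V) D"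
      using measure_distr[OF V D] by simp
    also have "distr M (PiM {..<m} (\<lambda>_. borel)) V
      = PiM {..<m} (\<lambda>i. density lborel (\<lambda>x. ennreal (normal_density 0 (sqrt ((s + \<sigma> (Suc i)) - (s + \<sigma> i))) x)))"
      unfolding V_def using s \<sigma> m0 by (intro increments_law) auto
    finally show ?thesis by (simp only: add_diff_cancel_left)
  qed
  have "prob {\<omega>\<in>space M. \<forall>j\<in>J. W (0 + j) \<omega> - W 0 \<omega> \<in> A j} = prob {\<omega>\<in>space M. \<forall>j\<in>J. W j \<omega> \<in> A j}"
    by (intro arg_cong[where f=prob]) (auto simp: W_0)
  then show ?thesis using law[OF s] law[of 0] by simp
qed

text \<open>The times up to \<open>s\<close> and those after \<open>s\<close> are concatenated into
  one partition. The two events then depend on disjoint blocks of its independent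
  increments.\<close>

lemma cylinder_indep:
  assumes s: "0 \<le> s" and R: "finite R" "R \<subseteq> {0..s}" "\<And>j. A j \<in> sets borel"
    and J: "finite J" "J \<subseteq> {0..}" "\<And>j. A' j \<in> sets borel"
  shows "prob ({\<omega>\<in>space M. \<forall>r\<in>R. W r \<omega> \<in> A r} \<inter> {\<omega>\<in>space M. \<forall>j\<in>J. W (s + j) \<omega> - W s \<omega> \<in> A' j})
    = prob {\<omega>\<in>space M. \<forall>r\<in>R. W r \<omega> \<in> A r} * prob {\<omega>\<in>space M. \<forall>j\<in>J. W (s + j) \<omega> - W s \<omega> \<in> A' j}"
proof -
  have times: "finite (R \<union> {0,s})" "0 \<in> R \<union> {0,s}" "R \<union> {0,s} \<subseteq> {0..}" using s R(1,2) by auto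
  obtain \<tau> n where \<tau>: "\<tau> 0 = 0" "R \<union> {0,s} = \<tau> ` {..n}" "\<And>i. i < n \<Longrightarrow> \<tau> i < \<tau> (Suc i)" "\<tau> n = Max (R \<union> {0,s})"
    by (rule enumerate_times[OF times], blast)
  have \<tau>n: "\<tau> n = s" unfolding \<tau>(4) using R s by (intro Max_eqI) auto
  have times: "finite (J \<union> {0})" "0 \<in> J \<union> {0}" "J \<union> {0} \<subseteq> {0..}" using J(1,2) by auto
  obtain \<sigma> m where \<sigma>: "\<sigma> 0 = 0" "J \<union> {0} = \<sigma> ` {..m}" "\<And>i. i < m \<Longrightarrow> \<sigma> i < \<sigma> (Suc i)"
    by (rule enumerate_times[OF times], blast)
  \<comment> \<open>The two lists overlap at index \<open>n\<close>, where both give the time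
    \<open>s\<close>, because \<open>\<tau> n = s\<close> and \<open>\<sigma> 0 = 0\<close>.\<close>
  define \<kappa> where "\<kappa> i = (if i \<le> n then \<tau> i else s + \<sigma> (i - n))" for i
  have \<kappa>n: "\<kappa> (n + i) = s + \<sigma> i" for i by (auto simp: \<kappa>_def \<tau>n \<sigma>(1))
  have \<kappa>: "\<kappa> 0 = 0" "\<And>i. i < n + m \<Longrightarrow> \<kappa> i < \<kappa> (Suc i)"
  proof -
    show "\<kappa> 0 = 0" by (simp add: \<kappa>_def \<tau>)
    fix i assume i: "i < n + m"
    show "\<kappa> i < \<kappa> (Suc i)"
    proof (cases "i < n")
      case True then show ?thesis using \<tau>(3)[of i] by (simp add: \<kappa>_def)
    next
      case False
      then obtain k where k: "i = n + k" using le_iff_add[of n i] by auto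
      then show ?thesis using \<kappa>n[of k] \<kappa>n[of "Suc k"] \<sigma>(3)[of k] i by simp
    qed
  qed
  let ?X = "\<lambda>i \<omega>. W (\<kappa> (Suc i)) \<omega> - W (\<kappa> i) \<omega>"
  define U where "U = (\<lambda>\<omega>. restrict (\<lambda>i. ?X i \<omega>) {..<n})"
  define V where "V = (\<lambda>\<omega>. restrict (\<lambda>i. ?X i \<omega>) {n..<n+m})"
  have "indep_vars (\<lambda>_. borel) ?X {..<n+m}" using \<kappa> by (intro W_indep) auto
  then have ind: "indep_var (PiM {..<n} (\<lambda>_. borel)) U (PiM {n..<n+m} (\<lambda>_. borel)) V"
    unfolding U_def V_def by (rule indep_var_restrict) auto
  define B where "B = {f \<in> space (PiM {..<n} (\<lambda>_. borel)). \<forall>k\<in>{..n}. \<tau> k \<in> R \<longrightarrow> (\<Sum>i<k. f i) \<in> A (\<tau> k)}"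
  define D where "D = {f \<in> space (PiM {n..<n+m} (\<lambda>_. borel)). \<forall>k\<in>{..m}. \<sigma> k \<in> J \<longrightarrow> (\<Sum>i<k. f (n + i)) \<in> A' (\<sigma> k)}"
  have B: "B \<in> sets (PiM {..<n} (\<lambda>_. borel :: real measure))"
    unfolding B_def pred_def[symmetric]
  proof (intro pred_intros_finite pred_intros_imp')
    fix k assume "k \<in> {..n}"
    then have [measurable]: "(\<lambda>f. (\<Sum>i<k. f i)) \<in> borel_measurable (PiM {..<n} (\<lambda>_. borel :: real measure))"
      by (intro borel_measurable_sum measurable_component_singleton) auto
    show "Measurable.pred (PiM {..<n} (\<lambda>_. borel)) (\<lambda>f. (\<Sum>i<k. f i) \<in> A (\<tau> k))"
      using R(3)[of "\<tau> k"] by measurable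
  qed simp
  have D: "D \<in> sets (PiM {n..<n+m} (\<lambda>_. borel :: real measure))"
    unfolding D_def pred_def[symmetric]
  proof (intro pred_intros_finite pred_intros_imp')
    fix k assume "k \<in> {..m}"
    then have [measurable]: "(\<lambda>f. (\<Sum>i<k. f (n + i))) \<in> borel_measurable (PiM {n..<n+m} (\<lambda>_. borel :: real measure))"
      by (intro borel_measurable_sum measurable_component_singleton) auto
    show "Measurable.pred (PiM {n..<n+m} (\<lambda>_. borel)) (\<lambda>f. (\<Sum>i<k. f (n + i)) \<in> A' (\<sigma> k))"
      using J(3)[of "\<sigma> k"] by measurable
  qed simp
  have UV: "U \<omega> \<in> space (PiM {..<n} (\<lambda>_. borel))" "V \<omega> \<in> space (PiM {n..<n+m} (\<lambda>_. borel))" for \<omega>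
    by (auto simp: space_PiM U_def V_def)
  have telU: "(\<Sum>i<k. ?X i \<omega>) = W (\<kappa> k) \<omega>" if "\<omega> \<in> space M" for k \<omega>
    using sum_lessThan_telescope[of "\<lambda>i. W (\<kappa> i) \<omega>" k] \<kappa>(1) W_0[OF that] by simp
  have sumU: "(\<Sum>i<k. U \<omega> i) = W (\<tau> k) \<omega>" if "k \<le> n" "\<omega> \<in> space M" for k \<omega>
  proof -
    have "(\<Sum>i<k. U \<omega> i) = (\<Sum>i<k. ?X i \<omega>)" unfolding U_def using that by (intro sum.cong) auto
    then show ?thesis using telU[OF that(2), of k] that by (simp add: \<kappa>_def)
  qed
  have telV: "(\<Sum>i<k. ?X (n + i) \<omega>) = W (s + \<sigma> k) \<omega> - W s \<omega>" for k \<omega>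
    using sum_lessThan_telescope[of "\<lambda>i. W (s + \<sigma> i) \<omega>" k] \<sigma>(1) by (simp add: \<kappa>n flip: add_Suc_right)
  have sumV: "(\<Sum>i<k. V \<omega> (n + i)) = W (s + \<sigma> k) \<omega> - W s \<omega>" if "k \<le> m" for k \<omega>
    unfolding telV[symmetric] V_def using that by (intro sum.cong) auto
  have inB: "U \<omega> \<in> B \<longleftrightarrow> (\<forall>r\<in>R. W r \<omega> \<in> A r)" if "\<omega> \<in> space M" for \<omega>
  proof -
    have "U \<omega> \<in> B \<longleftrightarrow> (\<forall>k\<in>{..n}. \<tau> k \<in> R \<longrightarrow> W (\<tau> k) \<omega> \<in> A (\<tau> k))"
      unfolding B_def using UV(1)[of \<omega>] sumU[OF _ that] by simp
    also have "\<dots> \<longleftrightarrow> (\<forall>r\<in>R. W r \<omega> \<in> A r)"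
      using \<tau>(2) by (intro ball_reindex[where P="\<lambda>r. W r \<omega> \<in> A r"]) auto
    finally show ?thesis .
  qed
  have eqB: "U -` B \<inter> space M = {\<omega>\<in>space M. \<forall>r\<in>R. W r \<omega> \<in> A r}"
    by (intro set_eqI) (simp only: vimage_eq Int_iff mem_Collect_eq inB conj_commute cong: conj_cong)
  have inD: "V \<omega> \<in> D \<longleftrightarrow> (\<forall>j\<in>J. W (s + j) \<omega> - W s \<omega> \<in> A' j)" for \<omega>
  proof -
    have "V \<omega> \<in> D \<longleftrightarrow> (\<forall>k\<in>{..m}. \<sigma> k \<in> J \<longrightarrow> W (s + \<sigma> k) \<omega> - W s \<omega> \<in> A' (\<sigma> k))"
      unfolding D_def using UV(2)[of \<omega>] sumV[of _ \<omega>] by simp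
    also have "\<dots> \<longleftrightarrow> (\<forall>j\<in>J. W (s + j) \<omega> - W s \<omega> \<in> A' j)"
      using \<sigma>(2) by (intro ball_reindex[where P="\<lambda>j. W (s + j) \<omega> - W s \<omega> \<in> A' j"]) auto
    finally show ?thesis .
  qed
  have eqD: "V -` D \<inter> space M = {\<omega>\<in>space M. \<forall>j\<in>J. W (s + j) \<omega> - W s \<omega> \<in> A' j}"
    by (intro set_eqI) (simp only: vimage_eq Int_iff mem_Collect_eq inD conj_commute)
  have "(\<lambda>\<omega>. (U \<omega>, V \<omega>)) -` (B \<times> D) \<inter> space M = (U -` B \<inter> space M) \<inter> (V -` D \<inter> space M)" by blast
  with indep_varD[OF ind B D] show ?thesis unfolding eqB eqD by (simp only:)
qed

text \<open>The future after \<open>s\<close> as a single random element of \<open>C[0,T]\<close>,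
  so that independence of the past and stationarity become statements about its law.\<close>

definition shift :: "real \<Rightarrow> real \<Rightarrow> 'a \<Rightarrow> real \<Rightarrow> real" where
  "shift s T \<omega> = restrict (\<lambda>r. W (s + r) \<omega> - W s \<omega>) {0..T}"

lemma shift_in_path_space:
  assumes "\<omega> \<in> space M" "0 \<le> s" shows "shift s T \<omega> \<in> mspace (path_space T)"
  unfolding shift_def using shift_continuous[OF W_continuous[OF assms(1)] assms(2), of 0]
  by (intro restrict_in_path_space) (auto intro: continuous_on_subset)

lemma shift_measurable:
  assumes "0 \<le> s" "0 < T" shows "shift s T \<in> measurable M (path_borel T)"
proof (rule measurable_path_borel[OF assms(2)])
  show "(\<lambda>\<omega>. shift s T \<omega> t) \<in> borel_measurable M" if "0 \<le> t" "t \<le> T" for t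
    unfolding shift_def using that assms by (auto intro!: borel_measurable_diff W_measurable)
qed (use assms shift_in_path_space in auto)

lemma shift_law:
  assumes s: "0 \<le> s" and T: "0 < T"
  shows "distr M (path_borel T) (shift s T) = distr M (path_borel T) (shift 0 T)"
proof (rule measure_eqI_generator_eq[where \<Omega>="mspace (path_space T)" and A="\<lambda>_. mspace (path_space T)"
    and E="cylinders (mspace (path_space T)) (\<lambda>t f. f t) {0..T}"])
  fix X assume X: "X \<in> cylinders (mspace (path_space T)) (\<lambda>t f. f t) {0..T}"
  then obtain J A where J: "finite J" "J \<subseteq> {0..T}" "\<And>i. A i \<in> sets borel" "X = {f\<in>mspace (path_space T). \<forall>i\<in>J. f i \<in> A i}"
    by (auto simp: cylinders_def)
  have Xs: "X \<in> sets (path_borel T)"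
    using X unfolding sets_path_borel_eq_sigma_cylinders[OF T] by (rule sigma_sets.Basic)
  have pre: "shift s T -` X \<inter> space M = {\<omega>\<in>space M. \<forall>j\<in>J. W (s + j) \<omega> - W s \<omega> \<in> A j}" if "0 \<le> s" for s
    using J(2) shift_in_path_space[OF _ that, of _ T] unfolding J(4) by (auto simp: shift_def subset_iff)
  have J0: "J \<subseteq> {0..}" using J(2) by auto
  have "prob (shift s T -` X \<inter> space M) = prob (shift 0 T -` X \<inter> space M)"
    unfolding pre[OF s] pre[OF order_refl] cylinder_shift_law[OF s J(1) J0 J(3)]
      cylinder_shift_law[OF order_refl J(1) J0 J(3)] ..
  then show "emeasure (distr M (path_borel T) (shift s T)) X = emeasure (distr M (path_borel T) (shift 0 T)) X"
    using shift_measurable s T Xs by (simp add: emeasure_distr emeasure_eq_measure)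
next
  show "emeasure (distr M (path_borel T) (shift s T)) (mspace (path_space T)) \<noteq> \<infinity>"
    using emeasure_finite
    by (metis emeasure_distr s T shift_measurable space_path_borel sets.top infinity_ennreal_def top.not_eq_extremum)
qed (auto simp: Int_stable_cylinders cylinders_subset sets_path_borel_eq_sigma_cylinders[OF T] space_in_cylinders)

lemma natural_filtration_eq:
  "sets (natural_filtration M W s) = sigma_sets (space M) {W r -` B \<inter> space M | r B. 0 \<le> r \<and> r \<le> s \<and> B \<in> sets borel}"
  "space (natural_filtration M W s) = space M"
  unfolding natural_filtration_def by (auto simp: space_measure_of_conv intro!: sets_measure_of)

lemma natural_filtration_measurable:
  "0 \<le> r \<Longrightarrow> r \<le> s \<Longrightarrow> W r \<in> borel_measurable (natural_filtration M W s)"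
  by (rule measurableI) (auto simp: natural_filtration_eq intro!: sigma_sets.Basic)

text \<open>Independence of two families of cylinders, both stable under intersection, passes to the
  generated sigma-algebras. On the side of the future these contain the preimages of all Borel sets
  of \<open>C[0,T]\<close>, by \<open>measurable_path_borel\<close>.\<close>

lemma shift_indep:
  assumes s: "0 \<le> s" and T: "0 < T" and B: "B \<in> sets (natural_filtration M W s)" and C: "C \<in> sets (path_borel T)"
  shows "prob (B \<inter> (shift s T -` C \<inter> space M)) = prob B * prob (shift s T -` C \<inter> space M)"
proof -
  let ?\<theta> = "\<lambda>t \<omega>. W (s + t) \<omega> - W s \<omega>"
  let ?P = "cylinders (space M) W {0..s}" and ?F = "cylinders (space M) ?\<theta> {0..T}"
  have P: "?P \<subseteq> sets M" and F: "?F \<subseteq> sets M"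
    using s by (auto intro!: cylinders_measurable[THEN subsetD, rotated 2] borel_measurable_diff W_measurable)
  have "indep_set ?P ?F"
  proof (rule indep_setI[OF P F])
    fix a b assume "a \<in> ?P" "b \<in> ?F"
    then show "prob (a \<inter> b) = prob a * prob b"
      unfolding cylinders_def using s by (auto intro!: cylinder_indep simp: subset_iff)
  qed
  then have "indep_set (sigma_sets (space M) ?P) (sigma_sets (space M) ?F)"
    by (rule indep_set_sigma_sets) (rule Int_stable_cylinders)+
  moreover have "B \<in> sigma_sets (space M) ?P"
    using B unfolding natural_filtration_eq
    by (rule sigma_sets_mono'[THEN subsetD, rotated]) (auto intro!: vimage_in_cylinders)
  moreover have "shift s T -` C \<inter> space M \<in> sigma_sets (space M) ?F"
  proof -
    have "shift s T \<in> measurable (sigma (space M) ?F) (path_borel T)"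
    proof (rule measurable_path_borel[OF T])
      show "(\<lambda>\<omega>. shift s T \<omega> t) \<in> borel_measurable (sigma (space M) ?F)" if "0 \<le> t" "t \<le> T" for t
        using measurable_from_cylinders[of t "{0..T}" ?\<theta> "space M"] that by (simp add: shift_def)
    qed (use s shift_in_path_space in \<open>auto simp: space_measure_of_conv\<close>)
    from measurable_sets[OF this C] show ?thesis
      using cylinders_subset[of "space M" ?\<theta> "{0..T}"] by (simp add: space_measure_of_conv)
  qed
  ultimately show ?thesis by (rule indep_setD)
qed

end


section \<open>The diffusion as a Feller process\<close>

lemma (in drift) sol_measurable:
  assumes t: "0 \<le> t" and c: "\<And>\<omega>. \<omega> \<in> space N \<Longrightarrow> continuous_on {0..} (Z \<omega>)"
    and m: "\<And>r. 0 \<le> r \<Longrightarrow> r \<le> t \<Longrightarrow> (\<lambda>\<omega>. Z \<omega> r) \<in> borel_measurable N"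
  shows "(\<lambda>\<omega>. sol (Z \<omega>) t) \<in> borel_measurable N"
proof (rule borel_measurable_path_dominated[where T="t+1" and C="exp (L * t)"])
  \<comment> \<open>Stopping at \<open>t\<close> means that only values up to \<open>t\<close> have
    to be measurable, which later yields adaptedness. The horizon \<open>t + 1\<close> is positive
    even for \<open>t = 0\<close>.\<close>
  let ?F = "\<lambda>\<omega>. restrict (\<lambda>r. Z \<omega> (min r t)) {0..t+1}"
  show "?F \<in> measurable N (path_borel (t+1))"
  proof (rule measurable_path_borel)
    show "?F \<omega> \<in> mspace (path_space (t+1))" if "\<omega> \<in> space N" for \<omega>
      using t by (intro restrict_in_path_space continuous_on_compose2[OF c[OF that]])
        (auto intro!: continuous_intros)
    show "(\<lambda>\<omega>. ?F \<omega> r) \<in> borel_measurable N" if "0 \<le> r" "r \<le> t+1" for r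
      using that m[of "min r t"] t by simp
  qed (use t in simp)
  fix \<omega> \<omega>' e assume \<omega>: "\<omega> \<in> space N" "\<omega>' \<in> space N" and e: "0 \<le> e"
    "\<And>r. 0 \<le> r \<Longrightarrow> r \<le> t+1 \<Longrightarrow> \<bar>?F \<omega> r - ?F \<omega>' r\<bar> \<le> e"
  have "\<bar>Z \<omega> r - Z \<omega>' r\<bar> \<le> e" if "0 \<le> r" "r \<le> t" for r
    using e(2)[of r] that by simp
  then show "\<bar>sol (Z \<omega>) t - sol (Z \<omega>') t\<bar> \<le> exp (L * t) * e"
    using sol_stability[OF c[OF \<omega>(1)] c[OF \<omega>(2)] t, of e] by (simp add: mult.commute)
qed (use t in auto)

lemma C0_iff: "f \<in> C0 \<longleftrightarrow> continuous_on UNIV f \<and> (\<forall>e>0. \<exists>R. \<forall>x. R \<le> \<bar>x\<bar> \<longrightarrow> \<bar>f x\<bar> < e)"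
  by (auto simp: C0_def tendsto_iff eventually_at_infinity)

lemma C0_bounded:
  assumes "f \<in> C0" obtains B where "0 \<le> B" "\<And>x. \<bar>f x\<bar> \<le> B"
proof -
  obtain R where R: "\<And>x. R \<le> \<bar>x\<bar> \<Longrightarrow> \<bar>f x\<bar> < 1" using assms unfolding C0_iff by (metis zero_less_one)
  obtain C where C: "0 \<le> C" "\<And>x. - R \<le> x \<Longrightarrow> x \<le> R \<Longrightarrow> \<bar>f x\<bar> \<le> C"
    using continuous_on_Icc_abs_bounded[of "-R" R f] assms unfolding C0_iff by (metis continuous_on_subset subset_UNIV)
  have "\<bar>f x\<bar> \<le> C + 1" for x
  proof (cases "R \<le> \<bar>x\<bar>")
    case True then show ?thesis using R[of x] C(1) by linarith
  next
    case False then show ?thesis using C(2)[of x] by linarith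
  qed
  then show ?thesis using that[of "C + 1"] C(1) by auto
qed

lemma C0_measurable: "f \<in> C0 \<Longrightarrow> f \<in> borel_measurable borel"
  by (auto simp: C0_def intro: borel_measurable_continuous_onI)

lemma C0_diff: "f \<in> C0 \<Longrightarrow> g \<in> C0 \<Longrightarrow> (\<lambda>x. f x - g x) \<in> C0"
  unfolding C0_def by (auto intro!: continuous_intros tendsto_eq_intros)

lemma C0_cmult: "f \<in> C0 \<Longrightarrow> (\<lambda>x. a * f x) \<in> C0"
  unfolding C0_def by (auto intro!: continuous_intros tendsto_eq_intros)

text \<open>These two bounds replace the moduli of continuity and of decay of \<open>f\<close>: only moments of the
  noise are needed when they are averaged.\<close>

lemma C0_quadratic_modulus:
  assumes f: "f \<in> C0" and \<eta>: "0 < \<eta>"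
  obtains C where "0 \<le> C" "\<And>x y. \<bar>f x - f y\<bar> \<le> \<eta> + C * (x - y)\<^sup>2"
proof -
  obtain B where B: "0 \<le> B" "\<And>x. \<bar>f x\<bar> \<le> B" using C0_bounded[OF f] by blast
  obtain R where R: "\<And>x. R \<le> \<bar>x\<bar> \<Longrightarrow> \<bar>f x\<bar> < \<eta> / 2" using f \<eta> unfolding C0_iff by (metis half_gt_zero)
  have "uniformly_continuous_on {-\<bar>R\<bar>-1..\<bar>R\<bar>+1} f"
    using f by (intro compact_uniformly_continuous) (auto simp: C0_def intro: continuous_on_subset)
  then obtain d where d: "0 < d" "\<And>x y. x \<in> {-\<bar>R\<bar>-1..\<bar>R\<bar>+1} \<Longrightarrow> y \<in> {-\<bar>R\<bar>-1..\<bar>R\<bar>+1} \<Longrightarrow> \<bar>x - y\<bar> < d \<Longrightarrow> \<bar>f x - f y\<bar> < \<eta>"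
    unfolding uniformly_continuous_on_def using \<eta> by (metis dist_real_def abs_minus_commute)
  \<comment> \<open>With \<open>d' \<le> 1\<close>, two points at distance less than
    \<open>d'\<close> either both lie in the larger interval, where \<open>f\<close> is uniformly
    continuous, or both lie where \<open>f\<close> is below \<open>\<eta> / 2\<close>.\<close>
  define d' where "d' = min d 1"
  have d': "0 < d'" using d by (simp add: d'_def)
  have "\<bar>f x - f y\<bar> \<le> \<eta> + (2 * B / d'\<^sup>2) * (x - y)\<^sup>2" for x y
  proof (cases "\<bar>x - y\<bar> < d'")
    case True
    have "\<bar>f x - f y\<bar> < \<eta>"
    proof (cases "\<bar>x\<bar> \<le> \<bar>R\<bar> + 1 \<and> \<bar>y\<bar> \<le> \<bar>R\<bar> + 1")
      case True then show ?thesis using d(2)[of x y] \<open>\<bar>x - y\<bar> < d'\<close> by (auto simp: d'_def abs_le_iff)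
    next
      case False
      then have "R \<le> \<bar>x\<bar>" "R \<le> \<bar>y\<bar>" using True by (auto simp: d'_def abs_if split: if_splits)
      then show ?thesis using R[of x] R[of y] by linarith
    qed
    moreover have "0 \<le> (2 * B / d'\<^sup>2) * (x - y)\<^sup>2" using B by simp
    ultimately show ?thesis by linarith
  next
    case False
    then have "d'\<^sup>2 \<le> (x - y)\<^sup>2" using d' by (simp add: abs_le_square_iff[symmetric])
    then have "2 * B / d'\<^sup>2 * d'\<^sup>2 \<le> (2 * B / d'\<^sup>2) * (x - y)\<^sup>2"
      using B by (intro mult_left_mono) auto
    moreover have "2 * B / d'\<^sup>2 * d'\<^sup>2 = 2 * B" using d' by simp
    ultimately show ?thesis using B(2)[of x] B(2)[of y] \<eta> by linarith
  qed
  then show ?thesis using that[of "2 * B / d'\<^sup>2"] B by simp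
qed

lemma C0_hyperbolic_decay:
  assumes f: "f \<in> C0" and \<eta>: "0 < \<eta>"
  obtains C where "0 \<le> C" "\<And>x. \<bar>f x\<bar> \<le> \<eta> + C / (1 + \<bar>x\<bar>)"
proof -
  obtain B where B: "0 \<le> B" "\<And>x. \<bar>f x\<bar> \<le> B" using C0_bounded[OF f] by blast
  obtain R where R: "\<And>x. R \<le> \<bar>x\<bar> \<Longrightarrow> \<bar>f x\<bar> < \<eta>" using f \<eta> unfolding C0_iff by metis
  have "\<bar>f x\<bar> \<le> \<eta> + B * (1 + \<bar>R\<bar>) / (1 + \<bar>x\<bar>)" for x
  proof (cases "R \<le> \<bar>x\<bar>")
    case True
    have "0 \<le> B * (1 + \<bar>R\<bar>) / (1 + \<bar>x\<bar>)" using B by simp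
    with R[OF True] show ?thesis by linarith
  next
    case False
    then have "B * (1 + \<bar>x\<bar>) \<le> B * (1 + \<bar>R\<bar>)" using B by (intro mult_left_mono) auto
    then have "B \<le> B * (1 + \<bar>R\<bar>) / (1 + \<bar>x\<bar>)" by (simp add: pos_le_divide_eq)
    then show ?thesis using B(2)[of x] \<eta> by linarith
  qed
  then show ?thesis using that[of "B * (1 + \<bar>R\<bar>)"] B by simp
qed

text \<open>Peetre's inequality. It transfers decay at the random endpoint to decay at the starting
  point, at the cost of a factor controlled by the displacement.\<close>

lemma one_plus_abs_div_le: "1 / (1 + \<bar>y\<bar>) \<le> (1 + \<bar>y - x\<bar>) / (1 + \<bar>x :: real\<bar>)"
proof -
  have "1 + \<bar>x\<bar> \<le> 1 + \<bar>y\<bar> + \<bar>y - x\<bar> + \<bar>y\<bar> * \<bar>y - x\<bar>"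
    using mult_nonneg_nonneg[of "\<bar>y\<bar>" "\<bar>y - x\<bar>"] by linarith
  also have "\<dots> = (1 + \<bar>y - x\<bar>) * (1 + \<bar>y\<bar>)" by (simp add: algebra_simps)
  finally show ?thesis by (simp add: divide_le_eq pos_le_divide_eq mult.commute)
qed

locale bilipschitz =
  fixes Lam Laminv :: "real \<Rightarrow> real" and cm cp :: real
  assumes inv: "Lam (Laminv y) = y" "Laminv (Lam x) = x" and cm: "0 < cm"
    and bilip: "cm * \<bar>x - y\<bar> \<le> \<bar>Lam x - Lam y\<bar>" "\<bar>Lam x - Lam y\<bar> \<le> cp * \<bar>x - y\<bar>"
begin

lemma cp: "0 < cp"
  using bilip(1)[of 0 1] bilip(2)[of 0 1] cm by simp

lemma Laminv_lip: "\<bar>Laminv x - Laminv y\<bar> \<le> \<bar>x - y\<bar> / cm"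
  using bilip(1)[of "Laminv x" "Laminv y"] cm by (simp add: inv pos_le_divide_eq mult.commute)

lemma Laminv_lower: "\<bar>x - y\<bar> / cp \<le> \<bar>Laminv x - Laminv y\<bar>"
  using bilip(2)[of "Laminv x" "Laminv y"] cp by (simp add: inv pos_divide_le_eq mult.commute)

lemma continuous_Lam: "continuous_on S Lam" and continuous_Laminv: "continuous_on S Laminv"
proof -
  have "cp-lipschitz_on S Lam" using bilip(2) cp by (auto simp: lipschitz_on_def dist_real_def)
  then show "continuous_on S Lam" by (rule lipschitz_on_continuous_on)
  have "(1/cm)-lipschitz_on S Laminv" using Laminv_lip cm by (auto simp: lipschitz_on_def dist_real_def)
  then show "continuous_on S Laminv" by (rule lipschitz_on_continuous_on)
qed

lemma Lam_measurable [measurable]: "Lam \<in> borel_measurable borel" "Laminv \<in> borel_measurable borel"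
  using continuous_Lam continuous_Laminv by (auto intro: borel_measurable_continuous_onI)

lemma C0_comp_Laminv:
  assumes "f \<in> C0" shows "(\<lambda>y. f (Laminv y)) \<in> C0"
  unfolding C0_iff
proof (intro conjI allI impI)
  show "continuous_on UNIV (\<lambda>y. f (Laminv y))"
    using assms by (auto simp: C0_def intro: continuous_on_compose2[OF _ continuous_Laminv])
  fix e :: real assume "0 < e"
  then obtain R where R: "\<And>x. R \<le> \<bar>x\<bar> \<Longrightarrow> \<bar>f x\<bar> < e" using assms unfolding C0_iff by metis
  have "\<bar>f (Laminv y)\<bar> < e" if "cp * (\<bar>R\<bar> + \<bar>Laminv 0\<bar>) \<le> \<bar>y\<bar>" for y
  proof -
    have "\<bar>R\<bar> + \<bar>Laminv 0\<bar> \<le> \<bar>y\<bar> / cp" using that cp by (simp add: pos_le_divide_eq mult.commute)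
    also have "\<dots> \<le> \<bar>Laminv y - Laminv 0\<bar>" using Laminv_lower[of y 0] by simp
    finally show ?thesis by (intro R) linarith
  qed
  then show "\<exists>R. \<forall>x. R \<le> \<bar>x\<bar> \<longrightarrow> \<bar>f (Laminv x)\<bar> < e" by blast
qed

lemma C0_comp_Lam:
  assumes "f \<in> C0" shows "(\<lambda>y. f (Lam y)) \<in> C0"
  unfolding C0_iff
proof (intro conjI allI impI)
  show "continuous_on UNIV (\<lambda>y. f (Lam y))"
    using assms by (auto simp: C0_def intro: continuous_on_compose2[OF _ continuous_Lam])
  fix e :: real assume "0 < e"
  then obtain R where R: "\<And>x. R \<le> \<bar>x\<bar> \<Longrightarrow> \<bar>f x\<bar> < e" using assms unfolding C0_iff by metis
  have "\<bar>f (Lam y)\<bar> < e" if "(\<bar>R\<bar> + \<bar>Lam 0\<bar>) / cm \<le> \<bar>y\<bar>" for y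
  proof -
    have "\<bar>R\<bar> + \<bar>Lam 0\<bar> \<le> cm * \<bar>y\<bar>" using that cm by (simp add: pos_divide_le_eq mult.commute)
    also have "\<dots> \<le> \<bar>Lam y - Lam 0\<bar>" using bilip(1)[of y 0] by simp
    finally show ?thesis by (intro R) linarith
  qed
  then show "\<exists>R. \<forall>x. R \<le> \<bar>x\<bar> \<longrightarrow> \<bar>f (Lam x)\<bar> < e" by blast
qed

end

locale diffusion = wiener M W + drift \<beta> L K + bilipschitz Lam Laminv cm cp
  for M :: "'a measure" and W \<beta> L K Lam Laminv cm cp
begin

definition Y :: "real \<Rightarrow> real \<Rightarrow> 'a \<Rightarrow> real" where
  "Y y t \<omega> = sol (\<lambda>r. y + W r \<omega>) t"

definition flow :: "real \<Rightarrow> real \<Rightarrow> 'a \<Rightarrow> real" where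
  "flow x t \<omega> = Laminv (Y (Lam x) t \<omega>)"

definition P :: "real \<Rightarrow> real \<Rightarrow> real measure" where
  "P t x = distr M borel (flow x t)"

lemma noise_continuous: "\<omega> \<in> space M \<Longrightarrow> continuous_on {0..} (\<lambda>r. y + W r \<omega>)"
  by (intro continuous_intros W_continuous)

lemma Y_measurable_pair:
  assumes "0 \<le> t" shows "(\<lambda>(y, \<omega>). Y y t \<omega>) \<in> borel_measurable (borel \<Otimes>\<^sub>M M)"
  unfolding Y_def split_beta
proof (rule sol_measurable[OF assms])
  show "continuous_on {0..} (\<lambda>r. fst z + W r (snd z))" if "z \<in> space (borel \<Otimes>\<^sub>M M)" for z
    using that by (intro noise_continuous) (auto simp: space_pair_measure)
  fix r :: real assume "0 \<le> r"
  then have [measurable]: "W r \<in> borel_measurable M" by (rule W_measurable)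
  show "(\<lambda>z. fst z + W r (snd z)) \<in> borel_measurable (borel \<Otimes>\<^sub>M M)" by measurable
qed

lemma Y_measurable: "0 \<le> t \<Longrightarrow> Y y t \<in> borel_measurable M"
  using measurable_compose[OF measurable_Pair1'[of y borel M] Y_measurable_pair] by simp

lemma flow_measurable_pair:
  assumes "0 \<le> t" shows "(\<lambda>(x, \<omega>). flow x t \<omega>) \<in> borel_measurable (borel \<Otimes>\<^sub>M M)"
proof -
  have "(\<lambda>z. (Lam (fst z), snd z)) \<in> measurable (borel \<Otimes>\<^sub>M M) (borel \<Otimes>\<^sub>M M)" by measurable
  from measurable_compose[OF measurable_compose[OF this Y_measurable_pair[OF assms]] Lam_measurable(2)]
  show ?thesis by (simp add: flow_def split_beta)
qed

lemma flow_measurable: "0 \<le> t \<Longrightarrow> flow x t \<in> borel_measurable M"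
  using measurable_compose[OF Y_measurable Lam_measurable(2)] by (simp add: flow_def[abs_def])

lemma Y_adapted:
  assumes "0 \<le> r" "r \<le> s" shows "Y y r \<in> borel_measurable (natural_filtration M W s)"
  unfolding Y_def
proof (rule sol_measurable[OF assms(1)])
  show "continuous_on {0..} (\<lambda>r. y + W r \<omega>)" if "\<omega> \<in> space (natural_filtration M W s)" for \<omega>
    using that by (intro noise_continuous) (simp add: natural_filtration_eq)
  show "(\<lambda>\<omega>. y + W u \<omega>) \<in> borel_measurable (natural_filtration M W s)" if "0 \<le> u" "u \<le> r" for u
    using that assms by (intro borel_measurable_add natural_filtration_measurable) auto
qed

lemma Y_0: "\<omega> \<in> space M \<Longrightarrow> Y y 0 \<omega> = y"
  unfolding Y_def by (simp add: sol_0[OF noise_continuous] W_0)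

lemma Y_continuous: "\<omega> \<in> space M \<Longrightarrow> continuous_on {0..} (\<lambda>t. Y y t \<omega>)"
  using sol_props(1)[OF noise_continuous] by (simp add: Y_def)

lemma Y_bound: "\<omega> \<in> space M \<Longrightarrow> 0 \<le> t \<Longrightarrow> \<bar>Y y t \<omega> - y\<bar> \<le> K * t + \<bar>W t \<omega>\<bar>"
  using sol_minus_noise[OF noise_continuous, of \<omega> t y] unfolding Y_def by linarith

lemma Y_lip: "\<omega> \<in> space M \<Longrightarrow> 0 \<le> t \<Longrightarrow> \<bar>Y y t \<omega> - Y z t \<omega>\<bar> \<le> \<bar>y - z\<bar> * exp (L * t)"
  unfolding Y_def by (rule sol_stability[OF noise_continuous noise_continuous]) auto

text \<open>The flow property in terms of the path-valued variable \<open>shift\<close>. The horizon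
  \<open>t + 1\<close> is positive also for \<open>t = 0\<close>, and \<open>min r (t + 1)\<close>
  continues an element of the path space to a continuous path on all of
  \<open>[0,\<infinity>)\<close>.\<close>

lemma Y_shift:
  assumes \<omega>: "\<omega> \<in> space M" and s: "0 \<le> s" and t: "0 \<le> t"
  shows "Y y (s + t) \<omega> = sol (\<lambda>r. Y y s \<omega> + shift s (t + 1) \<omega> (min r (t + 1))) t"
proof -
  have "Y y (s + t) \<omega> = sol (\<lambda>r. Y y s \<omega> + (W (s + r) \<omega> - W s \<omega>)) t"
    using sol_flow[OF noise_continuous[OF \<omega>] s t, of y] by (simp add: Y_def)
  also have "\<dots> = sol (\<lambda>r. Y y s \<omega> + shift s (t + 1) \<omega> (min r (t + 1))) t"
  proof (rule sol_cong[OF _ _ t])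
    show "continuous_on {0..} (\<lambda>r. Y y s \<omega> + (W (s + r) \<omega> - W s \<omega>))"
      by (rule shift_continuous[OF W_continuous[OF \<omega>] s])
    have "continuous_on {0..t+1} (shift s (t + 1) \<omega>)"
      using shift_in_path_space[OF \<omega> s] by (simp add: mspace_path_space_iff)
    then show "continuous_on {0..} (\<lambda>r. Y y s \<omega> + shift s (t + 1) \<omega> (min r (t + 1)))"
      using t by (intro continuous_on_add continuous_on_const)
        (auto intro!: continuous_intros elim!: continuous_on_compose2)
  qed (use t in \<open>auto simp: shift_def\<close>)
  finally show ?thesis .
qed

lemma prob_space_P: "0 \<le> t \<Longrightarrow> prob_space (P t x)"
  unfolding P_def by (intro prob_space_distr flow_measurable)

lemma sets_P [simp, measurable_cong]: "sets (P t x) = sets borel" and space_P [simp]: "space (P t x) = UNIV"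
  by (simp_all add: P_def)

lemma P_measurable:
  assumes "0 \<le> t" shows "P t \<in> borel \<rightarrow>\<^sub>M prob_algebra borel"
proof (rule measurable_prob_algebraI)
  show "P t \<in> borel \<rightarrow>\<^sub>M subprob_algebra borel"
    unfolding P_def using flow_measurable_pair[OF assms]
    by (intro measurable_distr2[where M=M]) (auto intro!: measurable_const simp: space_subprob_algebra prob_space_imp_subprob_space prob_space_axioms)
qed (rule prob_space_P[OF assms])

text \<open>Independence of past and future makes the joint law a product, and stationarity replaces
  the law of \<open>shift s T\<close> by that of \<open>shift 0 T\<close>.\<close>

lemma pair_law:
  assumes s: "0 \<le> s" and T: "0 < T" and U: "U \<in> measurable (natural_filtration M W s) S"
  shows "distr M (S \<Otimes>\<^sub>M path_borel T) (\<lambda>\<omega>. (U \<omega>, shift s T \<omega>))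
    = distr M S U \<Otimes>\<^sub>M distr M (path_borel T) (shift 0 T)"
proof (rule pair_measure_eqI[symmetric])
  have sub: "sets (natural_filtration M W s) \<subseteq> sets M"
    unfolding natural_filtration_eq using W_measurable
    by (intro sets.sigma_sets_subset) (auto intro!: measurable_sets)
  have UM: "U \<in> measurable M S"
    using U sub by (auto simp: measurable_def natural_filtration_eq)
  have V: "shift s T \<in> measurable M (path_borel T)" by (rule shift_measurable[OF s T])
  show "sigma_finite_measure (distr M S U)" using UM
    by (intro prob_space_imp_sigma_finite prob_space_distr)
  show "sigma_finite_measure (distr M (path_borel T) (shift 0 T))"
    using shift_measurable[of 0 T] T by (intro prob_space_imp_sigma_finite prob_space_distr) auto
  fix A B assume A: "A \<in> sets (distr M S U)" and B: "B \<in> sets (distr M (path_borel T) (shift 0 T))"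
  have "(\<lambda>\<omega>. (U \<omega>, shift s T \<omega>)) -` (A \<times> B) \<inter> space M = (U -` A \<inter> space M) \<inter> (shift s T -` B \<inter> space M)"
    by auto
  moreover have "U -` A \<inter> space M \<in> sets (natural_filtration M W s)"
    using measurable_sets[OF U] A by (simp add: natural_filtration_eq)
  ultimately have "measure M ((\<lambda>\<omega>. (U \<omega>, shift s T \<omega>)) -` (A \<times> B) \<inter> space M)
    = measure M (U -` A \<inter> space M) * measure M (shift s T -` B \<inter> space M)"
    using shift_indep[OF s T] B by simp
  moreover have "(\<lambda>\<omega>. (U \<omega>, shift s T \<omega>)) \<in> measurable M (S \<Otimes>\<^sub>M path_borel T)"
    using UM V by (rule measurable_Pair)
  ultimately show "emeasure (distr M S U) A * emeasure (distr M (path_borel T) (shift 0 T)) B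
    = emeasure (distr M (S \<Otimes>\<^sub>M path_borel T) (\<lambda>\<omega>. (U \<omega>, shift s T \<omega>))) (A \<times> B)"
    unfolding shift_law[OF s T, symmetric] using A B UM V
    by (subst (1 2 3) emeasure_distr) (auto simp: emeasure_eq_measure ennreal_mult)
qed simp

text \<open>With \<open>pair_law\<close> this is Fubini's theorem: given the past, the flow
  restarted at its present position is driven by an independent copy of the noise. \<open>B\<close>
  ranges over the past of \<open>W\<close>; the whole space gives the Chapman-Kolmogorov equation,
  and events of the smaller past of the flow give the Markov property.\<close>

lemma markov:
  assumes s: "0 \<le> s" and t: "0 \<le> t" and B: "B \<in> sets (natural_filtration M W s)" and A: "A \<in> sets borel"
  shows "emeasure M (B \<inter> (flow x (s + t) -` A \<inter> space M))
    = (\<integral>\<^sup>+\<omega>. indicator B \<omega> * emeasure (P t (flow x s \<omega>)) A \<partial>M)"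
proof -
  define T where "T = t + 1"
  have T: "0 < T" using t by (simp add: T_def)
  \<comment> \<open>The indicator of \<open>B\<close> is carried along as a real coordinate, so that
    the information from the past is one random vector. Testing this coordinate against
    \<open>{1}\<close> in \<open>f\<close> recovers the event.\<close>
  define U where "U = (\<lambda>\<omega>. (indicator B \<omega> :: real, Y (Lam x) s \<omega>))"
  define \<Phi> where "\<Phi> = (\<lambda>(u :: real \<times> real, v). Laminv (sol (\<lambda>r. snd u + v (min r T)) t))"
  define \<nu> where "\<nu> = distr M (path_borel T) (shift 0 T)"
  have U: "U \<in> measurable (natural_filtration M W s) (borel \<Otimes>\<^sub>M borel)"
    unfolding U_def using B Y_adapted[OF s order_refl] by (intro measurable_Pair borel_measurable_indicator) auto
  have sub: "sets (natural_filtration M W s) \<subseteq> sets M"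
    unfolding natural_filtration_eq using W_measurable
    by (intro sets.sigma_sets_subset) (auto intro!: measurable_sets)
  have UM: "U \<in> measurable M (borel \<Otimes>\<^sub>M borel)"
    using U sub by (auto simp: measurable_def natural_filtration_eq)
  have BM: "B \<in> sets M" using B sub by auto
  have \<Phi>: "(\<lambda>z. sol (\<lambda>r. snd (fst z) + snd z (min r T)) t) \<in> borel_measurable (((borel :: real measure) \<Otimes>\<^sub>M borel) \<Otimes>\<^sub>M path_borel T)"
  proof (rule sol_measurable[OF t])
    fix z :: "(real \<times> real) \<times> (real \<Rightarrow> real)" assume "z \<in> space ((borel \<Otimes>\<^sub>M borel) \<Otimes>\<^sub>M path_borel T)"
    then have "continuous_on {0..T} (snd z)" by (auto simp: space_pair_measure mspace_path_space_iff)
    then have "continuous_on {0..} (\<lambda>r. snd z (min r T))"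
      by (rule continuous_on_compose2) (use T in \<open>auto intro!: continuous_intros\<close>)
    then show "continuous_on {0..} (\<lambda>r. snd (fst z) + snd z (min r T))" by (intro continuous_intros)
  next
    fix r assume "0 \<le> r" "r \<le> t"
    then have [measurable]: "(\<lambda>f. f (min r T)) \<in> borel_measurable (path_borel T)"
      using T by (intro path_eval_measurable) auto
    show "(\<lambda>z. snd (fst z) + snd z (min r T)) \<in> borel_measurable ((borel \<Otimes>\<^sub>M borel) \<Otimes>\<^sub>M path_borel T)"
      by measurable
  qed
  have \<Phi>: "\<Phi> \<in> borel_measurable ((borel \<Otimes>\<^sub>M borel) \<Otimes>\<^sub>M path_borel T)"
    using measurable_compose[OF \<Phi> Lam_measurable(2)] by (simp add: \<Phi>_def split_beta)
  define f where "f = (\<lambda>z. indicator {1::real} (fst (fst z)) * indicator A (\<Phi> z) :: ennreal)"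
  have f: "f \<in> borel_measurable ((borel \<Otimes>\<^sub>M borel) \<Otimes>\<^sub>M path_borel T)"
    unfolding f_def using \<Phi> A by measurable
  have V: "shift s T \<in> measurable M (path_borel T)" by (rule shift_measurable[OF s T])
  have V0: "shift 0 T \<in> measurable M (path_borel T)" using shift_measurable[OF _ T, of 0] by simp
  interpret \<nu>: prob_space \<nu> unfolding \<nu>_def by (rule prob_space_distr[OF V0])
  have f': "f \<in> borel_measurable ((borel \<Otimes>\<^sub>M borel) \<Otimes>\<^sub>M \<nu>)"
    using f by (simp add: \<nu>_def cong: measurable_cong_sets)
  have f'': "f \<in> borel_measurable (distr M (borel \<Otimes>\<^sub>M borel) U \<Otimes>\<^sub>M \<nu>)"
    using f' by (simp cong: measurable_cong_sets)
  have "emeasure M (B \<inter> (flow x (s + t) -` A \<inter> space M)) = (\<integral>\<^sup>+\<omega>. indicator (B \<inter> (flow x (s + t) -` A \<inter> space M)) \<omega> \<partial>M)"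
    using BM A flow_measurable[of "s + t" x] s t by (intro nn_integral_indicator[symmetric]) (auto intro!: measurable_sets)
  also have "\<dots> = (\<integral>\<^sup>+\<omega>. f (U \<omega>, shift s T \<omega>) \<partial>M)"
  proof (rule nn_integral_cong)
    fix \<omega> assume \<omega>: "\<omega> \<in> space M"
    have "\<Phi> (U \<omega>, shift s T \<omega>) = flow x (s + t) \<omega>"
      unfolding \<Phi>_def U_def flow_def Y_shift[OF \<omega> s t] T_def by simp
    then show "indicator (B \<inter> (flow x (s + t) -` A \<inter> space M)) \<omega> = f (U \<omega>, shift s T \<omega>)"
      using \<omega> by (auto simp: f_def U_def indicator_def)
  qed
  also have "\<dots> = (\<integral>\<^sup>+z. f z \<partial>distr M ((borel \<Otimes>\<^sub>M borel) \<Otimes>\<^sub>M path_borel T) (\<lambda>\<omega>. (U \<omega>, shift s T \<omega>)))"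
    using UM V f by (subst nn_integral_distr) auto
  also have "\<dots> = (\<integral>\<^sup>+z. f z \<partial>(distr M (borel \<Otimes>\<^sub>M borel) U \<Otimes>\<^sub>M \<nu>))"
    by (simp add: pair_law[OF s T U] \<nu>_def)
  also have "\<dots> = (\<integral>\<^sup>+u. \<integral>\<^sup>+v. f (u, v) \<partial>\<nu> \<partial>distr M (borel \<Otimes>\<^sub>M borel) U)"
    by (rule \<nu>.nn_integral_fst[OF f'', symmetric])
  also have "\<dots> = (\<integral>\<^sup>+\<omega>. \<integral>\<^sup>+v. f (U \<omega>, v) \<partial>\<nu> \<partial>M)"
    using UM \<nu>.borel_measurable_nn_integral_fst[OF f'] by (subst nn_integral_distr) auto
  also have "\<dots> = (\<integral>\<^sup>+\<omega>. indicator B \<omega> * emeasure (P t (flow x s \<omega>)) A \<partial>M)"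
  proof (rule nn_integral_cong)
    fix \<omega> assume \<omega>: "\<omega> \<in> space M"
    have "(\<integral>\<^sup>+v. f (U \<omega>, v) \<partial>\<nu>) = (\<integral>\<^sup>+\<omega>'. f (U \<omega>, shift 0 T \<omega>') \<partial>M)"
      unfolding \<nu>_def using measurable_Pair2[OF f, of "U \<omega>"] V0
      by (intro nn_integral_distr) (auto simp: space_pair_measure)
    also have "\<dots> = (\<integral>\<^sup>+\<omega>'. indicator B \<omega> * indicator (flow (flow x s \<omega>) t -` A \<inter> space M) \<omega>' \<partial>M)"
    proof (rule nn_integral_cong)
      fix \<omega>' assume \<omega>': "\<omega>' \<in> space M"
      have "\<Phi> (U \<omega>, shift 0 T \<omega>') = flow (flow x s \<omega>) t \<omega>'"
        using Y_shift[OF \<omega>' order_refl t, of "Y (Lam x) s \<omega>"]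
        unfolding \<Phi>_def U_def flow_def T_def by (simp add: inv Y_0[OF \<omega>'])
      then show "f (U \<omega>, shift 0 T \<omega>') = indicator B \<omega> * indicator (flow (flow x s \<omega>) t -` A \<inter> space M) \<omega>'"
        using \<omega>' by (auto simp: f_def U_def indicator_def)
    qed
    also have "\<dots> = indicator B \<omega> * emeasure M (flow (flow x s \<omega>) t -` A \<inter> space M)"
      using flow_measurable[OF t] A by (intro nn_integral_cmult_indicator) (auto intro: measurable_sets)
    also have "emeasure M (flow (flow x s \<omega>) t -` A \<inter> space M) = emeasure (P t (flow x s \<omega>)) A"
      unfolding P_def using flow_measurable[OF t] A by (simp add: emeasure_distr)
    finally show "(\<integral>\<^sup>+v. f (U \<omega>, v) \<partial>\<nu>) = indicator B \<omega> * emeasure (P t (flow x s \<omega>)) A" .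
  qed
  finally show ?thesis .
qed

lemma P_emeasure_measurable:
  assumes "0 \<le> t" "A \<in> sets borel" shows "(\<lambda>x. emeasure (P t x) A) \<in> borel_measurable borel"
  using measurable_prob_algebraD[OF P_measurable[OF assms(1)]] assms(2)
  by (rule measurable_emeasure_kernel)

lemma chapman_kolmogorov:
  assumes s: "0 \<le> s" and t: "0 \<le> t"
  shows "P (s + t) x = P s x \<bind> P t"
proof (rule measure_eqI)
  have k: "P t \<in> measurable (P s x) (subprob_algebra borel)"
    using measurable_prob_algebraD[OF P_measurable[OF t]] by (simp cong: measurable_cong_sets)
  show "sets (P (s + t) x) = sets (P s x \<bind> P t)"
    using sets_bind[OF _ _, of "P s x" "P t" borel] by simp
  fix A assume "A \<in> sets (P (s + t) x)"
  then have A: "A \<in> sets borel" by simp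
  have "emeasure (P (s + t) x) A = emeasure M (space M \<inter> (flow x (s + t) -` A \<inter> space M))"
    unfolding P_def using flow_measurable[of "s + t" x] s t A by (subst emeasure_distr) (auto intro!: arg_cong[where f="emeasure M"])
  also have "\<dots> = (\<integral>\<^sup>+\<omega>. indicator (space M) \<omega> * emeasure (P t (flow x s \<omega>)) A \<partial>M)"
    using sets.top[of "natural_filtration M W s"] by (intro markov[OF s t _ A]) (simp add: natural_filtration_eq)
  also have "\<dots> = (\<integral>\<^sup>+\<omega>. emeasure (P t (flow x s \<omega>)) A \<partial>M)"
    by (intro nn_integral_cong) simp
  also have "\<dots> = (\<integral>\<^sup>+y. emeasure (P t y) A \<partial>P s x)"
    unfolding P_def[of s x] using flow_measurable[OF s] P_emeasure_measurable[OF t A]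
    by (intro nn_integral_distr[symmetric]) simp_all
  also have "\<dots> = emeasure (P s x \<bind> P t) A"
    using k A by (intro emeasure_bind[symmetric]) auto
  finally show "emeasure (P (s + t) x) A = emeasure (P s x \<bind> P t) A" .
qed

text \<open>The flow is adapted to \<open>W\<close>, so the identity of \<open>markov\<close> may be
  tested on the smaller natural filtration of the flow. The candidate for the conditional
  expectation is a function of the present position and hence measurable for that
  filtration.\<close>

lemma markov_process: "continuous_markov_process P x M (\<lambda>t \<omega>. flow x t \<omega>)"
  unfolding continuous_markov_process_def
proof (intro conjI ballI allI impI)
  show "prob_space M" by (rule prob_space_axioms)
  show "flow x t \<in> borel_measurable M" if "0 \<le> t" for t by (rule flow_measurable[OF that])
  show "flow x 0 \<omega> = x" if "\<omega> \<in> space M" for \<omega> using that by (simp add: flow_def Y_0 inv)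
  show "continuous_on {0..} (\<lambda>t. flow x t \<omega>)" if "\<omega> \<in> space M" for \<omega>
    unfolding flow_def by (rule continuous_on_compose2[OF continuous_Laminv Y_continuous[OF that]]) auto
  fix s t :: real and A :: "real set" assume s: "0 \<le> s" and t: "0 \<le> t" and A: "A \<in> sets borel"
  let ?F = "natural_filtration M (flow x) s"
  let ?G = "{flow x r -` B \<inter> space M | r B. 0 \<le> r \<and> r \<le> s \<and> B \<in> sets borel}"
  have F: "sets ?F = sigma_sets (space M) ?G" "space ?F = space M"
    unfolding natural_filtration_def by (auto simp: space_measure_of_conv intro!: sets_measure_of)
  have sub: "sets ?F \<subseteq> sets (natural_filtration M W s)"
  proof -
    have "?G \<subseteq> sets (natural_filtration M W s)"
    proof clarify
      fix r and B :: "real set" assume r: "0 \<le> r" "r \<le> s" and B: "B \<in> sets borel"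
      have "flow x r \<in> borel_measurable (natural_filtration M W s)"
        using measurable_compose[OF Y_adapted[OF r] Lam_measurable(2)] by (simp add: flow_def[abs_def])
      from measurable_sets[OF this B] show "flow x r -` B \<inter> space M \<in> sets (natural_filtration M W s)"
        by (simp add: natural_filtration_eq)
    qed
    from sets.sigma_sets_subset[OF this] show ?thesis by (simp add: F natural_filtration_eq)
  qed
  have subM: "sets ?F \<subseteq> sets M"
    unfolding F using flow_measurable by (intro sets.sigma_sets_subset) (auto intro!: measurable_sets)
  interpret fs: finite_measure_subalgebra M ?F
    by unfold_locales (use subM F in \<open>auto simp: subalgebra_def\<close>)
  let ?f = "indicator (flow x (s + t) -` A \<inter> space M) :: 'a \<Rightarrow> real"
  let ?g = "\<lambda>\<omega>. measure (P t (flow x s \<omega>)) A"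
  have fm: "flow x s \<in> borel_measurable ?F"
    using s by (intro measurableI) (auto simp: F intro!: sigma_sets.Basic)
  have gF: "?g \<in> borel_measurable ?F"
    unfolding measure_def by (rule measurable_compose[OF fm]) (intro borel_measurable_enn2real P_emeasure_measurable t A)
  have gM: "?g \<in> borel_measurable M" using gF by (rule measurable_from_subalg[OF fs.subalg])
  have fset: "flow x (s + t) -` A \<inter> space M \<in> sets M"
    using flow_measurable[of "s+t" x] s t A by (auto intro: measurable_sets)
  have g1: "?g \<omega> \<le> 1" for \<omega>
    using prob_space.prob_le_1[OF prob_space_P[OF t]] .
  have "AE \<omega> in M. real_cond_exp M ?F ?f \<omega> = ?g \<omega>"
  proof (rule fs.real_cond_exp_charact)
    show "integrable M ?f" using fset
      by (intro integrable_real_indicator) (auto simp: emeasure_eq_measure)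
    show "integrable M ?g" using g1 gM by (intro integrable_const_bound[where B=1]) auto
    fix B assume B: "B \<in> sets ?F"
    then have BM: "B \<in> sets M" using subM by auto
    have f_eq: "(\<integral>\<omega>\<in>B. ?f \<omega> \<partial>M) = prob (B \<inter> (flow x (s + t) -` A \<inter> space M))"
      unfolding set_lebesgue_integral_def using BM fset
      by (subst Bochner_Integration.integral_cong[OF refl, where g="indicator (B \<inter> (flow x (s + t) -` A \<inter> space M))"])
        (auto simp: indicator_def sets.sets_into_space Int_absorb2)
    have "ennreal (prob (B \<inter> (flow x (s + t) -` A \<inter> space M))) = (\<integral>\<^sup>+\<omega>. indicator B \<omega> * emeasure (P t (flow x s \<omega>)) A \<partial>M)"
      using markov[OF s t _ A, of B x] B sub by (auto simp: emeasure_eq_measure)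
    also have "\<dots> = (\<integral>\<^sup>+\<omega>. ennreal (indicator B \<omega> *\<^sub>R ?g \<omega>) \<partial>M)"
      using prob_space.axioms(1)[OF prob_space_P[OF t]]
      by (intro nn_integral_cong) (auto simp: finite_measure.emeasure_eq_measure indicator_def)
    also have "\<dots> = ennreal (\<integral>\<omega>\<in>B. ?g \<omega> \<partial>M)"
      unfolding set_lebesgue_integral_def using g1 gM BM
      by (intro nn_integral_eq_integral integrable_const_bound[where B=1]) (auto simp: indicator_def)
    finally have "ennreal (prob (B \<inter> (flow x (s + t) -` A \<inter> space M))) = ennreal (\<integral>\<omega>\<in>B. ?g \<omega> \<partial>M)" .
    moreover have "0 \<le> (\<integral>\<omega>\<in>B. ?g \<omega> \<partial>M)"
      unfolding set_lebesgue_integral_def by (intro integral_nonneg_AE) (auto intro!: AE_I2)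
    ultimately show "(\<integral>\<omega>\<in>B. ?f \<omega> \<partial>M) = (\<integral>\<omega>\<in>B. ?g \<omega> \<partial>M)"
      unfolding f_eq by (metis ennreal_inj measure_nonneg)
  qed (rule gF)
  then show "AE \<omega> in M. real_cond_exp M ?F ?f \<omega> = ?g \<omega>" .
qed

end


section \<open>Feller property of the transition kernels\<close>

context diffusion begin

lemma second_moment:
  assumes "0 \<le> t"
  shows "integrable M (\<lambda>\<omega>. (W t \<omega>)\<^sup>2)" "expectation (\<lambda>\<omega>. (W t \<omega>)\<^sup>2) = t"
proof -
  have "integrable M (\<lambda>\<omega>. (W t \<omega>)\<^sup>2) \<and> expectation (\<lambda>\<omega>. (W t \<omega>)\<^sup>2) = t"
  proof (cases "t = 0")
    case True
    have "integrable M (\<lambda>\<omega>. (W 0 \<omega>)\<^sup>2) \<longleftrightarrow> integrable M (\<lambda>\<omega>. 0 :: real)"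
      by (intro Bochner_Integration.integrable_cong) (auto simp: W_0)
    moreover have "expectation (\<lambda>\<omega>. (W 0 \<omega>)\<^sup>2) = expectation (\<lambda>\<omega>. 0)"
      by (intro Bochner_Integration.integral_cong) (auto simp: W_0)
    ultimately show ?thesis using True by simp
  qed (use moments[of t] assms in auto)
  then show "integrable M (\<lambda>\<omega>. (W t \<omega>)\<^sup>2)" "expectation (\<lambda>\<omega>. (W t \<omega>)\<^sup>2) = t" by auto
qed

lemma displacement_sq:
  assumes t: "0 \<le> t"
  shows "integrable M (\<lambda>\<omega>. (Y y t \<omega> - y)\<^sup>2)" "expectation (\<lambda>\<omega>. (Y y t \<omega> - y)\<^sup>2) \<le> 2 * K\<^sup>2 * t\<^sup>2 + 2 * t"
proof -
  have le: "(Y y t \<omega> - y)\<^sup>2 \<le> 2 * K\<^sup>2 * t\<^sup>2 + 2 * (W t \<omega>)\<^sup>2" if "\<omega> \<in> space M" for \<omega>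
  proof -
    have "(Y y t \<omega> - y)\<^sup>2 \<le> (K * t + \<bar>W t \<omega>\<bar>)\<^sup>2"
      using Y_bound[OF that t, of y] by (simp add: abs_le_square_iff[symmetric])
    also have "\<dots> \<le> 2 * (K * t)\<^sup>2 + 2 * (W t \<omega>)\<^sup>2"
      using zero_le_power2[of "K * t - \<bar>W t \<omega>\<bar>"] by (simp add: power2_sum power2_diff)
    finally show ?thesis by (simp add: power_mult_distrib)
  qed
  have int: "integrable M (\<lambda>\<omega>. 2 * K\<^sup>2 * t\<^sup>2 + 2 * (W t \<omega>)\<^sup>2)"
    using second_moment[OF t] by simp
  show 1: "integrable M (\<lambda>\<omega>. (Y y t \<omega> - y)\<^sup>2)"
    using Y_measurable[OF t, of y] le
    by (intro Bochner_Integration.integrable_bound[OF int]) (auto intro!: AE_I2)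
  have "expectation (\<lambda>\<omega>. (Y y t \<omega> - y)\<^sup>2) \<le> expectation (\<lambda>\<omega>. 2 * K\<^sup>2 * t\<^sup>2 + 2 * (W t \<omega>)\<^sup>2)"
    by (intro integral_mono 1 int le)
  also have "\<dots> = 2 * K\<^sup>2 * t\<^sup>2 + 2 * t" using second_moment[OF t] prob_space by simp
  finally show "expectation (\<lambda>\<omega>. (Y y t \<omega> - y)\<^sup>2) \<le> 2 * K\<^sup>2 * t\<^sup>2 + 2 * t" .
qed

lemma integral_P:
  assumes "f \<in> C0" "0 \<le> t" shows "(\<integral>y. f y \<partial>P t x) = expectation (\<lambda>\<omega>. f (Laminv (Y (Lam x) t \<omega>)))"
  unfolding P_def using flow_measurable[OF assms(2)] C0_measurable[OF assms(1)]
  by (subst integral_distr) (auto simp: flow_def)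

lemma integrable_C0_Y:
  assumes h: "h \<in> C0" and t: "0 \<le> t" shows "integrable M (\<lambda>\<omega>. h (Y y t \<omega>))"
proof -
  obtain B where "\<And>x. \<bar>h x\<bar> \<le> B" using C0_bounded[OF h] by blast
  then show ?thesis
    using measurable_compose[OF Y_measurable[OF t] C0_measurable[OF h]]
    by (intro integrable_const_bound[where B=B]) auto
qed

text \<open>Continuity comes from the Lipschitz dependence of \<open>Y\<close> on its starting
  point. Decay comes from Peetre's inequality, since the bound on the displacement does not depend
  on the starting point.\<close>

lemma expectation_C0:
  assumes h: "h \<in> C0" and t: "0 \<le> t" shows "(\<lambda>y. expectation (\<lambda>\<omega>. h (Y y t \<omega>))) \<in> C0"
  unfolding C0_iff
proof (intro conjI allI impI)
  show "continuous_on UNIV (\<lambda>y. expectation (\<lambda>\<omega>. h (Y y t \<omega>)))"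
    unfolding continuous_on_iff
  proof (intro ballI allI impI)
    fix y e :: real assume e: "0 < e"
    then obtain C where C: "0 \<le> C" "\<And>x y. \<bar>h x - h y\<bar> \<le> e/2 + C * (x - y)\<^sup>2"
      using C0_quadratic_modulus[OF h, of "e/2"] by (metis half_gt_zero)
    define D where "D = C * (exp (L * t))\<^sup>2"
    have D: "0 \<le> D" using C by (simp add: D_def)
    define d where "d = min 1 (e / (2 * (D + 1)))"
    have d: "0 < d" using e D by (simp add: d_def)
    have "\<bar>expectation (\<lambda>\<omega>. h (Y z t \<omega>)) - expectation (\<lambda>\<omega>. h (Y y t \<omega>))\<bar> < e" if z: "\<bar>z - y\<bar> < d" for z
    proof -
      have "\<bar>h (Y z t \<omega>) - h (Y y t \<omega>)\<bar> \<le> e/2 + D * (z - y)\<^sup>2" if \<omega>: "\<omega> \<in> space M" for \<omega>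
      proof -
        have "(Y z t \<omega> - Y y t \<omega>)\<^sup>2 \<le> (\<bar>z - y\<bar> * exp (L * t))\<^sup>2"
          using Y_lip[OF \<omega> t, of z y] by (simp add: abs_le_square_iff[symmetric])
        then have "C * (Y z t \<omega> - Y y t \<omega>)\<^sup>2 \<le> D * (z - y)\<^sup>2"
          using mult_left_mono[OF _ C(1)] by (fastforce simp: D_def power_mult_distrib mult_ac)
        then show ?thesis using C(2)[of "Y z t \<omega>" "Y y t \<omega>"] by linarith
      qed
      then have "\<bar>expectation (\<lambda>\<omega>. h (Y z t \<omega>) - h (Y y t \<omega>))\<bar> \<le> expectation (\<lambda>\<omega>. e/2 + D * (z - y)\<^sup>2)"
        using integrable_C0_Y[OF h t]
        by (intro order_trans[OF integral_abs_bound] integral_mono integrable_abs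
            Bochner_Integration.integrable_diff) auto
      then have "\<bar>expectation (\<lambda>\<omega>. h (Y z t \<omega>)) - expectation (\<lambda>\<omega>. h (Y y t \<omega>))\<bar> \<le> e/2 + D * (z - y)\<^sup>2"
        using prob_space by (simp add: integrable_C0_Y h t)
      also have "D * (z - y)\<^sup>2 < e / 2"
      proof -
        have "(z - y)\<^sup>2 = \<bar>z - y\<bar> * \<bar>z - y\<bar>" by (simp add: power2_eq_square)
        also have "\<dots> \<le> 1 * d" using z d by (intro mult_mono) (auto simp: d_def)
        also have "\<dots> \<le> e / (2 * (D + 1))" by (simp add: d_def)
        finally have "D * (z - y)\<^sup>2 \<le> D * (e / (2 * (D + 1)))" using D by (rule mult_left_mono)
        also have "\<dots> < e / 2" using D e by (simp add: field_simps)
        finally show ?thesis .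
      qed
      finally show ?thesis by simp
    qed
    then show "\<exists>d>0. \<forall>z\<in>UNIV. dist z y < d \<longrightarrow> dist (expectation (\<lambda>\<omega>. h (Y z t \<omega>))) (expectation (\<lambda>\<omega>. h (Y y t \<omega>))) < e"
      using d by (auto simp: dist_real_def intro!: exI[of _ d])
  qed
  fix e :: real assume e: "0 < e"
  obtain C where C: "0 \<le> C" "\<And>x. \<bar>h x\<bar> \<le> e/2 + C / (1 + \<bar>x\<bar>)"
    using C0_hyperbolic_decay[OF h, of "e/2"] e by (metis half_gt_zero)
  \<comment> \<open>\<open>2 + K * t + t\<close> is the mean of \<open>2 + K * t + (W t)^2\<close>,
    which dominates \<open>1 + \<bar>Y y t - y\<bar>\<close>; bounding
    \<open>\<bar>W t\<bar>\<close> by \<open>1 + (W t)^2\<close> leaves only the second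
    moment.\<close>
  define D where "D = C * (2 + K * t + t)"
  have D: "0 \<le> D" using C K_nonneg t by (simp add: D_def)
  have bound: "\<bar>expectation (\<lambda>\<omega>. h (Y y t \<omega>))\<bar> \<le> e/2 + D / (1 + \<bar>y\<bar>)" for y
  proof -
    have int: "integrable M (\<lambda>\<omega>. e/2 + C * ((2 + K * t + (W t \<omega>)\<^sup>2) / (1 + \<bar>y\<bar>)))"
      using second_moment[OF t] by simp
    have "\<bar>h (Y y t \<omega>)\<bar> \<le> e/2 + C * ((2 + K * t + (W t \<omega>)\<^sup>2) / (1 + \<bar>y\<bar>))" if \<omega>: "\<omega> \<in> space M" for \<omega>
    proof -
      have "\<bar>W t \<omega>\<bar> \<le> 1 + (W t \<omega>)\<^sup>2"
        using zero_le_power2[of "\<bar>W t \<omega>\<bar> - 1"] zero_le_power2[of "W t \<omega>"] unfolding power2_diff by simp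
      then have "1 + \<bar>Y y t \<omega> - y\<bar> \<le> 2 + K * t + (W t \<omega>)\<^sup>2"
        using Y_bound[OF \<omega> t, of y] by linarith
      then have "(1 + \<bar>Y y t \<omega> - y\<bar>) / (1 + \<bar>y\<bar>) \<le> (2 + K * t + (W t \<omega>)\<^sup>2) / (1 + \<bar>y\<bar>)"
        by (intro divide_right_mono) auto
      with one_plus_abs_div_le[of "Y y t \<omega>" y]
      have "C * (1 / (1 + \<bar>Y y t \<omega>\<bar>)) \<le> C * ((2 + K * t + (W t \<omega>)\<^sup>2) / (1 + \<bar>y\<bar>))"
        using C(1) by (intro mult_left_mono) auto
      then show ?thesis using C(2)[of "Y y t \<omega>"] by simp
    qed
    then have "\<bar>expectation (\<lambda>\<omega>. h (Y y t \<omega>))\<bar> \<le> expectation (\<lambda>\<omega>. e/2 + C * ((2 + K * t + (W t \<omega>)\<^sup>2) / (1 + \<bar>y\<bar>)))"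
      by (intro order_trans[OF integral_abs_bound] integral_mono integrable_abs integrable_C0_Y int h t) auto
    also have "\<dots> = e/2 + D / (1 + \<bar>y\<bar>)"
      using second_moment[OF t] prob_space by (simp add: D_def)
    finally show ?thesis .
  qed
  have "\<bar>expectation (\<lambda>\<omega>. h (Y y t \<omega>))\<bar> < e" if "2 * (D + 1) / e \<le> \<bar>y\<bar>" for y
  proof -
    have "2 * (D + 1) \<le> e * \<bar>y\<bar>" using that e by (simp add: pos_divide_le_eq mult.commute)
    also have "\<dots> \<le> e * (1 + \<bar>y\<bar>)" using e by (intro mult_left_mono) auto
    finally have "D / (1 + \<bar>y\<bar>) < e / 2" using D by (simp add: pos_divide_less_eq)
    then show ?thesis using bound[of y] by linarith
  qed
  then show "\<exists>R. \<forall>x. R \<le> \<bar>x\<bar> \<longrightarrow> \<bar>expectation (\<lambda>\<omega>. h (Y x t \<omega>))\<bar> < e" by blast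
qed

lemma expectation_near_identity:
  assumes h: "h \<in> C0" and e: "0 < e"
  shows "\<forall>\<^sub>F t in at_right 0. \<forall>y. \<bar>expectation (\<lambda>\<omega>. h (Y y t \<omega>)) - h y\<bar> < e"
proof -
  obtain C where C: "0 \<le> C" "\<And>x y. \<bar>h x - h y\<bar> \<le> e/2 + C * (x - y)\<^sup>2"
    using C0_quadratic_modulus[OF h, of "e/2"] e by (metis half_gt_zero)
  have "((\<lambda>t. C * (2 * K\<^sup>2 * t\<^sup>2 + 2 * t)) \<longlongrightarrow> C * (2 * K\<^sup>2 * 0\<^sup>2 + 2 * 0)) (at_right 0)"
    by (intro tendsto_intros)
  then have "\<forall>\<^sub>F t in at_right 0. C * (2 * K\<^sup>2 * t\<^sup>2 + 2 * t) < e / 2"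
    using e by (intro order_tendstoD(2)) auto
  moreover have "\<forall>\<^sub>F t in at_right 0. (0 :: real) < t" by (rule eventually_at_right_less)
  ultimately show ?thesis
  proof eventually_elim
    case (elim t)
    then have t: "0 \<le> t" by simp
    show ?case
    proof
      fix y
      have "\<bar>expectation (\<lambda>\<omega>. h (Y y t \<omega>)) - h y\<bar> = \<bar>expectation (\<lambda>\<omega>. h (Y y t \<omega>) - h y)\<bar>"
        using prob_space by (simp add: integrable_C0_Y h t)
      also have "\<dots> \<le> expectation (\<lambda>\<omega>. e/2 + C * (Y y t \<omega> - y)\<^sup>2)"
        using displacement_sq[OF t, of y] C(2) integrable_C0_Y[OF h t]
        by (intro order_trans[OF integral_abs_bound] integral_mono integrable_abs
            Bochner_Integration.integrable_diff) auto
      also have "\<dots> \<le> e/2 + C * (2 * K\<^sup>2 * t\<^sup>2 + 2 * t)"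
        using displacement_sq[OF t, of y] C(1) prob_space by (simp add: mult_left_mono)
      finally show "\<bar>expectation (\<lambda>\<omega>. h (Y y t \<omega>)) - h y\<bar> < e" using elim by linarith
    qed
  qed
qed

lemma feller: "feller_transition P"
  unfolding feller_transition_def
proof (intro conjI ballI allI impI)
  show "P t \<in> borel \<rightarrow>\<^sub>M prob_algebra borel" if "0 \<le> t" for t by (rule P_measurable[OF that])
  show "P (s + t) x = P s x \<bind> P t" if "0 \<le> s" "0 \<le> t" for s t x by (rule chapman_kolmogorov[OF that])
  fix x
  have "P 0 x = distr M borel (\<lambda>_. x)"
    unfolding P_def by (rule distr_cong) (auto simp: flow_def Y_0 inv)
  then show "P 0 x = return borel x" by (simp add: distr_const)
next
  fix f :: "real \<Rightarrow> real" and t :: real assume f: "f \<in> C0" and t: "0 \<le> t"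
  show "(\<lambda>x. \<integral>y. f y \<partial>P t x) \<in> C0"
    unfolding integral_P[OF f t] by (rule C0_comp_Lam[OF expectation_C0[OF C0_comp_Laminv[OF f] t]])
next
  fix f :: "real \<Rightarrow> real" assume f: "f \<in> C0"
  show "uniform_limit UNIV (\<lambda>t x. \<integral>y. f y \<partial>P t x) f (at_right 0)"
  proof (rule uniform_limitI)
    fix e :: real assume "0 < e"
    from expectation_near_identity[OF C0_comp_Laminv[OF f] this] eventually_at_right_less[of 0]
    show "\<forall>\<^sub>F t in at_right 0. \<forall>x\<in>UNIV. dist (\<integral>y. f y \<partial>P t x) (f x) < e"
    proof eventually_elim
      case (elim t)
      then show ?case by (metis integral_P[OF f less_imp_le] dist_real_def inv(2))
    qed
  qed
qed

end


section \<open>The generator in the coordinate with additive noise\<close>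

lemma C0_add: "f \<in> C0 \<Longrightarrow> g \<in> C0 \<Longrightarrow> (\<lambda>x. f x + g x) \<in> C0"
  unfolding C0_def by (auto intro!: continuous_intros tendsto_eq_intros)

lemma C0_reflect:
  assumes "f \<in> C0" shows "(\<lambda>x. f (- x)) \<in> C0"
  using assms unfolding C0_iff
  by (auto intro!: continuous_on_compose2[of UNIV f] continuous_intros) (metis abs_minus_cancel)

lemma C0_bounded_mult:
  assumes f: "f \<in> C0" and g: "continuous_on UNIV g" "\<And>x. \<bar>g x\<bar> \<le> B"
  shows "(\<lambda>x. g x * f x) \<in> C0"
  unfolding C0_iff
proof (intro conjI allI impI)
  show "continuous_on UNIV (\<lambda>x. g x * f x)" using f g by (auto simp: C0_def intro!: continuous_intros)
  have B: "0 \<le> B" using g(2)[of 0] by linarith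
  fix e :: real assume "0 < e"
  then have "0 < e / (B + 1)" using B by simp
  then obtain R where R: "\<And>x. R \<le> \<bar>x\<bar> \<Longrightarrow> \<bar>f x\<bar> < e / (B + 1)"
    using f unfolding C0_iff by metis
  have "\<bar>g x * f x\<bar> < e" if "R \<le> \<bar>x\<bar>" for x
  proof -
    have "\<bar>g x * f x\<bar> \<le> (B + 1) * \<bar>f x\<bar>"
      unfolding abs_mult using g(2)[of x] by (intro mult_right_mono) auto
    also have "\<dots> < (B + 1) * (e / (B + 1))" using R[OF that] B by (intro mult_strict_left_mono) auto
    finally show ?thesis using B by simp
  qed
  then show "\<exists>R. \<forall>x. R \<le> \<bar>x\<bar> \<longrightarrow> \<bar>g x * f x\<bar> < e" by blast
qed

text \<open>A variant of \<open>C0_hyperbolic_decay\<close> whose right-hand side is differentiable,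
  so that it can be used in a differential inequality.\<close>

lemma C0_inverse_square_decay:
  assumes f: "f \<in> C0" and \<eta>: "0 < \<eta>"
  obtains C where "0 \<le> C" "\<And>x. \<bar>f x\<bar> \<le> \<eta> + C / (1 + x\<^sup>2)"
proof -
  obtain B where B: "0 \<le> B" "\<And>x. \<bar>f x\<bar> \<le> B" using C0_bounded[OF f] by blast
  obtain R where R: "\<And>x. R \<le> \<bar>x\<bar> \<Longrightarrow> \<bar>f x\<bar> < \<eta>" using f \<eta> unfolding C0_iff by metis
  have pos: "0 < 1 + x\<^sup>2" for x :: real by (simp add: add_pos_nonneg)
  have "\<bar>f x\<bar> \<le> \<eta> + B * (1 + R\<^sup>2) / (1 + x\<^sup>2)" for x
  proof (cases "R \<le> \<bar>x\<bar>")
    case True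
    have "0 \<le> B * (1 + R\<^sup>2) / (1 + x\<^sup>2)" using B by simp
    with R[OF True] show ?thesis by linarith
  next
    case False
    then have "x\<^sup>2 \<le> R\<^sup>2" by (simp add: abs_le_square_iff[symmetric])
    then have "B * (1 + x\<^sup>2) \<le> B * (1 + R\<^sup>2)" using B by (intro mult_left_mono) auto
    then have "B \<le> B * (1 + R\<^sup>2) / (1 + x\<^sup>2)" using pos[of x] by (simp add: pos_le_divide_eq)
    then show ?thesis using B(2)[of x] \<eta> by linarith
  qed
  then show ?thesis using that[of "B * (1 + R\<^sup>2)"] B by simp
qed

lemma C0_I_decay:
  assumes "continuous_on UNIV u" "\<And>\<eta>. 0 < \<eta> \<Longrightarrow> \<exists>C\<ge>0. \<forall>x. \<bar>u x\<bar> \<le> \<eta> + C / (1 + x\<^sup>2)"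
  shows "u \<in> C0"
  unfolding C0_iff
proof (intro conjI allI impI assms(1))
  fix e :: real assume e: "0 < e"
  then obtain C where C: "0 \<le> C" "\<And>x. \<bar>u x\<bar> \<le> e/2 + C / (1 + x\<^sup>2)"
    using assms(2)[of "e/2"] by (metis half_gt_zero)
  have "\<bar>u x\<bar> < e" if "2 * C / e + 1 \<le> \<bar>x\<bar>" for x
  proof -
    have "0 \<le> 2 * C / e" using C e by simp
    then have "1 \<le> \<bar>x\<bar>" using that by linarith
    then have "\<bar>x\<bar> * 1 \<le> \<bar>x\<bar> * \<bar>x\<bar>" by (intro mult_left_mono) auto
    then have "2 * C / e < 1 + x\<^sup>2" using that by (simp add: power2_eq_square)
    then have "C / (1 + x\<^sup>2) < e / 2" using e by (simp add: field_simps add_pos_nonneg)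
    then show ?thesis using C(2)[of x] by linarith
  qed
  then show "\<exists>R. \<forall>x. R \<le> \<bar>x\<bar> \<longrightarrow> \<bar>u x\<bar> < e" by blast
qed

section \<open>The equation \<open>u' = w - c u\<close> on the whole line\<close>

lemma antiderivative_exists:
  fixes f :: "real \<Rightarrow> real"
  assumes "continuous_on UNIV f"
  obtains F where "\<And>x. (F has_real_derivative f x) (at x)"
proof -
  have "\<exists>F. \<forall>x. - \<infinity> < ereal x \<longrightarrow> ereal x < \<infinity> \<longrightarrow> (F has_vector_derivative f x) (at x)"
    using assms by (intro einterval_antiderivative) (auto simp: continuous_on_eq_continuous_at)
  then show ?thesis using that by (auto simp: has_real_derivative_iff_has_vector_derivative)
qed

text \<open>A comparison principle in which boundedness takes the place of an initial value: a
  positive excess of \<open>u\<close> over \<open>S\<close> would grow exponentially backwards in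
  \<open>x\<close>.\<close>

lemma bounded_solution_le:
  fixes u :: "real \<Rightarrow> real"
  assumes c: "0 < c" and u: "\<And>x. (u has_real_derivative w x - c * u x) (at x)" "\<And>x. \<bar>u x\<bar> \<le> B"
    and S: "\<And>x. (S has_real_derivative S' x) (at x)" "\<And>x. \<bar>S x\<bar> \<le> B'"
    and super: "\<And>x. w x \<le> S' x + c * S x"
  shows "u x \<le> S x"
proof (rule ccontr)
  assume "\<not> u x \<le> S x"
  define D where "D = u x - S x"
  have D: "0 < D" using \<open>\<not> u x \<le> S x\<close> by (simp add: D_def)
  define E where "E = B + B'"
  have E: "0 \<le> E" using u(2)[of 0] S(2)[of 0] by (simp add: E_def)
  define G where "G = (\<lambda>x. exp (c * x) * (S x - u x))"
  have dG: "\<exists>d. (G has_real_derivative d) (at y) \<and> 0 \<le> d" for y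
  proof -
    have "(G has_real_derivative (exp (c * y) * c) * (S y - u y) + (S' y - (w y - c * u y)) * exp (c * y)) (at y)"
      unfolding G_def by (rule DERIV_mult) (auto intro!: derivative_eq_intros S(1) u(1))
    moreover have "(exp (c * y) * c) * (S y - u y) + (S' y - (w y - c * u y)) * exp (c * y) = exp (c * y) * (S' y + c * S y - w y)"
      by (simp add: algebra_simps)
    moreover have "0 \<le> exp (c * y) * (S' y + c * S y - w y)" using super[of y] by simp
    ultimately show ?thesis by metis
  qed
  \<comment> \<open>Going back by \<open>s\<close> multiplies the excess \<open>D\<close> by at
    least \<open>1 + c * s = 1 + E / D\<close>, which brings it to \<open>D + E\<close>, above the
    bound \<open>E\<close> of the difference.\<close>
  define s where "s = E / (D * c)"
  have s: "0 \<le> s" using E D c by (simp add: s_def)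
  have "G (x - s) \<le> G x"
    by (rule DERIV_nonneg_imp_nondecreasing[of "x - s" x G]) (use s dG in auto)
  then have "exp (c * (x - s)) * (S (x - s) - u (x - s)) \<le> - (exp (c * x) * D)"
    by (simp add: G_def D_def algebra_simps)
  moreover have "- E \<le> S (x - s) - u (x - s)" using u(2)[of "x - s"] S(2)[of "x - s"] by (simp add: E_def)
  then have "exp (c * (x - s)) * (- E) \<le> exp (c * (x - s)) * (S (x - s) - u (x - s))"
    by (intro mult_left_mono) auto
  ultimately have "exp (c * x) * D \<le> exp (c * (x - s)) * E" by simp
  also have "exp (c * (x - s)) = exp (c * x) * exp (- (c * s))"
    by (simp add: right_diff_distrib exp_diff exp_minus divide_inverse)
  finally have "D \<le> exp (- (c * s)) * E" by simp
  then have "D * exp (c * s) \<le> E" by (simp add: exp_minus field_simps)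
  moreover have "D * (1 + c * s) \<le> D * exp (c * s)"
    using D exp_ge_add_one_self[of "c * s"] by (intro mult_left_mono) auto
  moreover have "D * (1 + c * s) = D + E" using D c by (simp add: s_def field_simps)
  ultimately show False using D by linarith
qed

text \<open>The solution is \<open>exp (- (c * x))\<close> times the integral of
  \<open>exp (c * y) * w y\<close> from minus infinity to \<open>x\<close>. In place of an improper
  integral, the limit of an antiderivative \<open>A\<close> at minus infinity is caught between the
  monotone functions \<open>A - E\<close> and \<open>A + E\<close>, whose distance tends to 0
  there.\<close>

lemma bounded_solution_exists:
  assumes c: "0 < c" and w: "continuous_on UNIV w" "\<And>x. \<bar>w x\<bar> \<le> B"
  obtains u where "\<And>x. (u has_real_derivative w x - c * u x) (at x)" "\<And>x. \<bar>u x\<bar> \<le> B / c"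
proof -
  obtain A where A: "\<And>x. (A has_real_derivative exp (c * x) * w x) (at x)"
    by (rule antiderivative_exists[of "\<lambda>x. exp (c * x) * w x"]) (auto intro!: continuous_intros w(1))
  define E where "E = (\<lambda>x. B / c * exp (c * x))"
  have E: "(E has_real_derivative B * exp (c * x)) (at x)" for x
    unfolding E_def using c by (auto intro!: derivative_eq_intros)
  have B: "0 \<le> B" using w(2)[of 0] by linarith
  have E0: "0 \<le> E x" for x using B c by (simp add: E_def)
  have up: "A x + E x \<le> A y + E y" if "x \<le> y" for x y
  proof (rule DERIV_nonneg_imp_nondecreasing[OF that])
    fix z
    have "((\<lambda>x. A x + E x) has_real_derivative exp (c * z) * (w z + B)) (at z)"
      by (auto intro!: derivative_eq_intros A E simp: algebra_simps)
    moreover have "0 \<le> exp (c * z) * (w z + B)" using w(2)[of z] by simp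
    ultimately show "\<exists>d. ((\<lambda>x. A x + E x) has_real_derivative d) (at z) \<and> 0 \<le> d" by blast
  qed
  have dn: "A y - E y \<le> A x - E x" if "x \<le> y" for x y
  proof (rule DERIV_nonpos_imp_nonincreasing[OF that])
    fix z
    have "((\<lambda>x. A x - E x) has_real_derivative exp (c * z) * (w z - B)) (at z)"
      by (auto intro!: derivative_eq_intros A E simp: algebra_simps)
    moreover have "exp (c * z) * (w z - B) \<le> 0" using w(2)[of z] by (simp add: mult_le_0_iff)
    ultimately show "\<exists>d. ((\<lambda>x. A x - E x) has_real_derivative d) (at z) \<and> d \<le> 0" by blast
  qed
  have sep: "A x - E x \<le> A y + E y" for x y
    using dn[of "min x y" x] up[of "min x y" y] E0[of "min x y"] by simp
  \<comment> \<open>\<open>A + E\<close> is nondecreasing, so its infimum is its limit at minus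
    infinity, and this is also the limit of \<open>A\<close>.\<close>
  define l where "l = (INF x. A x + E x)"
  have l1: "A x - E x \<le> l" for x unfolding l_def by (intro cINF_greatest sep) auto
  have l2: "l \<le> A x + E x" for x
    unfolding l_def using sep[of 0] by (intro cINF_lower bdd_belowI2) auto
  define u where "u = (\<lambda>x. exp (- (c * x)) * (A x - l))"
  have "(u has_real_derivative w x - c * u x) (at x)" for x
  proof -
    have "(u has_real_derivative (exp (- (c * x)) * (- c)) * (A x - l) + (exp (c * x) * w x) * exp (- (c * x))) (at x)"
      unfolding u_def by (rule DERIV_mult) (auto intro!: derivative_eq_intros A)
    then show ?thesis by (simp add: u_def exp_minus field_simps)
  qed
  moreover have "\<bar>u x\<bar> \<le> B / c" for x
  proof -
    have "\<bar>A x - l\<bar> \<le> E x" using l1[of x] l2[of x] by linarith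
    then have "\<bar>u x\<bar> \<le> exp (- (c * x)) * E x" unfolding u_def abs_mult by simp
    also have "\<dots> = B / c" by (simp add: E_def exp_minus)
    finally show ?thesis .
  qed
  ultimately show ?thesis using that by blast
qed

text \<open>\<open>\<eta> / c + C / (1 + x\<^sup>2)\<close> is a supersolution of \<open>u' = w - c u\<close> as soon as \<open>c \<ge> 2\<close>.\<close>

lemma decaying_solution_exists:
  assumes c: "2 \<le> c" and w: "w \<in> C0"
  shows "\<exists>u\<in>C0. \<forall>x. (u has_real_derivative w x - c * u x) (at x)"
proof -
  obtain B where B: "0 \<le> B" "\<And>x. \<bar>w x\<bar> \<le> B" using C0_bounded[OF w] by blast
  obtain u where u: "\<And>x. (u has_real_derivative w x - c * u x) (at x)" "\<And>x. \<bar>u x\<bar> \<le> B / c"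
    using bounded_solution_exists[of c w B] c w B by (auto simp: C0_def)
  have "u \<in> C0"
  proof (rule C0_I_decay)
    show "continuous_on UNIV u" using u(1) by (intro DERIV_continuous_on) (auto intro: DERIV_subset)
    fix \<eta> :: real assume "0 < \<eta>"
    then obtain C where C: "0 \<le> C" "\<And>x. \<bar>w x\<bar> \<le> \<eta> + C / (1 + x\<^sup>2)" using C0_inverse_square_decay[OF w] by blast
    define S where "S = (\<lambda>x. \<eta> / c + C / (1 + x\<^sup>2))"
    define S' where "S' = (\<lambda>x. - (C * (2 * x)) / (1 + x\<^sup>2)\<^sup>2)"
    have pos: "0 < 1 + x\<^sup>2" for x :: real by (simp add: add_pos_nonneg)
    have S: "(S has_real_derivative S' x) (at x)" for x
      unfolding S_def S'_def using pos[of x]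
      by (auto intro!: derivative_eq_intros simp: power2_eq_square)
    have Sb: "\<bar>S x\<bar> \<le> \<eta> / c + C" for x
    proof -
      have "C / (1 + x\<^sup>2) \<le> C" using C(1) pos[of x] by (simp add: divide_le_eq mult_le_cancel_left1)
      then show ?thesis using C(1) \<open>0 < \<eta>\<close> c pos[of x] by (simp add: S_def abs_of_nonneg add_nonneg_nonneg)
    qed
    have super: "\<bar>w x\<bar> \<le> S' x + c * S x" for x
    proof -
      \<comment> \<open>This shows that \<open>S'\<close> is at least minus
        \<open>C / (1 + x\<^sup>2)\<close>. As \<open>c \<ge> 2\<close>, the term
        \<open>c * S x\<close> supplies twice that amount, and one copy remains to dominate
        \<open>w\<close>.\<close>
      have "2 * x \<le> 1 + x\<^sup>2" using zero_le_power2[of "x - 1"] by (simp add: power2_diff)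
      then have "C * (2 * x) \<le> C * (1 + x\<^sup>2)" using C(1) by (rule mult_left_mono)
      then have "C * (2 * x) / (1 + x\<^sup>2)\<^sup>2 \<le> C * (1 + x\<^sup>2) / (1 + x\<^sup>2)\<^sup>2" by (intro divide_right_mono) auto
      also have "\<dots> = C / (1 + x\<^sup>2)" using pos[of x] by (simp add: power2_eq_square)
      finally have 1: "- (C / (1 + x\<^sup>2)) \<le> S' x" by (simp add: S'_def)
      have "2 * (C / (1 + x\<^sup>2)) \<le> c * (C / (1 + x\<^sup>2))" using c C(1) pos[of x] by (intro mult_right_mono) auto
      moreover have "c * S x = \<eta> + c * (C / (1 + x\<^sup>2))" using c by (simp add: S_def distrib_left)
      ultimately show ?thesis using C(2)[of x] 1 by linarith
    qed
    have c0: "0 < c" using c by simp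
    have "u x \<le> S x" for x
    proof (rule bounded_solution_le[OF c0 u S Sb])
      show "w x \<le> S' x + c * S x" for x using super[of x] by linarith
    qed
    moreover have "- u x \<le> S x" for x
    proof (rule bounded_solution_le[OF c0 _ _ S Sb, of "\<lambda>x. - u x" "\<lambda>x. - w x" "B / c"])
      show "((\<lambda>x. - u x) has_real_derivative - w x - c * - u x) (at x)" for x
        using DERIV_minus[OF u(1)[of x]] by simp
      show "- w x \<le> S' x + c * S x" for x using super[of x] by linarith
    qed (use u in auto)
    ultimately have "\<bar>u x\<bar> \<le> \<eta> / c + C / (1 + x\<^sup>2)" for x unfolding S_def by (metis abs_le_iff)
    moreover have "\<eta> / c \<le> \<eta>" using c \<open>0 < \<eta>\<close> by (simp add: divide_le_eq)
    ultimately show "\<exists>C\<ge>0. \<forall>x. \<bar>u x\<bar> \<le> \<eta> + C / (1 + x\<^sup>2)" using C(1) by (meson add_right_mono order_trans)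
  qed
  with u show ?thesis by blast
qed

text \<open>The constant \<open>d / c\<close> is a supersolution for the difference. This estimate
  makes the fixed point argument for the resolvent contracting.\<close>

lemma decaying_solution_dist:
  assumes c: "0 < c" and u: "u \<in> C0" "\<And>x. (u has_real_derivative w x - c * u x) (at x)"
    and v: "v \<in> C0" "\<And>x. (v has_real_derivative z x - c * v x) (at x)"
    and d: "\<And>x. \<bar>w x - z x\<bar> \<le> d"
  shows "\<bar>u x - v x\<bar> \<le> d / c"
proof -
  have le: "u x - v x \<le> d / c" if u: "u \<in> C0" "\<And>x. (u has_real_derivative w x - c * u x) (at x)"
    and v: "v \<in> C0" "\<And>x. (v has_real_derivative z x - c * v x) (at x)"
    and d: "\<And>x. \<bar>w x - z x\<bar> \<le> d" for u v w z
  proof -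
    obtain B where B: "\<And>x. \<bar>u x - v x\<bar> \<le> B" using C0_bounded[OF C0_diff[OF u(1) v(1)]] by blast
    show ?thesis
    proof (rule bounded_solution_le[where u="\<lambda>x. u x - v x" and w="\<lambda>x. w x - z x" and S="\<lambda>_. d / c"
          and S'="\<lambda>_. 0" and c=c and B=B and B'="\<bar>d / c\<bar>"])
      show "((\<lambda>x. u x - v x) has_real_derivative w x - z x - c * (u x - v x)) (at x)" for x
        using DERIV_diff[OF u(2) v(2)] by (simp add: algebra_simps)
      show "w x - z x \<le> 0 + c * (d / c)" for x using d[of x] c by simp
    qed (use c B in \<open>auto intro!: derivative_eq_intros\<close>)
  qed
  have "v x - u x \<le> d / c"
    using d by (intro le[OF v u]) (simp add: abs_minus_commute)
  with le[OF u v d] show ?thesis by linarith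
qed

section \<open>The operator \<open>h''/2 + \<beta> h'\<close> and its resolvent\<close>

context drift
begin

text \<open>With \<open>k = h'\<close> the second condition reads
  \<open>h''/2 + \<beta> h' = g\<close>.\<close>

definition ode :: "(real \<Rightarrow> real) \<Rightarrow> (real \<Rightarrow> real) \<Rightarrow> bool" where
  "ode h g \<longleftrightarrow> (\<exists>k. \<forall>x. (h has_real_derivative k x) (at x) \<and>
     (k has_real_derivative 2 * g x - 2 * \<beta> x * k x) (at x))"

text \<open>Uniformity of the small-time expansion requires \<open>h'\<close>, and with it
  \<open>h''\<close>, to be in \<open>C0\<close>. Far out, the mean value theorem provides a point
  in each unit interval where \<open>k\<close> is small. The function
  \<open>k * exp (2 * B)\<close>, with derivative \<open>2 * g * exp (2 * B)\<close>, carries this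
  smallness to the whole interval, on which \<open>exp (2 * B)\<close> varies by at most the factor
  \<open>exp (2 * K)\<close>.\<close>

lemma ode_deriv_C0:
  assumes h: "h \<in> C0" and g: "g \<in> C0" and dh: "\<And>x. (h has_real_derivative k x) (at x)"
    and dk: "\<And>x. (k has_real_derivative 2 * g x - 2 * \<beta> x * k x) (at x)"
  shows "k \<in> C0"
  unfolding C0_iff
proof (intro conjI allI impI)
  show "continuous_on UNIV k" using dk by (intro DERIV_continuous_on) (auto intro: DERIV_subset)
  obtain B where B: "\<And>x. (B has_real_derivative \<beta> x) (at x)"
    using antiderivative_exists[OF continuous_drift_UNIV] by blast
  have BK: "\<bar>B x - B y\<bar> \<le> K * \<bar>x - y\<bar>" for x y
    using field_differentiable_bound[of UNIV B \<beta> K y x] B bdd by (auto simp: abs_minus_commute intro: DERIV_subset)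
  define p where "p = (\<lambda>x. k x * exp (2 * B x))"
  have dp: "(p has_real_derivative 2 * g x * exp (2 * B x)) (at x)" for x
  proof -
    have "(p has_real_derivative (2 * g x - 2 * \<beta> x * k x) * exp (2 * B x) + exp (2 * B x) * (2 * \<beta> x) * k x) (at x)"
      unfolding p_def by (rule DERIV_mult[OF dk]) (auto intro!: derivative_eq_intros B)
    then show ?thesis by (simp add: algebra_simps)
  qed
  fix e :: real assume e: "0 < e"
  \<comment> \<open>The nearby point and the inhomogeneity contribute
    \<open>2 * e' * exp (2 * K)\<close> each, together two thirds of \<open>e\<close>.\<close>
  define e' where "e' = e / (6 * exp (2 * K))"
  have e': "0 < e'" using e by (simp add: e'_def)
  obtain R1 where R1: "\<And>x. R1 \<le> \<bar>x\<bar> \<Longrightarrow> \<bar>h x\<bar> < e'" using h e' unfolding C0_iff by metis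
  obtain R2 where R2: "\<And>x. R2 \<le> \<bar>x\<bar> \<Longrightarrow> \<bar>g x\<bar> < e'" using g e' unfolding C0_iff by metis
  have "\<bar>k x\<bar> < e" if x: "\<bar>R1\<bar> + \<bar>R2\<bar> + 1 \<le> \<bar>x\<bar>" for x
  proof -
    obtain \<xi> where \<xi>: "x < \<xi>" "\<xi> < x + 1" "h (x + 1) - h x = k \<xi>"
      using MVT2[of x "x+1" h k] dh by auto
    obtain \<zeta> where \<zeta>: "x < \<zeta>" "\<zeta> < \<xi>" "p \<xi> - p x = (\<xi> - x) * (2 * g \<zeta> * exp (2 * B \<zeta>))"
      using MVT2[of x \<xi> p "\<lambda>x. 2 * g x * exp (2 * B x)"] dp \<xi>(1) by auto
    have h1: "\<bar>k \<xi>\<bar> < 2 * e'" using R1[of x] R1[of "x + 1"] x \<xi>(3) by (smt (verit))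
    have g1: "\<bar>g \<zeta>\<bar> < e'" using R2[of \<zeta>] x \<zeta> \<xi> by (smt (verit))
    have ex: "exp (2 * B z) \<le> exp (2 * K) * exp (2 * B x)" if "x \<le> z" "z \<le> x + 1" for z
    proof -
      have "K * \<bar>z - x\<bar> \<le> K" using that K_nonneg by (simp add: mult_left_le)
      then have "2 * B z \<le> 2 * K + 2 * B x" using BK[of z x] by linarith
      then show ?thesis by (simp flip: exp_add)
    qed
    have "\<bar>p x\<bar> \<le> \<bar>p \<xi>\<bar> + \<bar>(\<xi> - x) * (2 * g \<zeta> * exp (2 * B \<zeta>))\<bar>" using \<zeta>(3) by linarith
    also have "\<bar>p \<xi>\<bar> \<le> 2 * e' * (exp (2 * K) * exp (2 * B x))"
      unfolding p_def abs_mult using h1 \<xi> e' ex[of \<xi>] by (intro mult_mono) auto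
    also have "\<bar>(\<xi> - x) * (2 * g \<zeta> * exp (2 * B \<zeta>))\<bar> \<le> 1 * (2 * e' * (exp (2 * K) * exp (2 * B x)))"
      unfolding abs_mult using \<xi> \<zeta> g1 e' ex[of \<zeta>] by (intro mult_mono) auto
    finally have "\<bar>k x\<bar> * exp (2 * B x) \<le> (4 * e' * exp (2 * K)) * exp (2 * B x)"
      by (simp add: p_def abs_mult)
    then have "\<bar>k x\<bar> \<le> 4 * e' * exp (2 * K)" by (rule mult_right_le_imp_le) simp
    also have "\<dots> < e" using e by (simp add: e'_def)
    finally show ?thesis .
  qed
  then show "\<exists>R. \<forall>x. R \<le> \<bar>x\<bar> \<longrightarrow> \<bar>k x\<bar> < e" by blast
qed

text \<open>For \<open>\<beta> = 0\<close> the resolvent is \<open>(U + V) / c\<close> with \<open>U' = z - c U\<close> and \<open>V' = c V - z\<close>; the drift is a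
  perturbation which is contracting for large \<open>c\<close>.\<close>

lemma resolvent_equation:
  defines "c \<equiv> 4 * K + 2"
  assumes f: "f \<in> C0"
  obtains h where "h \<in> C0" "ode h (\<lambda>x. c\<^sup>2 / 2 * h x - f x)"
proof -
  \<comment> \<open>\<open>c \<ge> 2\<close> is the condition of
    \<open>decaying_solution_exists\<close>, and \<open>4 * K \<le> c\<close> makes the perturbation
    \<open>z \<mapsto> \<beta> (V z - U z)\<close> contract by
    \<open>2 * K / c \<le> 1/2\<close>.\<close>
  have c: "2 \<le> c" "0 < c" using K_nonneg by (auto simp: c_def)
  define U where "U z = (SOME u. u \<in> C0 \<and> (\<forall>x. (u has_real_derivative z x - c * u x) (at x)))" for z
  \<comment> \<open>\<open>V\<close> solves \<open>V' = c V - z\<close>, obtained by reflecting the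
    line.\<close>
  define V where "V z x = U (\<lambda>x. z (- x)) (- x)" for z x
  have U: "U z \<in> C0" "(U z has_real_derivative z x - c * U z x) (at x)" if "z \<in> C0" for z x
    using someI_ex[OF decaying_solution_exists[OF c(1) that, unfolded Bex_def]] unfolding U_def by blast+
  have V: "V z \<in> C0" "(V z has_real_derivative c * V z x - z x) (at x)" if z: "z \<in> C0" for z x
  proof -
    show "V z \<in> C0" unfolding V_def by (intro C0_reflect U(1) z)
    have "((\<lambda>x. U (\<lambda>x. z (- x)) (- x)) has_real_derivative (z (- (- x)) - c * U (\<lambda>x. z (- x)) (- x)) * (- 1)) (at x)"
      by (rule DERIV_chain2[OF U(2)[OF C0_reflect[OF z]]]) (auto intro!: derivative_eq_intros)
    then show "(V z has_real_derivative c * V z x - z x) (at x)" unfolding V_def by (simp add: algebra_simps)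
  qed
  have Ud: "\<bar>U z x - U z' x\<bar> \<le> d / c" if "z \<in> C0" "z' \<in> C0" "\<And>x. \<bar>z x - z' x\<bar> \<le> d" for z z' d x
    using decaying_solution_dist[OF c(2) U[OF that(1)] U[OF that(2)] that(3)] .
  have Vd: "\<bar>V z x - V z' x\<bar> \<le> d / c" if "z \<in> C0" "z' \<in> C0" "\<And>x. \<bar>z x - z' x\<bar> \<le> d" for z z' d x
    unfolding V_def using that by (intro Ud C0_reflect) auto
  \<comment> \<open>The unknown is the source \<open>z = f + \<beta> h'\<close>, not
    \<open>h\<close>: in terms of \<open>z\<close> the derivative \<open>h' = V z - U z\<close>
    involves no differentiation and is Lipschitz in the supremum norm.\<close>
  define F where "F z x = f x + \<beta> x * (V z x - U z x)" for z x
  have FC: "F z \<in> C0" if "z \<in> C0" for z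
    unfolding F_def by (intro C0_add f C0_bounded_mult[where B=K] C0_diff U V that continuous_drift_UNIV bdd)
  have Fd: "\<bar>F z x - F z' x\<bar> \<le> d / 2" if z: "z \<in> C0" "z' \<in> C0" "\<And>x. \<bar>z x - z' x\<bar> \<le> d" for z z' d x
  proof -
    have d: "0 \<le> d" using z(3)[of 0] by linarith
    have "\<bar>F z x - F z' x\<bar> = \<bar>\<beta> x\<bar> * \<bar>(V z x - V z' x) - (U z x - U z' x)\<bar>"
      unfolding abs_mult[symmetric] by (simp add: F_def algebra_simps)
    also have "\<dots> \<le> K * (2 * d / c)"
      using bdd[of x] Ud[OF z, of x] Vd[OF z, of x] K_nonneg by (intro mult_mono) auto
    also have "\<dots> \<le> d / 2"
    proof -
      have "4 * K * d \<le> c * d" using d by (intro mult_right_mono) (auto simp: c_def)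
      then show ?thesis using c by (simp add: field_simps)
    qed
    finally show ?thesis .
  qed
  have bc: "z \<in> bcontfun" if z: "z \<in> C0" for z
  proof -
    obtain B where "\<And>x. \<bar>z x\<bar> \<le> B" using C0_bounded[OF z] by blast
    then show ?thesis using z by (intro bcontfun_normI[of z B]) (auto simp: C0_def)
  qed
  define S where "S = {z :: real \<Rightarrow>\<^sub>C real. apply_bcontfun z \<in> C0}"
  define FB where "FB = (\<lambda>z :: real \<Rightarrow>\<^sub>C real. Bcontfun (F (apply_bcontfun z)))"
  have FB: "apply_bcontfun (FB z) = F (apply_bcontfun z)" if "z \<in> S" for z
    unfolding FB_def using bc[OF FC] that by (simp add: S_def Bcontfun_inverse)
  have "closed S"
    unfolding closed_sequential_limits
  proof (intro allI impI, elim conjE)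
    fix zs z assume zs: "\<forall>n. zs n \<in> S" "zs \<longlonglongrightarrow> z"
    have "apply_bcontfun z \<in> C0"
      unfolding C0_iff
    proof (intro conjI allI impI)
      show "continuous_on UNIV (apply_bcontfun z)" using apply_bcontfun[of z] by (auto simp: bcontfun_def)
      fix e :: real assume e: "0 < e"
      then obtain n where n: "dist (zs n) z < e / 2"
        using zs(2) unfolding lim_sequentially by (meson half_gt_zero order_refl)
      have "apply_bcontfun (zs n) \<in> C0" using zs(1) by (auto simp: S_def)
      then obtain R where R: "\<And>x. R \<le> \<bar>x\<bar> \<Longrightarrow> \<bar>zs n x\<bar> < e / 2" using e unfolding C0_iff by (metis half_gt_zero)
      have "\<bar>z x\<bar> < e" if "R \<le> \<bar>x\<bar>" for x
        using R[OF that] dist_bounded[of "zs n" x z] n unfolding dist_real_def by linarith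
      then show "\<exists>R. \<forall>x. R \<le> \<bar>x\<bar> \<longrightarrow> \<bar>z x\<bar> < e" by blast
    qed
    then show "z \<in> S" by (simp add: S_def)
  qed
  note complete = iffD2[OF complete_eq_closed this]
  have "Bcontfun f \<in> S" using f bc[OF f] by (simp add: S_def Bcontfun_inverse)
  moreover have "FB ` S \<subseteq> S" using FB FC by (auto simp: S_def)
  moreover have "dist (FB z) (FB z') \<le> 1/2 * dist z z'" if "z \<in> S" "z' \<in> S" for z z'
  proof (rule dist_bound)
    fix x
    have "\<bar>F (apply_bcontfun z) x - F (apply_bcontfun z') x\<bar> \<le> dist z z' / 2"
      using that dist_bounded[of z _ z'] by (intro Fd) (auto simp: S_def dist_real_def)
    then show "dist (FB z x) (FB z' x) \<le> 1/2 * dist z z'"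
      by (simp add: FB that dist_real_def)
  qed
  ultimately have "\<exists>!z\<in>S. FB z = z" by (intro Banach_fix[OF complete, of "1/2"]) auto
  then obtain z' where z': "z' \<in> S" "FB z' = z'" by blast
  define z where "z = apply_bcontfun z'"
  have z: "z \<in> C0" "F z = z" using z' FB[OF z'(1)] by (auto simp: z_def S_def)
  define h where "h = (\<lambda>x. (1 / c) * (U z x + V z x))"
  define k where "k = (\<lambda>x. V z x - U z x)"
  have "h \<in> C0" unfolding h_def by (intro C0_cmult C0_add U V z)
  moreover have "(h has_real_derivative k x) (at x)" for x
  proof -
    have "(h has_real_derivative (1 / c) * ((z x - c * U z x) + (c * V z x - z x))) (at x)"
      unfolding h_def by (intro DERIV_cmult DERIV_add U V z)
    moreover have "(1 / c) * ((z x - c * U z x) + (c * V z x - z x)) = k x"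
      using c by (simp add: k_def field_simps)
    ultimately show ?thesis by simp
  qed
  moreover have "(k has_real_derivative 2 * (c\<^sup>2 / 2 * h x - f x) - 2 * \<beta> x * k x) (at x)" for x
  proof -
    have "(k has_real_derivative (c * V z x - z x) - (z x - c * U z x)) (at x)"
      unfolding k_def by (intro DERIV_diff U V z)
    moreover have "z x = f x + \<beta> x * k x" using fun_cong[OF z(2), of x] by (simp add: F_def k_def)
    moreover have "c\<^sup>2 * h x = c * U z x + c * V z x" using c by (simp add: h_def power2_eq_square field_simps)
    ultimately have "(c * V z x - z x) - (z x - c * U z x) = 2 * (c\<^sup>2 / 2 * h x - f x) - 2 * \<beta> x * k x"
      by (simp add: right_diff_distrib)
    then show ?thesis using \<open>(k has_real_derivative (c * V z x - z x) - (z x - c * U z x)) (at x)\<close> by simp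
  qed
  ultimately show ?thesis using that unfolding ode_def by blast
qed

end

text \<open>With the quadratic modulus of \<open>C0_quadratic_modulus\<close> for the second
  derivative, the remainder is a quartic polynomial in \<open>z - y\<close>, whose mean is
  controlled by moments.\<close>

lemma taylor_second_order:
  fixes h :: "real \<Rightarrow> real"
  assumes h: "\<And>x. (h has_real_derivative k x) (at x)" and k: "\<And>x. (k has_real_derivative m x) (at x)"
    and m: "\<And>x y. \<bar>m x - m y\<bar> \<le> \<eta> + C * (x - y)\<^sup>2" and C: "0 \<le> C"
  shows "\<bar>h z - h y - k y * (z - y) - m y / 2 * (z - y)\<^sup>2\<bar> \<le> (\<eta> + C * (z - y)\<^sup>2) / 2 * (z - y)\<^sup>2"
proof (cases "z = y")
  case False
  define diff where "diff = (\<lambda>n::nat. if n = 0 then h else if n = 1 then k else m)"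
  have "\<forall>n t. n < 2 \<and> min y z \<le> t \<and> t \<le> max y z \<longrightarrow> DERIV (diff n) t :> diff (Suc n) t"
    using h k by (auto simp: diff_def less_2_cases_iff)
  from Taylor[OF _ _ this, of h y z] False obtain t where
    t: "if z < y then z < t \<and> t < y else y < t \<and> t < z"
    "h z = (\<Sum>n<2. (diff n y / fact n) * (z - y)^n) + (diff 2 t / fact 2) * (z - y)^2"
    by (auto simp: diff_def)
  have "h z - h y - k y * (z - y) - m y / 2 * (z - y)\<^sup>2 = (m t - m y) / 2 * (z - y)\<^sup>2"
    unfolding t(2) by (simp add: diff_def eval_nat_numeral field_simps)
  also have "\<bar>\<dots>\<bar> = \<bar>m t - m y\<bar> / 2 * (z - y)\<^sup>2" by (simp add: abs_mult)
  also have "\<dots> \<le> (\<eta> + C * (z - y)\<^sup>2) / 2 * (z - y)\<^sup>2"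
  proof -
    have "(t - y)\<^sup>2 \<le> (z - y)\<^sup>2" using t(1) by (simp add: abs_le_square_iff[symmetric] split: if_splits)
    then have "C * (t - y)\<^sup>2 \<le> C * (z - y)\<^sup>2" using C by (rule mult_left_mono)
    then show ?thesis using m[of t y] by (intro mult_right_mono divide_right_mono) auto
  qed
  finally show ?thesis .
qed simp

text \<open>Averaging against a probability law keeps \<open>d\<close> below its supremum
  \<open>B\<close>, whereas the equation makes the average at a small time \<open>t\<close> nearly
  \<open>(1 + a * t) * d x\<close>. Hence \<open>B * (1 + a * t) \<le> B + t * e\<close> for every
  \<open>e > 0\<close>, which forces \<open>B = 0\<close>.\<close>

lemma generator_dissipative:
  assumes P: "\<And>t x. 0 \<le> t \<Longrightarrow> prob_space (P t x)" and sets: "\<And>t x. sets (P t x) = sets borel"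
    and gen: "(d, \<lambda>x. a * d x) \<in> generator P" and a: "0 < a"
  shows "d x = 0"
proof -
  have d: "d \<in> C0" and lim: "uniform_limit UNIV (\<lambda>t x. ((\<integral>y. d y \<partial>P t x) - d x) / t) (\<lambda>x. a * d x) (at_right 0)"
    using gen by (auto simp: generator_def)
  define B where "B = (SUP x. \<bar>d x\<bar>)"
  obtain C where C: "\<And>x. \<bar>d x\<bar> \<le> C" using C0_bounded[OF d] by blast
  have B: "\<bar>d x\<bar> \<le> B" for x unfolding B_def using C by (intro cSUP_upper bdd_aboveI2) auto
  have "a * B \<le> e" if e: "0 < e" for e
  proof -
    have "\<forall>\<^sub>F t in at_right 0. (\<forall>x\<in>UNIV. dist (((\<integral>y. d y \<partial>P t x) - d x) / t) (a * d x) < e) \<and> 0 < t"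
      using uniform_limitD[OF lim e] eventually_at_right_less[of "0::real"] by (rule eventually_conj)
    then obtain t where t: "\<And>x. \<bar>((\<integral>y. d y \<partial>P t x) - d x) / t - a * d x\<bar> < e" "0 < t"
      using eventually_happens[of _ "at_right (0::real)"] by (auto simp: dist_real_def)
    have "\<bar>d x\<bar> \<le> (B + t * e) / (1 + a * t)" for x
    proof -
      interpret p: prob_space "P t x" using P t(2) by simp
      have dm: "d \<in> borel_measurable (P t x)" using C0_measurable[OF d] by (simp add: sets cong: measurable_cong_sets)
      have int: "integrable (P t x) d" using B dm by (intro p.integrable_const_bound[where B=B]) auto
      have "\<bar>\<integral>y. d y \<partial>P t x\<bar> \<le> (\<integral>y. B \<partial>P t x)"
        using B by (intro order_trans[OF integral_abs_bound] integral_mono integrable_abs int) auto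
      then have 1: "\<bar>\<integral>y. d y \<partial>P t x\<bar> \<le> B" by (simp add: p.prob_space)
      have "\<bar>(((\<integral>y. d y \<partial>P t x) - d x) / t - a * d x) * t\<bar> \<le> e * t"
        unfolding abs_mult using t e by (intro mult_mono) (auto intro: less_imp_le)
      moreover have "(((\<integral>y. d y \<partial>P t x) - d x) / t - a * d x) * t = (\<integral>y. d y \<partial>P t x) - d x * (1 + a * t)"
        using t(2) by (simp add: field_simps)
      ultimately have "\<bar>d x * (1 + a * t)\<bar> \<le> B + t * e" using 1 by (simp only: mult.commute[of t e])
      then have "\<bar>d x\<bar> * (1 + a * t) \<le> B + t * e" using t(2) a by (simp add: abs_mult)
      then show ?thesis using t(2) a by (simp add: pos_le_divide_eq add_pos_pos)
    qed
    then have "B \<le> (B + t * e) / (1 + a * t)" unfolding B_def by (intro cSUP_least) auto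
    then have "B * (1 + a * t) \<le> B + t * e" using t(2) a by (simp add: pos_le_divide_eq add_pos_pos)
    then have "(a * B) * t \<le> e * t" by (simp add: algebra_simps)
    then show ?thesis using t(2) by simp
  qed
  then have "a * B \<le> 0" by (rule field_le_epsilon[of _ 0, simplified])
  then have "B \<le> 0" using a by (simp add: mult_le_0_iff)
  then show ?thesis using B[of x] by simp
qed


section \<open>Expansion of the semigroup for small times\<close>

context diffusion
begin

definition running_max :: "real \<Rightarrow> 'a \<Rightarrow> real" where
  "running_max t \<omega> = (SUP s\<in>{0..t}. \<bar>W s \<omega>\<bar>)"

lemma running_max_upper:
  assumes \<omega>: "\<omega> \<in> space M" and s: "0 \<le> s" "s \<le> t"
  shows "\<bar>W s \<omega>\<bar> \<le> running_max t \<omega>"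
proof -
  obtain C where "\<And>r. 0 \<le> r \<Longrightarrow> r \<le> t \<Longrightarrow> \<bar>W r \<omega>\<bar> \<le> C"
    using continuous_on_Icc_abs_bounded[OF continuous_on_subset[OF W_continuous[OF \<omega>], of "{0..t}"]] by auto
  then show ?thesis
    unfolding running_max_def using s by (intro cSUP_upper bdd_aboveI2[of _ _ C]) auto
qed

lemma running_max_least:
  assumes "0 \<le> t" "\<And>s. 0 \<le> s \<Longrightarrow> s \<le> t \<Longrightarrow> \<bar>W s \<omega>\<bar> \<le> C"
  shows "running_max t \<omega> \<le> C"
  unfolding running_max_def using assms by (intro cSUP_least) auto

lemma running_max_measurable:
  assumes t: "0 < t" shows "running_max t \<in> borel_measurable M"
proof (rule borel_measurable_path_dominated[where T=t and C=1 and F="shift 0 t"])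
  show "shift 0 t \<in> measurable M (path_borel t)" using shift_measurable[OF order_refl t] .
  fix \<omega> \<omega>' e assume \<omega>: "\<omega> \<in> space M" "\<omega>' \<in> space M"
    and e: "\<And>s. 0 \<le> s \<Longrightarrow> s \<le> t \<Longrightarrow> \<bar>shift 0 t \<omega> s - shift 0 t \<omega>' s\<bar> \<le> e"
  have d: "\<bar>W s \<omega> - W s \<omega>'\<bar> \<le> e" if "0 \<le> s" "s \<le> t" for s
    using e[OF that] that \<omega> by (simp add: shift_def W_0)
  have "running_max t \<omega> \<le> running_max t \<omega>' + e"
  proof (rule running_max_least)
    fix s assume s: "0 \<le> s" "s \<le> t"
    show "\<bar>W s \<omega>\<bar> \<le> running_max t \<omega>' + e" using d[OF s] running_max_upper[OF \<omega>(2) s] by linarith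
  qed (use t in simp)
  moreover have "running_max t \<omega>' \<le> running_max t \<omega> + e"
  proof (rule running_max_least)
    fix s assume s: "0 \<le> s" "s \<le> t"
    show "\<bar>W s \<omega>'\<bar> \<le> running_max t \<omega> + e" using d[OF s] running_max_upper[OF \<omega>(1) s] by linarith
  qed (use t in simp)
  ultimately show "\<bar>running_max t \<omega> - running_max t \<omega>'\<bar> \<le> 1 * e" by linarith
qed (use t in auto)

text \<open>A bound for \<open>\<bar>\<beta> (Y y s) - \<beta> y\<bar>\<close> on
  \<open>s \<le> t\<close> that is uniform in \<open>y\<close>. The second argument of
  \<open>min\<close> tends to 0 with \<open>t\<close> along each path; the first supplies the
  dominating constant, so that no maximal inequality for the integrability of
  \<open>running_max\<close> has to be invoked.\<close>

definition osc :: "real \<Rightarrow> 'a \<Rightarrow> real" where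
  "osc t \<omega> = min (2 * K) (L * (K * t + running_max t \<omega>))"

lemma osc_measurable: "0 < t \<Longrightarrow> osc t \<in> borel_measurable M"
  unfolding osc_def[abs_def] using running_max_measurable[of t] by measurable

lemma osc_bounds:
  assumes "\<omega> \<in> space M" "0 \<le> t" shows "0 \<le> osc t \<omega>" "osc t \<omega> \<le> 2 * K"
proof -
  have "0 \<le> running_max t \<omega>" using running_max_upper[OF assms(1), of 0 t] assms(2) by linarith
  then have "0 \<le> L * (K * t + running_max t \<omega>)" using L K_nonneg assms(2) by simp
  then show "0 \<le> osc t \<omega>" "osc t \<omega> \<le> 2 * K" using K_nonneg by (auto simp: osc_def)
qed

lemma osc_integrable: "0 < t \<Longrightarrow> integrable M (osc t)"
  using osc_bounds osc_measurable[of t]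
  by (intro integrable_const_bound[where B="2 * K"]) (auto intro!: AE_I2)

lemma expectation_osc_tendsto: "((\<lambda>t. expectation (osc t)) \<longlongrightarrow> 0) (at_right 0)"
proof (rule tendsto_at_right_sequentially[of 0 1])
  fix S :: "nat \<Rightarrow> real" assume S: "\<And>n. 0 < S n" "S \<longlonglongrightarrow> 0"
  have "(\<lambda>n. expectation (osc (S n))) \<longlonglongrightarrow> expectation (\<lambda>\<omega>. 0)"
  proof (rule integral_dominated_convergence[where w="\<lambda>_. 2 * K"])
    show "AE \<omega> in M. (\<lambda>n. osc (S n) \<omega>) \<longlonglongrightarrow> 0"
    proof (rule AE_I2)
      fix \<omega> assume \<omega>: "\<omega> \<in> space M"
      show "(\<lambda>n. osc (S n) \<omega>) \<longlonglongrightarrow> 0"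
      proof (rule LIMSEQ_I)
        fix e :: real assume e: "0 < e"
        define e' where "e' = e / (2 * L)"
        have e': "0 < e'" using e L by (simp add: e'_def)
        obtain d where d0: "0 < d" "\<forall>s\<in>{0..}. dist s 0 < d \<longrightarrow> dist (W s \<omega>) (W 0 \<omega>) < e' / 2"
          using W_continuous[OF \<omega>] half_gt_zero[OF e'] unfolding continuous_on_iff
          by (meson atLeast_iff order_refl)
        have d: "0 < d" "\<And>s. 0 \<le> s \<Longrightarrow> s < d \<Longrightarrow> \<bar>W s \<omega>\<bar> < e' / 2"
          using d0 W_0[OF \<omega>] by (auto simp: dist_real_def)
        have "0 < min d (e' / (4 * (K + 1)))" using d e' K_nonneg by simp
        from order_tendstoD(2)[OF S(2) this]
        obtain n0 where n0: "\<And>n. n \<ge> n0 \<Longrightarrow> S n < min d (e' / (4 * (K + 1)))"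
          unfolding eventually_sequentially by blast
        have "norm (osc (S n) \<omega> - 0) < e" if "n \<ge> n0" for n
        proof -
          have "running_max (S n) \<omega> \<le> e' / 2"
            using d(2) n0[OF that] S(1)[of n] by (intro running_max_least) (auto intro: less_imp_le)
          moreover have "K * S n \<le> e' / 4"
          proof -
            have "K * S n \<le> (K + 1) * (e' / (4 * (K + 1)))"
              using n0[OF that] S(1)[of n] K_nonneg by (intro mult_mono) auto
            also have "\<dots> = e' / 4" using K_nonneg by (simp add: field_simps)
            finally show ?thesis .
          qed
          ultimately have "K * S n + running_max (S n) \<omega> \<le> e'" using e' by linarith
          then have "L * (K * S n + running_max (S n) \<omega>) \<le> L * e'" using L by (intro mult_left_mono) auto
          then have "osc (S n) \<omega> \<le> e / 2" using L by (auto simp: osc_def e'_def)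
          then show ?thesis using osc_bounds[OF \<omega>, of "S n"] S(1)[of n] e by auto
        qed
        then show "\<exists>n0. \<forall>n\<ge>n0. norm (osc (S n) \<omega> - 0) < e" by blast
      qed
    qed
    show "AE \<omega> in M. norm (osc (S n) \<omega>) \<le> 2 * K" for n
      using osc_bounds[of _ "S n"] S(1)[of n] by (auto intro!: AE_I2)
  qed (use osc_measurable S in auto)
  then show "(\<lambda>n. expectation (osc (S n))) \<longlonglongrightarrow> 0" by simp
qed simp

lemma drift_integral:
  assumes \<omega>: "\<omega> \<in> space M" and t: "0 \<le> t"
  shows "\<bar>Y y t \<omega> - y - W t \<omega>\<bar> \<le> K * t" "\<bar>Y y t \<omega> - y - W t \<omega> - t * \<beta> y\<bar> \<le> t * osc t \<omega>"
proof -
  have eq: "Y y t \<omega> = y + W t \<omega> + integral {0..t} (\<lambda>s. \<beta> (Y y s \<omega>))"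
    unfolding Y_def using sol_props(2)[OF noise_continuous[OF \<omega>] t] .
  show "\<bar>Y y t \<omega> - y - W t \<omega>\<bar> \<le> K * t"
    using sol_minus_noise[OF noise_continuous[OF \<omega>] t, of y] by (simp add: Y_def diff_diff_eq)
  have c: "continuous_on {0..t} (\<lambda>s. \<beta> (Y y s \<omega>))"
    by (intro continuous_intros continuous_on_subset[OF Y_continuous[OF \<omega>]]) auto
  have "integral {0..t} (\<lambda>s. \<beta> (Y y s \<omega>) - \<beta> y) = integral {0..t} (\<lambda>s. \<beta> (Y y s \<omega>)) - t * \<beta> y"
    using integral_diff[OF integrable_continuous_real[OF c] integrable_continuous_real[OF continuous_on_const]] t by simp
  then have "\<bar>Y y t \<omega> - y - W t \<omega> - t * \<beta> y\<bar> = \<bar>integral {0..t} (\<lambda>s. \<beta> (Y y s \<omega>) - \<beta> y)\<bar>"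
    using eq by simp
  also have "\<dots> \<le> osc t \<omega> * (t - 0)"
  proof (rule abs_integral_bound[OF _ _ t])
    show "continuous_on {0..t} (\<lambda>s. \<beta> (Y y s \<omega>) - \<beta> y)" by (intro continuous_on_diff c continuous_on_const)
    fix s assume s: "s \<in> {0..t}"
    have "\<bar>\<beta> (Y y s \<omega>) - \<beta> y\<bar> \<le> L * \<bar>Y y s \<omega> - y\<bar>" by (rule Lip)
    also have "\<bar>Y y s \<omega> - y\<bar> \<le> K * t + running_max t \<omega>"
      using Y_bound[OF \<omega>, of s y] running_max_upper[OF \<omega>, of s t] s mult_left_mono[of s t K] K_nonneg by fastforce
    finally have "\<bar>\<beta> (Y y s \<omega>) - \<beta> y\<bar> \<le> L * (K * t + running_max t \<omega>)" using L by simp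
    moreover have "\<bar>\<beta> (Y y s \<omega>) - \<beta> y\<bar> \<le> 2 * K" using bdd[of "Y y s \<omega>"] bdd[of y] by linarith
    ultimately show "\<bar>\<beta> (Y y s \<omega>) - \<beta> y\<bar> \<le> osc t \<omega>" by (simp add: osc_def)
  qed
  finally show "\<bar>Y y t \<omega> - y - W t \<omega> - t * \<beta> y\<bar> \<le> t * osc t \<omega>" by (simp add: mult.commute)
qed

text \<open>The subtracted terms with \<open>W t\<close> and \<open>(W t)\<^sup>2 - t\<close> have
  mean zero. The right-hand side does not depend on \<open>y\<close>, and its mean is
  \<open>t\<close> times a quantity that becomes as small as desired once \<eta> and then
  \<open>t\<close> are small.\<close>

lemma expansion_bound:
  assumes \<omega>: "\<omega> \<in> space M" and t: "0 \<le> t" and \<eta>: "0 < \<eta>" and C: "0 \<le> C"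
    and h: "\<And>x. (h has_real_derivative k x) (at x)" and k: "\<And>x. (k has_real_derivative m x) (at x)"
    and m: "\<And>x y. \<bar>m x - m y\<bar> \<le> \<eta> + C * (x - y)\<^sup>2"
    and Ck: "\<And>x. \<bar>k x\<bar> \<le> Ck" and Cm: "\<And>x. \<bar>m x\<bar> \<le> Cm"
  shows "\<bar>h (Y y t \<omega>) - h y - t * (m y / 2 + \<beta> y * k y) - k y * W t \<omega> - m y / 2 * ((W t \<omega>)\<^sup>2 - t)\<bar>
    \<le> Ck * (t * osc t \<omega>) + Cm / 2 * (\<eta> * (W t \<omega>)\<^sup>2 + K\<^sup>2 * t\<^sup>2 / \<eta> + K\<^sup>2 * t\<^sup>2)
      + \<eta> / 2 * (2 * K\<^sup>2 * t\<^sup>2 + 2 * (W t \<omega>)\<^sup>2) + C / 2 * (8 * K^4 * t^4 + 8 * (W t \<omega>)^4)"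
proof -
  define w where "w = W t \<omega>"
  define D where "D = Y y t \<omega> - y - w"
  define \<Delta> where "\<Delta> = D + w"
  have \<Delta>: "Y y t \<omega> - y = \<Delta>" by (simp add: \<Delta>_def D_def)
  have D1: "\<bar>D\<bar> \<le> K * t" and D2: "\<bar>D - t * \<beta> y\<bar> \<le> t * osc t \<omega>"
    using drift_integral[OF \<omega> t, of y] by (auto simp: D_def w_def)
  have DD: "D\<^sup>2 \<le> K\<^sup>2 * t\<^sup>2"
    using D1 K_nonneg t abs_le_square_iff[of D "K * t"] by (simp add: power_mult_distrib)
  have \<Delta>2: "\<Delta>\<^sup>2 \<le> 2 * K\<^sup>2 * t\<^sup>2 + 2 * w\<^sup>2"
    using zero_le_power2[of "D - w"] DD unfolding \<Delta>_def power2_sum power2_diff by linarith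
  have \<Delta>4: "\<Delta>\<^sup>2 * \<Delta>\<^sup>2 \<le> 8 * K^4 * t^4 + 8 * w^4"
  proof -
    have "\<Delta>\<^sup>2 * \<Delta>\<^sup>2 \<le> (2 * K\<^sup>2 * t\<^sup>2 + 2 * w\<^sup>2) * (2 * K\<^sup>2 * t\<^sup>2 + 2 * w\<^sup>2)"
      using \<Delta>2 by (intro mult_mono) auto
    also have "\<dots> \<le> 2 * (2 * K\<^sup>2 * t\<^sup>2)\<^sup>2 + 2 * (2 * w\<^sup>2)\<^sup>2"
      using zero_le_power2[of "2 * K\<^sup>2 * t\<^sup>2 - 2 * w\<^sup>2"] by (simp add: power2_eq_square algebra_simps)
    also have "\<dots> = 8 * K^4 * t^4 + 8 * w^4" by (simp add: eval_nat_numeral)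
    finally show ?thesis .
  qed
  \<comment> \<open>Young's inequality with weight \<eta>: in the mean the first term is
    \<open>\<eta> * t\<close> and the second is of order \<open>t\<^sup>2\<close> for fixed \<eta>,
    so both are admissible after division by \<open>t\<close>.\<close>
  have Dw: "2 * \<bar>D * w\<bar> \<le> \<eta> * w\<^sup>2 + K\<^sup>2 * t\<^sup>2 / \<eta>"
  proof -
    have "0 \<le> (\<eta> * \<bar>w\<bar> - \<bar>D\<bar>)\<^sup>2" by simp
    then have "2 * (\<eta> * \<bar>D * w\<bar>) \<le> \<eta>\<^sup>2 * w\<^sup>2 + D\<^sup>2"
      by (simp add: power2_diff power_mult_distrib abs_mult mult_ac)
    also have "\<dots> \<le> \<eta>\<^sup>2 * w\<^sup>2 + K\<^sup>2 * t\<^sup>2" using DD by simp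
    finally have "\<eta> * (2 * \<bar>D * w\<bar>) \<le> \<eta> * (\<eta> * w\<^sup>2 + K\<^sup>2 * t\<^sup>2 / \<eta>)"
      using \<eta> by (simp add: distrib_left power2_eq_square mult_ac)
    then show ?thesis using \<eta> by simp
  qed
  have T: "\<bar>h (Y y t \<omega>) - h y - k y * \<Delta> - m y / 2 * \<Delta>\<^sup>2\<bar> \<le> (\<eta> + C * \<Delta>\<^sup>2) / 2 * \<Delta>\<^sup>2"
    using taylor_second_order[OF h k m C, of "Y y t \<omega>" y] unfolding \<Delta> .
  also have "\<dots> = \<eta> / 2 * \<Delta>\<^sup>2 + C / 2 * (\<Delta>\<^sup>2 * \<Delta>\<^sup>2)" by (simp add: field_simps)
  also have "\<dots> \<le> \<eta> / 2 * (2 * K\<^sup>2 * t\<^sup>2 + 2 * w\<^sup>2) + C / 2 * (8 * K^4 * t^4 + 8 * w^4)"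
    using \<Delta>2 \<Delta>4 \<eta> C by (intro add_mono mult_left_mono) auto
  finally have R: "\<bar>h (Y y t \<omega>) - h y - k y * \<Delta> - m y / 2 * \<Delta>\<^sup>2\<bar> \<le> \<dots>" .
  have A: "\<bar>k y * (D - t * \<beta> y)\<bar> \<le> Ck * (t * osc t \<omega>)"
    unfolding abs_mult using D2 Ck[of y] by (intro mult_mono) auto
  have "\<bar>2 * (D * w) + D\<^sup>2\<bar> \<le> \<eta> * w\<^sup>2 + K\<^sup>2 * t\<^sup>2 / \<eta> + K\<^sup>2 * t\<^sup>2"
    using Dw DD zero_le_power2[of D] by linarith
  then have Bm: "\<bar>m y / 2 * (2 * (D * w) + D\<^sup>2)\<bar> \<le> Cm / 2 * (\<eta> * w\<^sup>2 + K\<^sup>2 * t\<^sup>2 / \<eta> + K\<^sup>2 * t\<^sup>2)"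
    unfolding abs_mult using Cm[of y] by (intro mult_mono) auto
  have "h (Y y t \<omega>) - h y - t * (m y / 2 + \<beta> y * k y) - k y * w - m y / 2 * (w\<^sup>2 - t)
    = (h (Y y t \<omega>) - h y - k y * \<Delta> - m y / 2 * \<Delta>\<^sup>2) + k y * (D - t * \<beta> y) + m y / 2 * (2 * (D * w) + D\<^sup>2)"
    by (simp add: \<Delta>_def power2_sum algebra_simps)
  then show ?thesis using R A Bm unfolding w_def[symmetric] by linarith
qed

lemma ode_generator:
  assumes h: "h \<in> C0" and g: "g \<in> C0" and ode: "ode h g" and e: "0 < e"
  shows "\<forall>\<^sub>F t in at_right 0. \<forall>y. \<bar>(expectation (\<lambda>\<omega>. h (Y y t \<omega>)) - h y) / t - g y\<bar> < e"
proof -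
  obtain k where dh: "\<And>x. (h has_real_derivative k x) (at x)"
    and dk: "\<And>x. (k has_real_derivative 2 * g x - 2 * \<beta> x * k x) (at x)"
    using ode unfolding ode_def by blast
  have kC: "k \<in> C0" by (rule ode_deriv_C0[OF h g dh dk])
  define m where "m = (\<lambda>x. 2 * g x - 2 * (\<beta> x * k x))"
  have mC: "m \<in> C0" unfolding m_def
    by (intro C0_diff C0_cmult g C0_bounded_mult[where B=K] kC continuous_drift_UNIV bdd)
  have dk: "(k has_real_derivative m x) (at x)" for x using dk[of x] by (simp add: m_def mult.assoc)
  have gm: "g y = m y / 2 + \<beta> y * k y" for y by (simp add: m_def diff_divide_distrib)
  obtain Ck where Ck: "0 \<le> Ck" "\<And>x. \<bar>k x\<bar> \<le> Ck" using C0_bounded[OF kC] by blast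
  obtain Cm where Cm: "0 \<le> Cm" "\<And>x. \<bar>m x\<bar> \<le> Cm" using C0_bounded[OF mC] by blast
  \<comment> \<open>As \<open>t\<close> tends to 0 the error bound \<open>b\<close> tends to
    \<open>(Cm + 2) * \<eta> / 2\<close>, which this choice makes equal to
    \<open>e / 2\<close>.\<close>
  define \<eta> where "\<eta> = e / (Cm + 2)"
  have \<eta>: "0 < \<eta>" using e Cm by (simp add: \<eta>_def)
  obtain C where C: "0 \<le> C" "\<And>x y. \<bar>m x - m y\<bar> \<le> \<eta> + C * (x - y)\<^sup>2"
    using C0_quadratic_modulus[OF mC \<eta>] by blast
  \<comment> \<open>\<open>b t\<close> is the mean of the right-hand side of
    \<open>expansion_bound\<close>, divided by \<open>t\<close>.\<close>
  define b where "b t = Ck * expectation (osc t) + Cm / 2 * (\<eta> + K\<^sup>2 * t / \<eta> + K\<^sup>2 * t)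
      + \<eta> / 2 * (2 * K\<^sup>2 * t + 2) + C / 2 * (8 * K^4 * t^3 + 24 * t)" for t
  have "(b \<longlongrightarrow> Ck * 0 + Cm / 2 * (\<eta> + K\<^sup>2 * 0 / \<eta> + K\<^sup>2 * 0)
      + \<eta> / 2 * (2 * K\<^sup>2 * 0 + 2) + C / 2 * (8 * K^4 * 0^3 + 24 * 0)) (at_right 0)"
    unfolding b_def[abs_def] using \<eta> by (intro tendsto_intros expectation_osc_tendsto) auto
  moreover have "Ck * 0 + Cm / 2 * (\<eta> + K\<^sup>2 * 0 / \<eta> + K\<^sup>2 * 0)
      + \<eta> / 2 * (2 * K\<^sup>2 * 0 + 2) + C / 2 * (8 * K^4 * 0^3 + 24 * 0) < e"
  proof -
    have "Ck * 0 + Cm / 2 * (\<eta> + K\<^sup>2 * 0 / \<eta> + K\<^sup>2 * 0)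
      + \<eta> / 2 * (2 * K\<^sup>2 * 0 + 2) + C / 2 * (8 * K^4 * 0^3 + 24 * 0) = (Cm + 2) * \<eta> / 2" by (simp add: field_simps)
    also have "\<dots> = e / 2" using Cm by (simp add: \<eta>_def)
    finally show ?thesis using e by simp
  qed
  ultimately have "\<forall>\<^sub>F t in at_right 0. b t < e" by (rule order_tendstoD(2))
  with eventually_at_right_less[of 0] show ?thesis
  proof eventually_elim
    case (elim t)
    then have t: "0 < t" "0 \<le> t" by auto
    show ?case
    proof
      fix y
      let ?A = "\<lambda>\<omega>. h (Y y t \<omega>) - h y - t * (m y / 2 + \<beta> y * k y) - k y * W t \<omega> - m y / 2 * ((W t \<omega>)\<^sup>2 - t)"
      let ?B = "\<lambda>\<omega>. Ck * (t * osc t \<omega>) + Cm / 2 * (\<eta> * (W t \<omega>)\<^sup>2 + K\<^sup>2 * t\<^sup>2 / \<eta> + K\<^sup>2 * t\<^sup>2)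
        + \<eta> / 2 * (2 * K\<^sup>2 * t\<^sup>2 + 2 * (W t \<omega>)\<^sup>2) + C / 2 * (8 * K^4 * t^4 + 8 * (W t \<omega>)^4)"
      have i1: "integrable M (W t)" "integrable M (\<lambda>\<omega>. (W t \<omega>)\<^sup>2)" "integrable M (\<lambda>\<omega>. (W t \<omega>)^4)"
        using moments(1)[OF t(1), of 1] moments(1)[OF t(1), of 2] moments(1)[OF t(1), of 4] by simp_all
      have i2: "integrable M (\<lambda>\<omega>. h (Y y t \<omega>))" by (rule integrable_C0_Y[OF h t(2)])
      have iA: "integrable M ?A" using i1 i2 by (intro Bochner_Integration.integrable_diff integrable_mult_right) auto
      have iB: "integrable M ?B" using i1 osc_integrable[OF t(1)]
        by (intro Bochner_Integration.integrable_add integrable_mult_right) auto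
      have "expectation ?A = expectation (\<lambda>\<omega>. h (Y y t \<omega>)) - h y - t * g y"
        using i1 i2 moments[OF t(1)] prob_space by (simp add: gm)
      moreover have "\<bar>expectation ?A\<bar> \<le> expectation ?B"
        by (intro order_trans[OF integral_abs_bound] integral_mono integrable_abs iA iB
            expansion_bound t \<eta> C dh dk Ck Cm)
      moreover have "expectation ?B = t * b t"
      proof -
        have "expectation ?B = Ck * (t * expectation (osc t)) + Cm / 2 * (\<eta> * t + K\<^sup>2 * t\<^sup>2 / \<eta> + K\<^sup>2 * t\<^sup>2)
          + \<eta> / 2 * (2 * K\<^sup>2 * t\<^sup>2 + 2 * t) + C / 2 * (8 * K^4 * t^4 + 8 * (3 * t\<^sup>2))"
          using i1 osc_integrable[OF t(1)] moments[OF t(1)] prob_space by simp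
        also have "\<dots> = t * b t"
          by (simp add: b_def power2_eq_square power3_eq_cube power4_eq_xxxx field_simps)
        finally show ?thesis .
      qed
      ultimately have "\<bar>expectation (\<lambda>\<omega>. h (Y y t \<omega>)) - h y - t * g y\<bar> \<le> t * b t"
        by (simp only:)
      moreover have "t * b t < t * e" using elim t(1) by (intro mult_strict_left_mono)
      ultimately have "\<bar>expectation (\<lambda>\<omega>. h (Y y t \<omega>)) - h y - t * g y\<bar> < t * e" by linarith
      moreover have "expectation (\<lambda>\<omega>. h (Y y t \<omega>)) - h y - t * g y
          = t * ((expectation (\<lambda>\<omega>. h (Y y t \<omega>)) - h y) / t - g y)"
        using t by (simp add: field_simps)
      ultimately have "t * \<bar>(expectation (\<lambda>\<omega>. h (Y y t \<omega>)) - h y) / t - g y\<bar> < t * e"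
        using t by (simp add: abs_mult)
      then show "\<bar>(expectation (\<lambda>\<omega>. h (Y y t \<omega>)) - h y) / t - g y\<bar> < e" using t by simp
    qed
  qed
qed

lemma ode_in_generator:
  assumes f: "f \<in> C0" and g: "g \<in> C0" and ode: "ode (\<lambda>y. f (Laminv y)) (\<lambda>y. g (Laminv y))"
  shows "(f, g) \<in> generator P"
  unfolding generator_def
proof (intro CollectI case_prodI conjI f g uniform_limitI)
  fix e :: real assume "0 < e"
  from ode_generator[OF C0_comp_Laminv[OF f] C0_comp_Laminv[OF g] ode this] eventually_at_right_less[of 0]
  show "\<forall>\<^sub>F t in at_right 0. \<forall>x\<in>UNIV. dist (((\<integral>y. f y \<partial>P t x) - f x) / t) (g x) < e"
  proof eventually_elim
    case (elim t)
    show ?case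
    proof
      fix x
      have "(\<integral>y. f y \<partial>P t x) = expectation (\<lambda>\<omega>. f (Laminv (Y (Lam x) t \<omega>)))"
        using elim by (intro integral_P f) simp
      then show "dist (((\<integral>y. f y \<partial>P t x) - f x) / t) (g x) < e"
        using elim(1)[rule_format, of "Lam x"] by (simp add: dist_real_def inv)
    qed
  qed
qed

lemma generator_diff:
  assumes "(f, g) \<in> generator P" "(f', g') \<in> generator P"
  shows "(\<lambda>x. f x - f' x, \<lambda>x. g x - g' x) \<in> generator P"
proof -
  have f: "f \<in> C0" "f' \<in> C0" using assms by (auto simp: generator_def)
  have "uniform_limit UNIV (\<lambda>t x. ((\<integral>y. f y \<partial>P t x) - f x) / t - ((\<integral>y. f' y \<partial>P t x) - f' x) / t) (\<lambda>x. g x - g' x) (at_right 0)"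
    using assms by (intro uniform_limit_minus) (auto simp: generator_def)
  moreover have "\<forall>\<^sub>F t in at_right 0. \<forall>x\<in>UNIV. ((\<integral>y. f y \<partial>P t x) - f x) / t - ((\<integral>y. f' y \<partial>P t x) - f' x) / t
      = ((\<integral>y. f y - f' y \<partial>P t x) - (f x - f' x)) / t"
    using eventually_at_right_less[of 0]
  proof eventually_elim
    case (elim t)
    show ?case
    proof
      fix x
      have i: "integrable (P t x) h" if "h \<in> C0" for h
        unfolding P_def using elim integrable_C0_Y[OF C0_comp_Laminv[OF that], of t "Lam x"] flow_measurable[of t x] C0_measurable[OF that]
        by (subst integrable_distr_eq) (auto simp: flow_def)
      show "((\<integral>y. f y \<partial>P t x) - f x) / t - ((\<integral>y. f' y \<partial>P t x) - f' x) / t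
        = ((\<integral>y. f y - f' y \<partial>P t x) - (f x - f' x)) / t"
        using i[OF f(1)] i[OF f(2)] by (simp add: diff_divide_distrib)
    qed
  qed
  ultimately have "uniform_limit UNIV (\<lambda>t x. ((\<integral>y. f y - f' y \<partial>P t x) - (f x - f' x)) / t) (\<lambda>x. g x - g' x) (at_right 0)"
    by (subst (asm) uniform_limit_cong[where i="\<lambda>x. g x - g' x"]) auto
  then show ?thesis using assms by (auto simp: generator_def intro!: C0_diff)
qed

lemma generator_eq:
  "generator P = {(f, g). f \<in> C0 \<and> g \<in> C0 \<and> ode (\<lambda>y. f (Laminv y)) (\<lambda>y. g (Laminv y))}"
proof (intro set_eqI iffI; clarify)
  fix f g assume fg: "(f, g) \<in> generator P"
  then have f: "f \<in> C0" and g: "g \<in> C0" by (auto simp: generator_def)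
  define a where "a = (4 * K + 2)\<^sup>2 / 2"
  have a: "0 < a" using K_nonneg by (simp add: a_def)
  \<comment> \<open>If \<open>(f, g)\<close> is in the generator, \<open>F\<close> is
    \<open>a f - g\<close> in the variable \<open>y\<close>. The solution \<open>f'\<close> of the
    same resolvent equation within Feller's domain differs from \<open>f\<close> by an eigenfunction
    for \<open>a > 0\<close>, which has to vanish.\<close>
  define F where "F = (\<lambda>y. a * f (Laminv y) - g (Laminv y))"
  have "F \<in> C0" unfolding F_def by (intro C0_diff C0_cmult C0_comp_Laminv f g)
  then obtain h where h: "h \<in> C0" "ode h (\<lambda>y. a * h y - F y)"
    using resolvent_equation unfolding a_def by blast
  define f' where "f' = (\<lambda>x. h (Lam x))"
  define g' where "g' = (\<lambda>x. a * f' x - (a * f x - g x))"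
  have f': "f' \<in> C0" unfolding f'_def by (rule C0_comp_Lam[OF h(1)])
  have g': "g' \<in> C0" unfolding g'_def by (intro C0_diff C0_cmult f f' g)
  have "ode (\<lambda>y. f' (Laminv y)) (\<lambda>y. g' (Laminv y))"
    using h(2) by (simp add: f'_def g'_def F_def inv)
  then have gen': "(f', g') \<in> generator P" by (rule ode_in_generator[OF f' g'])
  have "(\<lambda>x. g x - g' x) = (\<lambda>x. a * (f x - f' x))" by (auto simp: g'_def algebra_simps)
  with generator_diff[OF fg gen'] have "(\<lambda>x. f x - f' x, \<lambda>x. a * (f x - f' x)) \<in> generator P" by simp
  from generator_dissipative[OF prob_space_P sets_P this a] have "f x = f' x" for x by simp
  then have "f = f'" by auto
  then have "g = g'" by (auto simp: g'_def)
  show "f \<in> C0 \<and> g \<in> C0 \<and> ode (\<lambda>y. f (Laminv y)) (\<lambda>y. g (Laminv y))"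
    using f g \<open>ode (\<lambda>y. f' (Laminv y)) (\<lambda>y. g' (Laminv y))\<close> \<open>f = f'\<close> \<open>g = g'\<close> by simp
qed (rule ode_in_generator)

end


section \<open>The limiting coefficient and Feller's operator\<close>

definition primitive :: "(real \<Rightarrow> real) \<Rightarrow> real \<Rightarrow> real" where
  "primitive l q = (LBINT x=0..ereal q. l x)"

lemma interval_integral_diff:
  fixes F :: "real \<Rightarrow> real"
  assumes F: "\<And>a b. set_integrable lborel {a..b} F" and ab: "a \<le> b"
  shows "(LBINT x=0..ereal b. F x) - (LBINT x=0..ereal a. F x) = (LBINT x:{a..b}. F x)"
proof -
  have int: "interval_lebesgue_integrable lborel (ereal c) (ereal d) F" if "c \<le> d" for c d
    unfolding interval_lebesgue_integrable_def using that
    by (auto intro!: set_integrable_subset[OF F[of c d]] simp: einterval_def)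
  have "(LBINT x=ereal 0..ereal a. F x) + (LBINT x=ereal a..ereal b. F x) = (LBINT x=ereal 0..ereal b. F x)"
  proof (rule interval_integral_sum)
    have "min (ereal 0) (min (ereal a) (ereal b)) = ereal (min 0 (min a b))" "max (ereal 0) (max (ereal a) (ereal b)) = ereal (max 0 (max a b))"
      by (simp_all add: ereal_min ereal_max flip: zero_ereal_def)
    then show "interval_lebesgue_integrable lborel (min (ereal 0) (min (ereal a) (ereal b))) (max (ereal 0) (max (ereal a) (ereal b))) F"
      using int[of "min 0 (min a b)" "max 0 (max a b)"] by simp
  qed
  then show ?thesis using interval_integral_Icc[OF ab, of F] by (simp add: zero_ereal_def)
qed

lemma set_integrable_mult_continuous:
  fixes l G :: "real \<Rightarrow> real"
  assumes l: "set_integrable lborel {a..b} l" and G: "continuous_on {a..b} G"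
  shows "set_integrable lborel {a..b} (\<lambda>x. l x * G x)"
proof -
  obtain C where C: "0 \<le> C" "\<And>x. a \<le> x \<Longrightarrow> x \<le> b \<Longrightarrow> \<bar>G x\<bar> \<le> C" using continuous_on_Icc_abs_bounded[OF G] by blast
  have "integrable lborel (\<lambda>x. C * (indicator {a..b} x *\<^sub>R l x))"
    using l by (intro integrable_mult_right) (simp add: set_integrable_def)
  then have "integrable lborel (\<lambda>x. (indicator {a..b} x *\<^sub>R l x) * (indicator {a..b} x *\<^sub>R G x))"
  proof (rule Bochner_Integration.integrable_bound)
    have "(\<lambda>x. indicator {a..b} x *\<^sub>R G x) \<in> borel_measurable lborel"
      using borel_measurable_continuous_on_indicator[of "{a..b}" G] G by simp
    then show "(\<lambda>x. (indicator {a..b} x *\<^sub>R l x) * (indicator {a..b} x *\<^sub>R G x)) \<in> borel_measurable lborel"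
      using l unfolding set_integrable_def by (intro borel_measurable_times) auto
    show "AE x in lborel. norm ((indicator {a..b} x *\<^sub>R l x) * (indicator {a..b} x *\<^sub>R G x)) \<le> norm (C * (indicator {a..b} x *\<^sub>R l x))"
    proof (rule AE_I2)
      fix x
      show "norm ((indicator {a..b} x *\<^sub>R l x) * (indicator {a..b} x *\<^sub>R G x)) \<le> norm (C * (indicator {a..b} x *\<^sub>R l x))"
        using C mult_left_mono[OF C(2)[of x], of "\<bar>l x\<bar>"] by (auto simp: indicator_def abs_mult mult.commute)
    qed
  qed
  then show ?thesis
    unfolding set_integrable_def
    by (rule Bochner_Integration.integrable_cong[THEN iffD1, rotated -1]) (auto simp: indicator_def)
qed

text \<open>The coefficient \<open>l\<close> only enters through its primitive: it need not be bounded pointwise, since it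
  is determined by the weak limit up to null sets.\<close>

locale coefficient =
  fixes l :: "real \<Rightarrow> real" and cm cp :: real
  assumes l_int: "set_integrable lborel {a..b} l" and cm: "0 < cm"
    and l_bounds: "a \<le> b \<Longrightarrow> cm * (b - a) \<le> (LBINT x:{a..b}. l x)" "a \<le> b \<Longrightarrow> (LBINT x:{a..b}. \<bar>l x\<bar>) \<le> cp * (b - a)"
begin

lemma primitive_diff: "a \<le> b \<Longrightarrow> primitive l b - primitive l a = (LBINT x:{a..b}. l x)"
  unfolding primitive_def by (rule interval_integral_diff[OF l_int])

lemma integral_le_abs: "\<bar>LBINT x:{a..b}. l x\<bar> \<le> (LBINT x:{a..b}. \<bar>l x\<bar>)"
  using set_integral_norm_bound[OF l_int, of a b] by simp

lemma primitive_bounds: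
  assumes "a \<le> b"
  shows "cm * (b - a) \<le> primitive l b - primitive l a" "primitive l b - primitive l a \<le> cp * (b - a)"
  using primitive_diff[OF assms] l_bounds[OF assms] integral_le_abs[of a b] by auto

lemma cp_pos: "0 < cp"
  using primitive_bounds[of 0 1] cm by simp

lemma primitive_bilip:
  "cm * \<bar>x - y\<bar> \<le> \<bar>primitive l x - primitive l y\<bar>" "\<bar>primitive l x - primitive l y\<bar> \<le> cp * \<bar>x - y\<bar>"
proof -
  have *: "cm * \<bar>x - y\<bar> \<le> \<bar>primitive l x - primitive l y\<bar> \<and> \<bar>primitive l x - primitive l y\<bar> \<le> cp * \<bar>x - y\<bar>" if "y \<le> x" for x y
  proof -
    have "0 \<le> cm * (x - y)" using cm that by simp
    then have "0 \<le> primitive l x - primitive l y" using primitive_bounds(1)[OF that] by linarith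
    then show ?thesis using primitive_bounds[OF that] that by (simp only: abs_of_nonneg diff_ge_0_iff_ge)
  qed
  show "cm * \<bar>x - y\<bar> \<le> \<bar>primitive l x - primitive l y\<bar>" "\<bar>primitive l x - primitive l y\<bar> \<le> cp * \<bar>x - y\<bar>"
    using *[of x y] *[of y x] le_cases[of x y]
    by (auto simp only: abs_minus_commute[of x y] abs_minus_commute[of "primitive l x" "primitive l y"])
qed

lemma primitive_continuous: "continuous_on UNIV (primitive l)"
proof -
  have "cp-lipschitz_on UNIV (primitive l)"
    using primitive_bilip(2) cp_pos by (auto simp: lipschitz_on_def dist_real_def)
  then show ?thesis by (rule lipschitz_on_continuous_on)
qed

lemma primitive_bij: "bij (primitive l)"
proof (rule bijI)
  show "inj (primitive l)"
  proof (rule injI)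
    fix x y assume "primitive l x = primitive l y"
    then have "cm * \<bar>x - y\<bar> \<le> 0" using primitive_bilip(1)[of x y] by simp
    then show "x = y" using cm by (simp add: mult_le_0_iff)
  qed
  have "\<exists>x. primitive l x = y" for y
  proof -
    define r where "r = \<bar>y - primitive l 0\<bar> / cm"
    have r: "0 \<le> r" "cm * r = \<bar>y - primitive l 0\<bar>" using cm by (auto simp: r_def)
    have "primitive l (- r) \<le> y" "y \<le> primitive l r"
      using primitive_bounds(1)[of "-r" 0] primitive_bounds(1)[of 0 r] r by auto
    then show ?thesis
      using IVT'[of "primitive l" "-r" y r] r primitive_continuous by (auto intro: continuous_on_subset)
  qed
  then show "surj (primitive l)" by (metis surj_def)
qed

sublocale bilipschitz "primitive l" "inv (primitive l)" cm cp
  using primitive_bij primitive_bilip cm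
  by unfold_locales (auto simp: bij_def surj_f_inv_f)

lemma primitive_0: "primitive l 0 = 0"
  by (simp add: primitive_def zero_ereal_def[symmetric])

text \<open>The two sides have the same increments up to \<open>o(b - a)\<close>, by the mean value theorem for \<open>\<Phi>\<close>.\<close>

lemma substitution:
  assumes F: "continuous_on UNIV F" and \<Phi>: "\<And>y. (\<Phi> has_real_derivative F y) (at y)"
  shows "(LBINT x=0..ereal q. l x * F (primitive l x)) = \<Phi> (primitive l q) - \<Phi> 0"
proof -
  let ?\<Lambda> = "primitive l"
  have FL: "continuous_on S (\<lambda>x. F (?\<Lambda> x))" for S
    by (rule continuous_on_compose2[OF F continuous_Lam]) auto
  have int: "set_integrable lborel {a..b} (\<lambda>x. l x * F (?\<Lambda> x))" for a b
    by (intro set_integrable_mult_continuous l_int FL)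
  define H where "H q = (LBINT x=0..ereal q. l x * F (?\<Lambda> x)) - \<Phi> (?\<Lambda> q)" for q
  have incr: "\<bar>H b - H a\<bar> \<le> e * (cp * (b - a))" if ab: "a \<le> b"
    and e: "\<And>x y. x \<in> {a..b} \<Longrightarrow> y \<in> {a..b} \<Longrightarrow> \<bar>F (?\<Lambda> x) - F (?\<Lambda> y)\<bar> \<le> e" for a b e
  proof (cases "a = b")
    case False
    then have "0 < cm * (b - a)" using ab cm by simp
    then have lt: "?\<Lambda> a < ?\<Lambda> b" using primitive_bounds(1)[OF ab] by linarith
    obtain z where z: "?\<Lambda> a < z" "z < ?\<Lambda> b" "\<Phi> (?\<Lambda> b) - \<Phi> (?\<Lambda> a) = (?\<Lambda> b - ?\<Lambda> a) * F z"
      using MVT2[OF lt, of \<Phi> F] \<Phi> by blast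
    \<comment> \<open>The mean value point lies in the range of the primitive; pulling it back to
      \<open>{a..b}\<close> makes the oscillation bound \<open>e\<close> applicable.\<close>
    obtain \<xi> where \<xi>: "a \<le> \<xi>" "\<xi> \<le> b" "?\<Lambda> \<xi> = z"
      using IVT'[of ?\<Lambda> a z b] z ab continuous_Lam by auto
    have i2: "set_integrable lborel {a..b} (\<lambda>x. l x * F z)" using l_int by simp
    have "(LBINT x:{a..b}. l x * F z) = (LBINT x:{a..b}. l x) * F z" by simp
    then have "H b - H a = (LBINT x:{a..b}. l x * F (?\<Lambda> x)) - (LBINT x:{a..b}. l x * F z)"
      using interval_integral_diff[OF int ab] primitive_diff[OF ab] z(3) by (simp add: H_def)
    also have "\<dots> = (LBINT x:{a..b}. l x * F (?\<Lambda> x) - l x * F z)"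
      by (rule set_integral_diff(2)[OF int i2, symmetric])
    finally have "\<bar>H b - H a\<bar> \<le> (LBINT x:{a..b}. \<bar>l x * F (?\<Lambda> x) - l x * F z\<bar>)"
      using set_integral_norm_bound[OF set_integral_diff(1)[OF int i2]] by simp
    also have "\<dots> \<le> (LBINT x:{a..b}. e * \<bar>l x\<bar>)"
    proof (rule set_integral_mono)
      show "set_integrable lborel {a..b} (\<lambda>x. \<bar>l x * F (?\<Lambda> x) - l x * F z\<bar>)"
        by (intro set_integrable_abs set_integral_diff int i2)
      show "set_integrable lborel {a..b} (\<lambda>x. e * \<bar>l x\<bar>)"
        using set_integrable_abs[OF l_int] by simp
      fix x assume "x \<in> {a..b}"
      then have "\<bar>F (?\<Lambda> x) - F z\<bar> \<le> e" using e[of x \<xi>] \<xi> by auto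
      then have "\<bar>l x\<bar> * \<bar>F (?\<Lambda> x) - F z\<bar> \<le> \<bar>l x\<bar> * e" by (intro mult_left_mono) auto
      then show "\<bar>l x * F (?\<Lambda> x) - l x * F z\<bar> \<le> e * \<bar>l x\<bar>"
        by (simp add: abs_mult[symmetric] right_diff_distrib mult.commute)
    qed
    also have "\<dots> = e * (LBINT x:{a..b}. \<bar>l x\<bar>)" by simp
    also have "\<dots> \<le> e * (cp * (b - a))"
      using l_bounds(2)[OF ab] e[of a a] ab by (intro mult_left_mono) auto
    finally show ?thesis .
  qed simp
  have "(H has_real_derivative 0) (at x)" for x
    unfolding DERIV_def
  proof (rule LIM_I)
    fix r :: real assume r: "0 < r"
    define e where "e = r / (2 * cp)"
    have e: "0 < e" using r cp_pos by (simp add: e_def)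
    have "\<forall>e>0. \<exists>d>0. \<forall>y. dist y x < d \<longrightarrow> dist (F (?\<Lambda> y)) (F (?\<Lambda> x)) < e"
      using FL[of UNIV] unfolding continuous_on_iff by auto
    then obtain d where d: "0 < d" "\<And>y. \<bar>y - x\<bar> < d \<Longrightarrow> \<bar>F (?\<Lambda> y) - F (?\<Lambda> x)\<bar> < e / 2"
      using half_gt_zero[OF e] unfolding dist_real_def by blast
    have "norm ((H (x + h) - H x) / h - 0) < r" if h: "h \<noteq> 0" "norm (h - 0) < d" for h
    proof -
      have "\<bar>H (max x (x + h)) - H (min x (x + h))\<bar> \<le> e * (cp * (max x (x + h) - min x (x + h)))"
      proof (rule incr)
        fix y z assume "y \<in> {min x (x + h)..max x (x + h)}" "z \<in> {min x (x + h)..max x (x + h)}"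
        then have "\<bar>y - x\<bar> < d" "\<bar>z - x\<bar> < d" using h by (auto simp: min_def max_def abs_if split: if_splits)
        from d(2)[OF this(1)] d(2)[OF this(2)] show "\<bar>F (?\<Lambda> y) - F (?\<Lambda> z)\<bar> \<le> e" by linarith
      qed simp
      then have "\<bar>H (x + h) - H x\<bar> \<le> e * (cp * \<bar>h\<bar>)"
        by (cases "0 \<le> h") (auto simp: min_def max_def abs_minus_commute)
      also have "\<dots> = r / 2 * \<bar>h\<bar>" using cp_pos by (simp add: e_def)
      finally have "\<bar>H (x + h) - H x\<bar> / \<bar>h\<bar> \<le> r / 2" using h by (simp add: pos_divide_le_eq)
      moreover have "norm ((H (x + h) - H x) / h - 0) = \<bar>H (x + h) - H x\<bar> / \<bar>h\<bar>" by simp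
      ultimately show ?thesis using r by linarith
    qed
    then show "\<exists>s>0. \<forall>h. h \<noteq> 0 \<and> norm (h - 0) < s \<longrightarrow> norm ((H (x + h) - H x) / h - 0) < r"
      using d(1) by blast
  qed
  then have "H q = H 0" by (intro DERIV_isconst_all) auto
  then show ?thesis by (simp add: H_def primitive_0 zero_ereal_def[symmetric])
qed

text \<open>In the variable \<open>y\<close> the derivative with respect to \<open>u\<close> is an
  ordinary derivative divided by \<open>U'\<close>, because the primitive is a homeomorphism and
  limits may be taken in either variable. No derivative in \<open>x\<close> is involved; the
  primitive need not be differentiable.\<close>

lemma has_D_iff:
  assumes U: "(U has_real_derivative r) (at (primitive l x))" and r: "r \<noteq> 0"
  shows "has_D (\<lambda>x. U (primitive l x)) f d x \<longleftrightarrow>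
    ((\<lambda>y. f (inv (primitive l) y)) has_real_derivative d * r) (at (primitive l x))"
proof -
  let ?\<Lambda> = "primitive l" and ?J = "inv (primitive l)"
  define y where "y = ?\<Lambda> x"
  define h where "h = (\<lambda>y. f (?J y))"
  define Q where "Q j = (h (y + j) - h y) / (U (y + j) - U y)" for j
  have k: "filterlim (\<lambda>k. ?\<Lambda> (x + k) - ?\<Lambda> x) (at 0) (at 0)"
  proof (rule filterlim_atI)
    have "continuous_on UNIV (\<lambda>k. ?\<Lambda> (x + k) - ?\<Lambda> x)"
      by (intro continuous_intros continuous_on_compose2[OF primitive_continuous]) auto
    from this[unfolded continuous_on_def, rule_format, of 0] show "((\<lambda>k. ?\<Lambda> (x + k) - ?\<Lambda> x) \<longlongrightarrow> 0) (at 0)" by simp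
    show "\<forall>\<^sub>F k in at 0. ?\<Lambda> (x + k) - ?\<Lambda> x \<noteq> 0"
      using bij_is_inj[OF primitive_bij] by (auto simp: eventually_at_filter inj_eq)
  qed
  have j: "filterlim (\<lambda>j. ?J (y + j) - ?J y) (at 0) (at 0)"
  proof (rule filterlim_atI)
    have "continuous_on UNIV (\<lambda>j. ?J (y + j) - ?J y)"
      by (intro continuous_intros continuous_on_compose2[OF continuous_Laminv[of UNIV]]) auto
    from this[unfolded continuous_on_def, rule_format, of 0] show "((\<lambda>j. ?J (y + j) - ?J y) \<longlongrightarrow> 0) (at 0)" by simp
    show "\<forall>\<^sub>F j in at 0. ?J (y + j) - ?J y \<noteq> 0"
      using bij_is_inj[OF bij_imp_bij_inv[OF primitive_bij]] by (auto simp: eventually_at_filter inj_eq)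
  qed
  let ?R = "\<lambda>k. (f (x + k) - f x) / (U (?\<Lambda> (x + k)) - U (?\<Lambda> x))"
  have RQ: "Q (?\<Lambda> (x + k) - ?\<Lambda> x) = ?R k" for k by (simp add: Q_def h_def y_def inv)
  have QR: "?R (?J (y + j) - ?J y) = Q j" for j by (simp add: Q_def h_def y_def inv)
  have "has_D (\<lambda>x. U (?\<Lambda> x)) f d x \<longleftrightarrow> (Q \<longlongrightarrow> d) (at 0)"
  proof
    assume "has_D (\<lambda>x. U (?\<Lambda> x)) f d x"
    then have "(?R \<longlongrightarrow> d) (at 0)" by (simp add: has_D_def)
    from filterlim_compose[OF this j] show "(Q \<longlongrightarrow> d) (at 0)" by (simp only: QR)
  next
    assume "(Q \<longlongrightarrow> d) (at 0)"
    from filterlim_compose[OF this k] show "has_D (\<lambda>x. U (?\<Lambda> x)) f d x" by (simp only: RQ has_D_def)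
  qed
  also have "\<dots> \<longleftrightarrow> (h has_real_derivative d * r) (at y)"
  proof -
    have U': "((\<lambda>j. (U (y + j) - U y) / j) \<longlongrightarrow> r) (at 0)" using U by (simp add: DERIV_def y_def)
    \<comment> \<open>A nonzero derivative keeps the increments of \<open>U\<close> nonzero only
      near the point, so cancelling them in \<open>Q\<close> is legitimate only eventually.\<close>
    have nz: "\<forall>\<^sub>F j in at 0. (U (y + j) - U y) / j \<noteq> 0"
      using tendsto_imp_eventually_ne[OF U' r] .
    show ?thesis
    proof
      assume "(Q \<longlongrightarrow> d) (at 0)"
      from tendsto_mult[OF this U'] have "((\<lambda>j. Q j * ((U (y + j) - U y) / j)) \<longlongrightarrow> d * r) (at 0)" .
      then have "((\<lambda>j. (h (y + j) - h y) / j) \<longlongrightarrow> d * r) (at 0)"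
        by (rule Lim_transform_eventually) (use nz in \<open>auto elim!: eventually_mono simp: Q_def\<close>)
      then show "(h has_real_derivative d * r) (at y)" by (simp add: DERIV_def)
    next
      assume "(h has_real_derivative d * r) (at y)"
      then have "((\<lambda>j. ((h (y + j) - h y) / j) / ((U (y + j) - U y) / j)) \<longlongrightarrow> (d * r) / r) (at 0)"
        using U' r by (intro tendsto_divide) (simp_all add: DERIV_def)
      then have "((\<lambda>j. ((h (y + j) - h y) / j) / ((U (y + j) - U y) / j)) \<longlongrightarrow> d) (at 0)" using r by simp
      then show "(Q \<longlongrightarrow> d) (at 0)"
        by (rule Lim_transform_eventually) (auto simp: Q_def eventually_at_filter)
    qed
  qed
  finally show ?thesis by (simp add: y_def h_def)
qed

text \<open>By \<open>has_D_iff\<close> the two conditions on \<open>f\<^sub>1 = D\<^sub>u f\<close>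
  become \<open>h' = f\<^sub>1 exp (- 2 Bt)\<close> and \<open>f\<^sub>1' = 2 g exp (2 Bt)\<close>
  in the variable \<open>y\<close>. The product rule turns this pair into the equation of
  \<open>ode\<close>, and back.\<close>

lemma has_DD_iff_ode:
  assumes b: "continuous_on UNIV b" and d: "drift (\<lambda>y. b (inv (primitive l) y)) L K"
  shows "has_DD (v_fun b l) (u_fun b l) f g \<longleftrightarrow>
    drift.ode (\<lambda>y. b (inv (primitive l) y)) (\<lambda>y. f (inv (primitive l) y)) (\<lambda>y. g (inv (primitive l) y))"
proof -
  let ?\<Lambda> = "primitive l" and ?J = "inv (primitive l)"
  define \<beta> where "\<beta> = (\<lambda>y. b (?J y))"
  interpret drift \<beta> L K using d by (simp add: \<beta>_def)
  obtain B where B: "\<And>y. (B has_real_derivative \<beta> y) (at y)"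
    using antiderivative_exists[OF continuous_drift_UNIV] by blast
  \<comment> \<open>The value 0 at 0 matches the inner integrals of \<open>u_fun\<close> and
    \<open>v_fun\<close>, which start at 0, where the primitive vanishes.\<close>
  define Bt where "Bt y = B y - B 0" for y
  have Bt: "(Bt has_real_derivative \<beta> y) (at y)" for y
    unfolding Bt_def[abs_def] by (auto intro!: derivative_eq_intros B)
  have cBt: "continuous_on S Bt" for S
    using Bt by (intro DERIV_continuous_on) (auto intro: DERIV_subset)
  have inner: "(LBINT y=0..ereal x. b y * l y) = Bt (?\<Lambda> x)" for x
    using substitution[OF continuous_drift_UNIV Bt, of x] by (simp add: \<beta>_def inv Bt_def mult.commute)
  obtain U where U: "\<And>y. (U has_real_derivative exp (- 2 * Bt y)) (at y)"
    by (rule antiderivative_exists[of "\<lambda>y. exp (- 2 * Bt y)"]) (auto intro!: continuous_intros cBt)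
  obtain V where V: "\<And>y. (V has_real_derivative exp (2 * Bt y)) (at y)"
    by (rule antiderivative_exists[of "\<lambda>y. exp (2 * Bt y)"]) (auto intro!: continuous_intros cBt)
  have u: "u_fun b l = (\<lambda>q. U (?\<Lambda> q) - U 0)"
  proof
    fix q
    have "u_fun b l q = (LBINT x=0..ereal q. l x * exp (- 2 * Bt (?\<Lambda> x)))"
      by (simp add: u_fun_def inner)
    also have "\<dots> = U (?\<Lambda> q) - U 0"
      by (rule substitution[OF _ U]) (intro continuous_intros cBt)
    finally show "u_fun b l q = U (?\<Lambda> q) - U 0" .
  qed
  have v: "v_fun b l = (\<lambda>q. 2 * (V (?\<Lambda> q) - V 0))"
  proof
    fix q
    have "v_fun b l q = 2 * (LBINT x=0..ereal q. l x * exp (2 * Bt (?\<Lambda> x)))"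
      by (simp add: v_fun_def inner)
    also have "(LBINT x=0..ereal q. l x * exp (2 * Bt (?\<Lambda> x))) = V (?\<Lambda> q) - V 0"
      by (rule substitution[OF _ V]) (intro continuous_intros cBt)
    finally show "v_fun b l q = 2 * (V (?\<Lambda> q) - V 0)" .
  qed
  have Du: "has_D (u_fun b l) f d x \<longleftrightarrow> ((\<lambda>y. f (?J y)) has_real_derivative d * exp (- 2 * Bt (?\<Lambda> x))) (at (?\<Lambda> x))" for f d x
    unfolding u by (rule has_D_iff[of "\<lambda>y. U y - U 0"]) (auto intro!: derivative_eq_intros U)
  have Dv: "has_D (v_fun b l) f d x \<longleftrightarrow> ((\<lambda>y. f (?J y)) has_real_derivative d * (2 * exp (2 * Bt (?\<Lambda> x)))) (at (?\<Lambda> x))" for f d x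
    unfolding v by (rule has_D_iff[of "\<lambda>y. 2 * (V y - V 0)"]) (auto intro!: derivative_eq_intros V)
  have E: "exp (2 * Bt y) * exp (- 2 * Bt y) = 1" for y by (simp flip: exp_add)
  have "has_DD (v_fun b l) (u_fun b l) f g \<longleftrightarrow> ode (\<lambda>y. f (?J y)) (\<lambda>y. g (?J y))"
  proof
    assume "has_DD (v_fun b l) (u_fun b l) f g"
    then obtain f1 where f1: "\<And>x. has_D (u_fun b l) f (f1 x) x" "\<And>x. has_D (v_fun b l) f1 (g x) x"
      unfolding has_DD_def by blast
    define k where "k = (\<lambda>y. f1 (?J y) * exp (- 2 * Bt y))"
    have "((\<lambda>y. f (?J y)) has_real_derivative k y) (at y)" for y
      using f1(1)[of "?J y"] unfolding Du k_def inv .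
    moreover have "(k has_real_derivative 2 * g (?J y) - 2 * \<beta> y * k y) (at y)" for y
    proof -
      have d1: "((\<lambda>y. f1 (?J y)) has_real_derivative g (?J y) * (2 * exp (2 * Bt y))) (at y)"
        using f1(2)[of "?J y"] unfolding Dv inv .
      have "(k has_real_derivative (g (?J y) * (2 * exp (2 * Bt y))) * exp (- 2 * Bt y) + (exp (- 2 * Bt y) * (- 2 * \<beta> y)) * f1 (?J y)) (at y)"
        unfolding k_def by (rule DERIV_mult[OF d1]) (auto intro!: derivative_eq_intros Bt)
      moreover have "(g (?J y) * (2 * exp (2 * Bt y))) * exp (- 2 * Bt y) = 2 * g (?J y) * (exp (2 * Bt y) * exp (- 2 * Bt y))"
        by (simp only: mult_ac)
      ultimately have "(k has_real_derivative 2 * g (?J y) + (exp (- 2 * Bt y) * (- 2 * \<beta> y)) * f1 (?J y)) (at y)"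
        by (simp only: E mult_1_right)
      then show ?thesis by (simp add: k_def mult_ac)
    qed
    ultimately show "ode (\<lambda>y. f (?J y)) (\<lambda>y. g (?J y))" unfolding ode_def by blast
  next
    assume "ode (\<lambda>y. f (?J y)) (\<lambda>y. g (?J y))"
    then obtain k where k: "\<And>y. ((\<lambda>y. f (?J y)) has_real_derivative k y) (at y)"
      "\<And>y. (k has_real_derivative 2 * g (?J y) - 2 * \<beta> y * k y) (at y)"
      unfolding ode_def by blast
    define f1 where "f1 x = k (?\<Lambda> x) * exp (2 * Bt (?\<Lambda> x))" for x
    have "has_D (u_fun b l) f (f1 x) x" for x
      unfolding Du f1_def mult.assoc E mult_1_right by (rule k(1))
    moreover have "has_D (v_fun b l) f1 (g x) x" for x
    proof -
      have "((\<lambda>y. k y * exp (2 * Bt y)) has_real_derivative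
          (2 * g (?J y) - 2 * \<beta> y * k y) * exp (2 * Bt y) + (exp (2 * Bt y) * (2 * \<beta> y)) * k y) (at y)" for y
        by (rule DERIV_mult[OF k(2)]) (auto intro!: derivative_eq_intros Bt)
      from this[of "?\<Lambda> x"] show ?thesis unfolding Dv by (simp add: f1_def inv algebra_simps)
    qed
    ultimately show "has_DD (v_fun b l) (u_fun b l) f g" unfolding has_DD_def by blast
  qed
  then show ?thesis by (simp only: \<beta>_def)
qed

end

lemma diffusion_governed:
  assumes "coefficient l cm cp" and "wiener_process M W" and b: "continuous_on UNIV b"
    and d: "drift (\<lambda>y. b (inv (primitive l) y)) L K"
  shows "diffusion_governed_by (v_fun b l) (u_fun b l) q M
    (\<lambda>t \<omega>. diffusion.flow W (\<lambda>y. b (inv (primitive l) y)) (primitive l) (inv (primitive l)) q t \<omega>)"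
proof -
  interpret coefficient l cm cp by fact
  interpret D: diffusion M W "\<lambda>y. b (inv (primitive l) y)" L K "primitive l" "inv (primitive l)" cm cp
    using assms(2) d by (intro diffusion.intro wiener.intro bilipschitz_axioms)
  show ?thesis
    unfolding diffusion_governed_by_def
  proof (intro exI conjI)
    show "feller_transition D.P" by (rule D.feller)
    show "generator D.P = {(f, g). f \<in> C0 \<and> g \<in> C0 \<and> has_DD (v_fun b l) (u_fun b l) f g}"
      unfolding D.generator_eq has_DD_iff_ode[OF b d] ..
    show "continuous_markov_process D.P q M (\<lambda>t \<omega>. D.flow q t \<omega>)" by (rule D.markov_process)
  qed
qed


section \<open>Passage to the limit\<close>

lemma LBINT_Icc_const: "a \<le> b \<Longrightarrow> (LBINT x:{a..b}. c) = c * (b - a :: real)"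
  by (simp add: set_lebesgue_integral_def)

lemma C1_bounded_deriv_continuous: "C1_bounded_deriv f \<Longrightarrow> continuous_on S f"
  unfolding C1_bounded_deriv_def
  by (meson DERIV_isCont continuous_at_imp_continuous_on)

lemma C1_bounded_deriv_Lipschitz:
  assumes "C1_bounded_deriv f" obtains L where "0 \<le> L" "\<And>x y. \<bar>f x - f y\<bar> \<le> L * \<bar>x - y\<bar>"
proof -
  obtain f' where f': "\<And>x. (f has_real_derivative f' x) (at x)" "bounded (range f')"
    using assms unfolding C1_bounded_deriv_def by blast
  then obtain L where L: "\<And>x. \<bar>f' x\<bar> \<le> L" by (auto simp: bounded_iff)
  have "\<bar>f x - f y\<bar> \<le> L * \<bar>x - y\<bar>" for x y
    using field_differentiable_bound[of UNIV f f' L y x] f' L by (auto simp: abs_minus_commute intro: DERIV_subset)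
  then show ?thesis using that[of L] L[of 0] by auto
qed

lemma Icc_integrable_continuous: "continuous_on {a..b} (f :: real \<Rightarrow> real) \<Longrightarrow> set_integrable lborel {a..b} f"
  by (rule borel_integrable_atLeastAtMost')

lemma coefficient_continuous:
  assumes l: "continuous_on UNIV l" and cm: "0 < cm" and bd: "\<And>x. cm \<le> l x \<and> l x \<le> cp"
  shows "coefficient l cm cp" "(primitive l has_real_derivative l x) (at x)"
proof -
  have int: "set_integrable lborel {a..b} l" for a b
    by (intro Icc_integrable_continuous continuous_on_subset[OF l]) auto
  have c: "set_integrable lborel {a..b} (\<lambda>_. c)" for a b c :: real
    by (intro Icc_integrable_continuous continuous_intros)
  have "\<bar>l x\<bar> = l x" for x using bd[of x] cm by auto
  then have 1: "coefficient l cm cp"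
    using set_integral_mono[OF c int] set_integral_mono[OF int c] bd
    by unfold_locales (auto simp: int cm simp flip: LBINT_Icc_const)
  then show "coefficient l cm cp" .
  interpret coefficient l cm cp by fact
  have "((\<lambda>u. LBINT y=0..u. l y) has_vector_derivative l x) (at x within {- \<bar>x\<bar> - 1..\<bar>x\<bar> + 1})"
  proof -
    have "- \<bar>x\<bar> - 1 \<le> x" "x \<le> \<bar>x\<bar> + 1" by auto
    with interval_integral_FTC2[of "- \<bar>x\<bar> - 1" 0 "\<bar>x\<bar> + 1" l x] continuous_on_subset[OF l]
    show ?thesis by (simp add: zero_ereal_def)
  qed
  moreover have "at x within {- \<bar>x\<bar> - 1..\<bar>x\<bar> + 1} = at x"
    by (intro at_within_Icc_at) auto
  ultimately show "(primitive l has_real_derivative l x) (at x)"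
    by (simp add: primitive_def[abs_def] has_real_derivative_iff_has_vector_derivative)
qed

lemma eventually_unit_interval: "\<forall>\<^sub>F \<epsilon> in at_right 0. \<epsilon> \<in> {0<..1::real}"
  unfolding eventually_at_right_field by (intro exI[of _ 1]) auto

section \<open>The weak limit of the coefficients\<close>

context
  fixes lam :: "real \<Rightarrow> real \<Rightarrow> real" and lbar :: "real \<Rightarrow> real" and cm cp :: real
  assumes lam: "\<And>\<epsilon>. \<epsilon> \<in> {0<..1} \<Longrightarrow> continuous_on UNIV (lam \<epsilon>)" and cm: "0 < cm"
    and lam_bd: "\<And>\<epsilon> x. \<epsilon> \<in> {0<..1} \<Longrightarrow> cm \<le> lam \<epsilon> x \<and> lam \<epsilon> x \<le> cp"
    and weak: "weakly_converges_on_intervals lam lbar"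
begin

lemma weak_limit:
  assumes "\<alpha> < \<beta>" "set_integrable lborel {\<alpha>..\<beta>} \<phi>"
  shows "((\<lambda>\<epsilon>. LBINT x:{\<alpha>..\<beta>}. lam \<epsilon> x * \<phi> x) \<longlongrightarrow> (LBINT x:{\<alpha>..\<beta>}. lbar x * \<phi> x)) (at_right 0)"
  using weak assms unfolding weakly_converges_on_intervals_def by blast

lemma lam_int: "\<epsilon> \<in> {0<..1} \<Longrightarrow> set_integrable lborel {a..b} (lam \<epsilon>)"
  using lam by (intro Icc_integrable_continuous) (auto intro: continuous_on_subset)

lemma const_int: "set_integrable lborel {a..b} (\<lambda>_ :: real. c :: real)"
  by (intro Icc_integrable_continuous continuous_intros)

lemma weak_limit_lower:
  assumes ab: "a < b" shows "cm * (b - a) \<le> (LBINT x:{a..b}. lbar x)"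
proof (rule tendsto_lowerbound)
  show "((\<lambda>\<epsilon>. LBINT x:{a..b}. lam \<epsilon> x) \<longlongrightarrow> (LBINT x:{a..b}. lbar x)) (at_right 0)"
    using weak_limit[OF ab const_int, of 1] by simp
  show "\<forall>\<^sub>F \<epsilon> in at_right 0. cm * (b - a) \<le> (LBINT x:{a..b}. lam \<epsilon> x)"
    using eventually_unit_interval
  proof eventually_elim
    case (elim \<epsilon>)
    then show ?case
      using set_integral_mono[OF const_int lam_int[OF elim], of a b cm] lam_bd ab
      by (simp add: LBINT_Icc_const)
  qed
qed simp

text \<open>A function which is not integrable has Bochner integral \<open>0\<close>, which the lower bound excludes.\<close>

lemma weak_limit_integrable: "set_integrable lborel {a..b} lbar"
proof (cases "a < b")
  case True
  show ?thesis
  proof (rule ccontr)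
    assume "\<not> set_integrable lborel {a..b} lbar"
    then have "(LBINT x:{a..b}. lbar x) = 0"
      unfolding set_lebesgue_integral_def set_integrable_def by (rule not_integrable_integral_eq)
    moreover have "0 < cm * (b - a)" using cm True by simp
    ultimately show False using weak_limit_lower[OF True] by simp
  qed
next
  case False
  have "AE x in lborel. indicator {a..b} x *\<^sub>R lbar x = 0"
  proof (cases "a = b")
    case True
    have "AE x in lborel. x \<noteq> b" by (rule AE_lborel_singleton)
    then show ?thesis by eventually_elim (use True in \<open>auto simp: indicator_def\<close>)
  qed (use False in auto)
  moreover have [measurable]: "lbar \<in> borel_measurable borel"
    using weak by (simp add: weakly_converges_on_intervals_def)
  ultimately have "integrable lborel (\<lambda>x. indicator {a..b} x *\<^sub>R lbar x) \<longleftrightarrow> integrable lborel (\<lambda>x :: real. 0 :: real)"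
    by (intro integrable_cong_AE) measurable
  then show ?thesis by (simp add: set_integrable_def)
qed

text \<open>Testing against the sign of \<open>lbar\<close>, a bounded measurable function, turns
  weak convergence into a bound for the integral of \<open>\<bar>lbar\<bar>\<close>.\<close>

lemma weak_limit_abs:
  assumes ab: "a < b" shows "(LBINT x:{a..b}. \<bar>lbar x\<bar>) \<le> cp * (b - a)"
proof (rule tendsto_upperbound)
  have m: "lbar \<in> borel_measurable borel" using weak by (simp add: weakly_converges_on_intervals_def)
  have sgn: "set_integrable lborel {a..b} (\<lambda>x. sgn (lbar x))"
  proof (rule set_integrable_bound[OF const_int[of a b 1]])
    show "set_borel_measurable lborel {a..b} (\<lambda>x. sgn (lbar x))"
      unfolding set_borel_measurable_def using m by measurable
  qed (auto simp: sgn_if)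
  have "lbar x * sgn (lbar x) = \<bar>lbar x\<bar>" for x by (simp add: abs_sgn)
  then show "((\<lambda>\<epsilon>. LBINT x:{a..b}. lam \<epsilon> x * sgn (lbar x)) \<longlongrightarrow> (LBINT x:{a..b}. \<bar>lbar x\<bar>)) (at_right 0)"
    using weak_limit[OF ab sgn] by simp
  show "\<forall>\<^sub>F \<epsilon> in at_right 0. (LBINT x:{a..b}. lam \<epsilon> x * sgn (lbar x)) \<le> cp * (b - a)"
    using eventually_unit_interval
  proof eventually_elim
    case (elim \<epsilon>)
    have le: "lam \<epsilon> x * sgn (lbar x) \<le> cp" for x
      using lam_bd[OF elim, of x] cm by (auto simp: sgn_if)
    have int: "set_integrable lborel {a..b} (\<lambda>x. sgn (lbar x) * lam \<epsilon> x)"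
      by (intro set_integrable_mult_continuous sgn continuous_on_subset[OF lam[OF elim]]) auto
    have int: "set_integrable lborel {a..b} (\<lambda>x. lam \<epsilon> x * sgn (lbar x))"
      using int by (simp add: mult.commute)
    show ?case
      using set_integral_mono[OF int const_int, of cp] le ab by (simp add: LBINT_Icc_const)
  qed
qed simp

lemma coefficient_weak_limit: "coefficient lbar cm cp"
proof
  fix a b :: real
  show "set_integrable lborel {a..b} lbar" by (rule weak_limit_integrable)
  assume ab: "a \<le> b"
  have "(LBINT x:{b..b}. f x) = (0 :: real)" for f :: "real \<Rightarrow> real"
  proof -
    have "AE x in lborel. indicator {b..b} x *\<^sub>R f x = 0"
      using AE_lborel_singleton[of b] by eventually_elim (auto simp: indicator_def)
    then show ?thesis unfolding set_lebesgue_integral_def by (rule integral_eq_zero_AE)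
  qed
  then show "cm * (b - a) \<le> (LBINT x:{a..b}. lbar x)" "(LBINT x:{a..b}. \<bar>lbar x\<bar>) \<le> cp * (b - a)"
    using weak_limit_lower[of a b] weak_limit_abs[of a b] ab by (cases "a = b"; simp)+
qed (rule cm)

lemma primitive_tendsto: "((\<lambda>\<epsilon>. primitive (lam \<epsilon>) x) \<longlongrightarrow> primitive lbar x) (at_right 0)"
proof -
  interpret lb: coefficient lbar cm cp by (rule coefficient_weak_limit)
  have lim: "((\<lambda>\<epsilon>. LBINT x:{a..b}. lam \<epsilon> x) \<longlongrightarrow> (LBINT x:{a..b}. lbar x)) (at_right 0)" if "a < b" for a b
    using weak_limit[OF that const_int, of 1] by simp
  have diff: "((\<lambda>\<epsilon>. primitive (lam \<epsilon>) b - primitive (lam \<epsilon>) a) \<longlongrightarrow> primitive lbar b - primitive lbar a) (at_right 0)"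
    if ab: "a < b" for a b
  proof (rule Lim_transform_eventually)
    show "((\<lambda>\<epsilon>. LBINT x:{a..b}. lam \<epsilon> x) \<longlongrightarrow> primitive lbar b - primitive lbar a) (at_right 0)"
      using lim[OF ab] lb.primitive_diff[of a b] ab by simp
    show "\<forall>\<^sub>F \<epsilon> in at_right 0. (LBINT x:{a..b}. lam \<epsilon> x) = primitive (lam \<epsilon>) b - primitive (lam \<epsilon>) a"
      using eventually_unit_interval
    proof eventually_elim
      case (elim \<epsilon>)
      then show ?case
        using coefficient.primitive_diff[OF coefficient_continuous(1)[OF lam[OF elim] cm lam_bd[OF elim]], of a b] ab by simp
    qed
  qed
  have z: "primitive l 0 = 0" for l by (simp add: primitive_def zero_ereal_def[symmetric])
  consider "x = 0" | "0 < x" | "x < 0" by linarith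
  then show ?thesis
  proof cases
    case 2 then show ?thesis using diff[of 0 x] by (simp add: z)
  next
    case 3 then show ?thesis using tendsto_minus[OF diff[of x 0]] by (simp add: z)
  qed (simp add: z)
qed

text \<open>The primitives share the Lipschitz constant \<open>cp\<close>, so convergence at the
  finitely many points of a net is enough.\<close>

lemma primitive_tendsto_uniform:
  assumes e: "0 < e"
  shows "\<forall>\<^sub>F \<epsilon> in at_right 0. \<forall>x\<in>{-R..R}. \<bar>primitive (lam \<epsilon>) x - primitive lbar x\<bar> \<le> e"
proof -
  interpret lb: coefficient lbar cm cp by (rule coefficient_weak_limit)
  \<comment> \<open>Each of the two primitives moves by at most \<open>e / 4\<close> within distance
    \<open>d\<close> of a net point; the remaining \<open>e / 2\<close> is the error at that
    point.\<close>
  define d where "d = e / (4 * cp)"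
  have d: "0 < d" using e lb.cp_pos by (simp add: d_def)
  obtain S where S: "finite S" "{-R..R} \<subseteq> (\<Union>z\<in>S. ball z d)"
    by (rule compactE_image[of "{-R..R}" "{-R..R}" "\<lambda>z. ball z d"]) (use d in auto)
  have "\<forall>\<^sub>F \<epsilon> in at_right 0. \<forall>z\<in>S. \<bar>primitive (lam \<epsilon>) z - primitive lbar z\<bar> < e / 2"
    using S(1)
  proof (rule eventually_ball_finite, intro ballI)
    fix z
    show "\<forall>\<^sub>F \<epsilon> in at_right 0. \<bar>primitive (lam \<epsilon>) z - primitive lbar z\<bar> < e / 2"
      using tendstoD[OF primitive_tendsto, of "e/2" z] e by (simp add: dist_real_def)
  qed
  with eventually_unit_interval show ?thesis
  proof eventually_elim
    case (elim \<epsilon>)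
    interpret le: coefficient "lam \<epsilon>" cm cp
      by (rule coefficient_continuous(1)[OF lam[OF elim(1)] cm lam_bd[OF elim(1)]])
    show ?case
    proof
      fix x assume "x \<in> {-R..R}"
      then obtain z where z: "z \<in> S" "\<bar>x - z\<bar> < d" using S(2) by (force simp: dist_real_def abs_minus_commute)
      have "cp * \<bar>x - z\<bar> \<le> cp * d" using z lb.cp_pos by (intro mult_left_mono) auto
      also have "cp * d = e / 4" using lb.cp_pos by (simp add: d_def)
      finally have "cp * \<bar>x - z\<bar> \<le> e / 4" .
      moreover have "\<bar>primitive (lam \<epsilon>) z - primitive lbar z\<bar> < e / 2" using elim(2) z(1) by blast
      ultimately show "\<bar>primitive (lam \<epsilon>) x - primitive lbar x\<bar> \<le> e"
        using le.primitive_bilip(2)[of x z] lb.primitive_bilip(2)[of x z] by linarith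
    qed
  qed
qed

end

text \<open>\<open>G\<close> is continuous at the limiting path of each \<omega>, and bounded, so
  dominated convergence applies. Measurability is asked only for parameters in \<open>(0,1)\<close>,
  since \<epsilon> is confined to \<open>(0,1]\<close>.\<close>

lemma weak_conv_law_pathwise:
  assumes T: "0 \<le> T" and "prob_space M"
    and X: "\<And>i. 0 < i \<Longrightarrow> i < 1 \<Longrightarrow> (\<lambda>\<omega>. restrict (\<lambda>t. X i t \<omega>) {0..T}) \<in> measurable M (path_borel T)"
    and X0: "(\<lambda>\<omega>. restrict (\<lambda>t. X0 t \<omega>) {0..T}) \<in> measurable M (path_borel T)"
    and conv: "\<And>\<omega> e. \<omega> \<in> space M \<Longrightarrow> 0 < e \<Longrightarrow> \<forall>\<^sub>F i in at_right 0. \<forall>t\<in>{0..T}. \<bar>X i t \<omega> - X0 t \<omega>\<bar> \<le> e"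
  shows "weak_conv_law T (\<lambda>i. path_law T M (X i)) (path_law T M X0) (at_right 0)"
  unfolding weak_conv_law_def
proof (intro allI impI, elim conjE)
  interpret prob_space M by fact
  fix G assume G: "continuous_map (mtopology_of (path_space T)) euclideanreal G"
    and bd: "bounded (G ` mspace (path_space T))"
  define F where "F i \<omega> = restrict (\<lambda>t. X i t \<omega>) {0..T}" for i \<omega>
  define F0 where "F0 \<omega> = restrict (\<lambda>t. X0 t \<omega>) {0..T}" for \<omega>
  have F: "F i \<in> measurable M (path_borel T)" if "0 < i" "i < 1" for i using X[OF that] by (simp add: F_def[abs_def])
  have F0: "F0 \<in> measurable M (path_borel T)" using X0 by (simp add: F0_def[abs_def])
  have Fs: "F i \<omega> \<in> mspace (path_space T)" if "0 < i" "i < 1" "\<omega> \<in> space M" for i \<omega>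
    using measurable_space[OF F[OF that(1,2)] that(3)] by simp
  have F0s: "F0 \<omega> \<in> mspace (path_space T)" if "\<omega> \<in> space M" for \<omega>
    using measurable_space[OF F0 that] by simp
  have Gm: "G \<in> borel_measurable (path_borel T)" by (rule continuous_map_path_borel_measurable[OF G])
  obtain B where B: "\<And>f. f \<in> mspace (path_space T) \<Longrightarrow> \<bar>G f\<bar> \<le> B" using bd by (auto simp: bounded_iff)
  have GF: "(\<integral>x. G x \<partial>path_law T M (X i)) = (\<integral>\<omega>. G (F i \<omega>) \<partial>M)" if "0 < i" "i < 1" for i
    unfolding path_law_def using integral_distr[OF F[OF that] Gm] by (simp add: F_def[abs_def])
  have GF0: "(\<integral>x. G x \<partial>path_law T M X0) = (\<integral>\<omega>. G (F0 \<omega>) \<partial>M)"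
    unfolding path_law_def using integral_distr[OF F0 Gm] by (simp add: F0_def[abs_def])
  have lim: "\<forall>\<^sub>F i in at_right 0. \<bar>G (F i \<omega>) - G (F0 \<omega>)\<bar> < r" if \<omega>: "\<omega> \<in> space M" and r: "0 < r" for \<omega> r
  proof -
    let ?U = "{f \<in> mspace (path_space T). G f \<in> ball (G (F0 \<omega>)) r}"
    have "openin (mtopology_of (path_space T)) ?U"
      using G openin_continuous_map_preimage[OF G, of "ball (G (F0 \<omega>)) r"] by simp
    moreover have "F0 \<omega> \<in> ?U" using F0s[OF \<omega>] r by simp
    ultimately obtain d where d: "0 < d"
      "\<And>f. f \<in> mspace (path_space T) \<Longrightarrow> (\<forall>t\<in>{0..T}. \<bar>F0 \<omega> t - f t\<bar> \<le> d) \<Longrightarrow> f \<in> ?U"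
      unfolding openin_path_space[OF T] by blast
    have "\<forall>\<^sub>F i in at_right 0. i \<in> {0<..<1::real}"
      unfolding eventually_at_right_field by (intro exI[of _ 1]) auto
    with conv[OF \<omega> d(1)] show ?thesis
    proof eventually_elim
      case (elim i)
      have "F i \<omega> \<in> ?U"
        using elim Fs[OF _ _ \<omega>, of i] by (intro d(2)) (auto simp: F_def F0_def abs_minus_commute)
      then show ?case by (simp add: dist_real_def abs_minus_commute)
    qed
  qed
  show "((\<lambda>i. \<integral>x. G x \<partial>path_law T M (X i)) \<longlongrightarrow> (\<integral>x. G x \<partial>path_law T M X0)) (at_right 0)"
  \<comment> \<open>Dominated convergence is applied along sequences; the bound 1 keeps them where
    measurability is assumed.\<close>
  proof (rule tendsto_at_right_sequentially[of 0 1])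
    fix S :: "nat \<Rightarrow> real" assume S: "\<And>n. 0 < S n" "\<And>n. S n < 1" "S \<longlonglongrightarrow> 0"
    have St: "filterlim S (at_right 0) sequentially"
      using S(1,3) less_imp_neq[OF S(1), symmetric] by (auto simp: filterlim_at intro!: always_eventually)
    have "(\<lambda>n. \<integral>\<omega>. G (F (S n) \<omega>) \<partial>M) \<longlonglongrightarrow> (\<integral>\<omega>. G (F0 \<omega>) \<partial>M)"
    proof (rule integral_dominated_convergence[where w="\<lambda>_. B"])
      show "(\<lambda>\<omega>. G (F0 \<omega>)) \<in> borel_measurable M" by (rule measurable_compose[OF F0 Gm])
      show "(\<lambda>\<omega>. G (F (S n) \<omega>)) \<in> borel_measurable M" for n by (rule measurable_compose[OF F[OF S(1,2)] Gm])
      show "AE \<omega> in M. (\<lambda>n. G (F (S n) \<omega>)) \<longlonglongrightarrow> G (F0 \<omega>)"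
      proof (rule AE_I2)
        fix \<omega> assume \<omega>: "\<omega> \<in> space M"
        have "((\<lambda>i. G (F i \<omega>)) \<longlongrightarrow> G (F0 \<omega>)) (at_right 0)"
          by (rule tendstoI) (use lim[OF \<omega>] in \<open>simp add: dist_real_def\<close>)
        from filterlim_compose[OF this St] show "(\<lambda>n. G (F (S n) \<omega>)) \<longlonglongrightarrow> G (F0 \<omega>)" .
      qed
      show "AE \<omega> in M. norm (G (F (S n) \<omega>)) \<le> B" for n
        using Fs[OF S(1,2)] B by (auto intro!: AE_I2)
    qed simp
    then show "(\<lambda>n. \<integral>x. G x \<partial>path_law T M (X (S n))) \<longlonglongrightarrow> (\<integral>x. G x \<partial>path_law T M X0)"
      by (simp add: GF GF0 S)
  qed simp
qed

lemma path_law_prob_algebra: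
  assumes "prob_space M" "(\<lambda>\<omega>. restrict (\<lambda>t. X t \<omega>) {0..T}) \<in> measurable M (path_borel T)"
  shows "path_law T M X \<in> space (prob_algebra (path_borel T))"
  using prob_space.prob_space_distr[OF assms] by (simp add: path_law_def space_prob_algebra)

lemma path_measurable:
  assumes T: "0 < T" and c: "\<And>\<omega>. \<omega> \<in> space M \<Longrightarrow> continuous_on {0..} (\<lambda>t. X t \<omega>)"
    and m: "\<And>t. 0 \<le> t \<Longrightarrow> X t \<in> borel_measurable M"
  shows "(\<lambda>\<omega>. restrict (\<lambda>t. X t \<omega>) {0..T}) \<in> measurable M (path_borel T)"
proof (rule measurable_path_borel[OF T])
  show "restrict (\<lambda>t. X t \<omega>) {0..T} \<in> mspace (path_space T)" if "\<omega> \<in> space M" for \<omega>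
    using continuous_on_subset[OF c[OF that]] by (intro restrict_in_path_space) auto
qed (use m in simp)

text \<open>\<open>wiener_process\<close> requires every point of the space to be a continuous path
  from 0, and such paths do not form a measurable subset of the full product; hence the restricted
  space.\<close>

definition canonical_space :: "(real \<Rightarrow> real) measure" where
  "canonical_space = restrict_space (PiM UNIV (\<lambda>_. borel)) {w. w 0 = 0 \<and> continuous_on {0..} w}"

text \<open>Nothing is assumed about \<open>W\<close> at negative times, so each path is continued
  there by its value at 0.\<close>

definition canonical_wiener :: "'a measure \<Rightarrow> (real \<Rightarrow> 'a \<Rightarrow> real) \<Rightarrow> (real \<Rightarrow> real) measure" where
  "canonical_wiener M W = distr M canonical_space (\<lambda>\<omega> t. W (max 0 t) \<omega>)"

context wiener
begin

lemma canonical_measurable: "(\<lambda>\<omega> t. W (max 0 t) \<omega>) \<in> measurable M canonical_space"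
  unfolding canonical_space_def
proof (rule measurable_restrict_space2)
  show "(\<lambda>\<omega> t. W (max 0 t) \<omega>) \<in> space M \<rightarrow> {w. w 0 = 0 \<and> continuous_on {0..} w}"
    using W_0 W_continuous by (auto cong: continuous_on_cong_simp)
  show "(\<lambda>\<omega> t. W (max 0 t) \<omega>) \<in> measurable M (PiM UNIV (\<lambda>_. borel))"
    by (rule measurable_PiM_single') (auto intro!: W_measurable)
qed

lemma canonical_coordinate: "(\<lambda>w. w t) \<in> borel_measurable canonical_space"
  unfolding canonical_space_def by (rule measurable_restrict_space1) simp

lemma space_canonical: "space canonical_space = {w. w 0 = 0 \<and> continuous_on {0..} w}"
  by (simp add: canonical_space_def space_restrict_space space_PiM)

lemma canonical_wiener_process: "wiener_process (canonical_wiener M W) (\<lambda>t w. w t)"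
proof -
  let ?N = "canonical_wiener M W" and ?F = "\<lambda>\<omega> t. W (max 0 t) \<omega>"
  have sets: "sets ?N = sets canonical_space" by (simp add: canonical_wiener_def)
  interpret N: prob_space ?N unfolding canonical_wiener_def by (rule prob_space_distr[OF canonical_measurable])
  have coord: "(\<lambda>w. w t) \<in> borel_measurable ?N" for t
    using canonical_coordinate by (simp cong: measurable_cong_sets add: sets)
  have diffm: "(\<lambda>w. w t - w s) \<in> borel_measurable canonical_space" for s t
    by (intro borel_measurable_diff canonical_coordinate)
  have diff: "distr ?N S (\<lambda>w. w t - w s) = distr M S (\<lambda>\<omega>. W t \<omega> - W s \<omega>)"
    if "0 \<le> s" "0 \<le> t" "sets S = sets borel" for s t and S :: "real measure"
    unfolding canonical_wiener_def using diffm that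
    by (subst distr_distr[OF _ canonical_measurable]) (auto simp: o_def cong: measurable_cong_sets)
  show ?thesis
    unfolding wiener_process_def
  proof (intro conjI allI impI ballI)
    show "prob_space ?N" by (rule N.prob_space_axioms)
    show "(\<lambda>w. w t) \<in> borel_measurable ?N" for t by (rule coord)
    show "w 0 = 0" "continuous_on {0..} (\<lambda>t. w t)" if "w \<in> space ?N" for w
      using that by (auto simp: canonical_wiener_def space_canonical)
    show "distributed ?N lborel (\<lambda>w. w t - w s) (normal_density 0 (sqrt (t - s)))" if "0 \<le> s \<and> s < t" for s t
      using W_increment[of s t] that diff[of s t lborel] coord unfolding distributed_def by auto
    fix \<tau> :: "nat \<Rightarrow> real" and n assume \<tau>: "0 \<le> \<tau> 0 \<and> (\<forall>i<n. \<tau> i < \<tau> (Suc i))"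
    show "N.indep_vars (\<lambda>_. borel) (\<lambda>i w. w (\<tau> (Suc i)) - w (\<tau> i)) {..<n}"
    \<comment> \<open>The characterisation of independence by a product law is applied to a nonempty
      index set only.\<close>
    proof (cases "n = 0")
      case True
      then show ?thesis by (simp add: N.indep_vars_def N.indep_sets_def)
    next
      case False
      then have ne: "{..<n} \<noteq> {}" by auto
      have \<tau>0: "0 \<le> \<tau> i" if "i \<le> n" for i
        using that
      proof (induction i)
        case (Suc i) then show ?case using \<tau> by (meson Suc_le_lessD less_imp_le order_trans)
      qed (use \<tau> in simp)
      let ?inc = "\<lambda>w :: real \<Rightarrow> real. \<lambda>i\<in>{..<n}. w (\<tau> (Suc i)) - w (\<tau> i)"
      have "?inc \<in> measurable canonical_space (PiM {..<n} (\<lambda>_. borel))"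
        by (intro measurable_restrict diffm)
      then have "distr ?N (PiM {..<n} (\<lambda>_. borel)) ?inc = distr M (PiM {..<n} (\<lambda>_. borel)) (\<lambda>\<omega>. ?inc (?F \<omega>))"
        unfolding canonical_wiener_def by (subst distr_distr[OF _ canonical_measurable]) (auto simp: o_def)
      also have "\<dots> = distr M (PiM {..<n} (\<lambda>_. borel)) (\<lambda>\<omega>. \<lambda>i\<in>{..<n}. W (\<tau> (Suc i)) \<omega> - W (\<tau> i) \<omega>)"
        using \<tau>0 by (intro distr_cong) (auto intro!: restrict_ext)
      also have "\<dots> = PiM {..<n} (\<lambda>i. distr M borel (\<lambda>\<omega>. W (\<tau> (Suc i)) \<omega> - W (\<tau> i) \<omega>))"
        using W_indep[of \<tau> n] \<tau> \<tau>0 ne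
        by (subst indep_vars_iff_distr_eq_PiM'[symmetric]) (auto intro!: borel_measurable_diff W_measurable)
      also have "\<dots> = PiM {..<n} (\<lambda>i. distr ?N borel (\<lambda>w. w (\<tau> (Suc i)) - w (\<tau> i)))"
        using \<tau>0 by (intro PiM_cong refl diff[symmetric]) auto
      finally show ?thesis
        using ne coord by (subst N.indep_vars_iff_distr_eq_PiM') (auto intro!: borel_measurable_diff)
    qed
  qed
qed

end


section \<open>Flows of the limit equations and their pathwise convergence\<close>

locale langevin = wiener M W + coefficient l cm cp
  for M :: "'a measure" and W l cm cp +
  fixes b :: "real \<Rightarrow> real" and Lb K :: real
  assumes Lb: "0 \<le> Lb" and b_Lip: "\<bar>b x - b y\<bar> \<le> Lb * \<bar>x - y\<bar>" and b_bd: "\<bar>b x\<bar> \<le> K"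
begin

abbreviation "\<Lambda> \<equiv> primitive l"
abbreviation "\<Lambda>inv \<equiv> inv (primitive l)"
text \<open>\<open>Lb / cm\<close> is a Lipschitz constant of the drift in the variable
  \<open>y\<close>; the summand 1 makes it positive when \<open>b\<close> is constant.\<close>

abbreviation "drift_rate \<equiv> Lb / cm + 1"

sublocale diffusion M W "\<lambda>y. b (inv (primitive l) y)" "Lb / cm + 1" K "primitive l" "inv (primitive l)" cm cp
proof
  show "0 < Lb / cm + 1" using Lb cm by (simp add: add_nonneg_pos)
  fix x y
  show "\<bar>b (\<Lambda>inv x)\<bar> \<le> K" by (rule b_bd)
  have "\<bar>b (\<Lambda>inv x) - b (\<Lambda>inv y)\<bar> \<le> Lb * \<bar>\<Lambda>inv x - \<Lambda>inv y\<bar>" by (rule b_Lip)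
  also have "\<dots> \<le> Lb * (\<bar>x - y\<bar> / cm)" using Laminv_lip Lb by (intro mult_left_mono)
  also have "\<dots> \<le> (Lb / cm + 1) * \<bar>x - y\<bar>" by (simp add: distrib_right)
  finally show "\<bar>b (\<Lambda>inv x) - b (\<Lambda>inv y)\<bar> \<le> (Lb / cm + 1) * \<bar>x - y\<bar>" .
qed

lemma b_continuous: "continuous_on S b"
proof -
  have "Lb-lipschitz_on S b" using b_Lip Lb by (auto simp: lipschitz_on_def dist_real_def)
  then show ?thesis by (rule lipschitz_on_continuous_on)
qed

lemma flow_continuous: "\<omega> \<in> space M \<Longrightarrow> continuous_on {0..} (\<lambda>t. flow q t \<omega>)"
  unfolding flow_def by (rule continuous_on_compose2[OF continuous_Laminv Y_continuous]) auto

lemma flow_path_measurable: "0 < T \<Longrightarrow> (\<lambda>\<omega>. restrict (\<lambda>t. flow q t \<omega>) {0..T}) \<in> measurable M (path_borel T)"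
  by (rule path_measurable[OF _ flow_continuous flow_measurable])

lemma flow_equation:
  assumes "\<omega> \<in> space M" "0 \<le> t"
  shows "\<Lambda> (flow q t \<omega>) = \<Lambda> q + W t \<omega> + integral {0..t} (\<lambda>s. b (flow q s \<omega>))"
  unfolding flow_def inv Y_def using sol_props(2)[OF noise_continuous[OF assms(1)] assms(2)] .

end

text \<open>The limiting flow, mapped by the primitive of \<open>lam \<epsilon>\<close>, nearly
  solves the equation of that coefficient: the noise and the integrals of \<open>b\<close> cancel,
  and what remains is the difference of the two primitives along the limiting path and at
  \<open>q\<close>. For fixed \<omega> that path stays in a compact interval, where the primitives
  converge uniformly.\<close>

lemma flow_tendsto:
  fixes q :: real
  assumes wiener: "wiener_process M W" and lam: "\<And>\<epsilon>. \<epsilon> \<in> {0<..1} \<Longrightarrow> continuous_on UNIV (lam \<epsilon>)" and cm: "0 < cm"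
    and bd: "\<And>\<epsilon> x. \<epsilon> \<in> {0<..1} \<Longrightarrow> cm \<le> lam \<epsilon> x \<and> lam \<epsilon> x \<le> cp"
    and weak: "weakly_converges_on_intervals lam lbar"
    and b: "0 \<le> Lb" "\<And>x y. \<bar>b x - b y\<bar> \<le> Lb * \<bar>x - y\<bar>" "\<And>x. \<bar>b x\<bar> \<le> K"
    and \<omega>: "\<omega> \<in> space M" and e: "0 < e" and T: "0 \<le> T"
  defines "fl \<equiv> \<lambda>l. diffusion.flow W (\<lambda>y. b (inv (primitive l) y)) (primitive l) (inv (primitive l)) q"
  shows "\<forall>\<^sub>F \<epsilon> in at_right 0. \<forall>t\<in>{0..T}. \<bar>fl (lam \<epsilon>) t \<omega> - fl lbar t \<omega>\<bar> \<le> e"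
proof -
  interpret lb: langevin M W lbar cm cp b Lb K
    using wiener coefficient_weak_limit[OF lam cm bd weak] b
    by (intro langevin.intro wiener.intro langevin_axioms.intro)
  define c where "c = exp ((Lb / cm + 1) * T)"
  \<comment> \<open>The residual \<open>2 * \<eta>\<close>, the Gronwall factor \<open>c\<close> and
    the Lipschitz constant \<open>1 / cm\<close> of the inverse primitive multiply to
    \<open>e\<close>.\<close>
  define \<eta> where "\<eta> = e * cm / (2 * c)"
  have c: "0 < c" by (simp add: c_def)
  have \<eta>: "0 < \<eta>" using e cm c by (simp add: \<eta>_def)
  obtain R where R: "\<And>t. 0 \<le> t \<Longrightarrow> t \<le> T \<Longrightarrow> \<bar>lb.flow q t \<omega>\<bar> \<le> R"
    using continuous_on_Icc_abs_bounded[OF continuous_on_subset[OF lb.flow_continuous[OF \<omega>, of q], of "{0..T}"]] by auto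
  have uniform: "\<forall>\<^sub>F \<epsilon> in at_right 0. \<forall>x\<in>{-R..R}. \<bar>primitive (lam \<epsilon>) x - primitive lbar x\<bar> \<le> \<eta>" for R
    by (rule primitive_tendsto_uniform) (use lam cm bd weak \<eta> in auto)
  from uniform[of R] uniform[of "\<bar>q\<bar>"] eventually_unit_interval
  show ?thesis
  proof eventually_elim
    case (elim \<epsilon>)
    interpret le: langevin M W "lam \<epsilon>" cm cp b Lb K
      using wiener coefficient_continuous(1)[OF lam[OF elim(3)] cm bd[OF elim(3)]] b
      by (intro langevin.intro wiener.intro langevin_axioms.intro)
    let ?z = "\<lambda>t. primitive (lam \<epsilon>) (lb.flow q t \<omega>)" and ?y = "\<lambda>t. le.Y (primitive (lam \<epsilon>) q) t \<omega>"
    show ?case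
    proof
      fix t assume t: "t \<in> {0..T}"
      have "\<bar>?y t - ?z t\<bar> \<le> 2 * \<eta> * exp ((Lb / cm + 1) * t)"
      proof (rule le.stability)
        show "continuous_on {0..T} ?y" by (rule continuous_on_subset[OF le.Y_continuous[OF \<omega>]]) auto
        show "continuous_on {0..T} ?z"
          by (rule continuous_on_compose2[OF le.continuous_Lam[of UNIV] continuous_on_subset[OF lb.flow_continuous[OF \<omega>]]]) auto
        fix s assume s: "0 \<le> s" "s \<le> T"
        have 1: "?y s = primitive (lam \<epsilon>) q + W s \<omega> + integral {0..s} (\<lambda>r. b (inv (primitive (lam \<epsilon>)) (?y r)))"
          unfolding le.Y_def using le.sol_props(2)[OF le.noise_continuous[OF \<omega>] s(1)] .
        have 2: "primitive lbar (lb.flow q s \<omega>) = primitive lbar q + W s \<omega> + integral {0..s} (\<lambda>r. b (lb.flow q r \<omega>))"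
          by (rule lb.flow_equation[OF \<omega> s(1)])
        have 3: "\<bar>primitive (lam \<epsilon>) (lb.flow q s \<omega>) - primitive lbar (lb.flow q s \<omega>)\<bar> \<le> \<eta>"
          using elim(1) R[OF s] by (auto simp: abs_le_iff)
        have 4: "\<bar>primitive (lam \<epsilon>) q - primitive lbar q\<bar> \<le> \<eta>"
        proof -
          have "q \<in> {-\<bar>q\<bar>..\<bar>q\<bar>}" by auto
          then show ?thesis using elim(2) by blast
        qed
        show "\<bar>(?y s - integral {0..s} (\<lambda>r. b (inv (primitive (lam \<epsilon>)) (?y r)))) -
            (?z s - integral {0..s} (\<lambda>r. b (inv (primitive (lam \<epsilon>)) (?z r))))\<bar> \<le> 2 * \<eta>"
          using 1 2 3 4 by (simp add: le.inv)
      qed (use t in auto)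
      also have "\<dots> \<le> 2 * \<eta> * c"
        unfolding c_def using \<eta> t le.L by (intro mult_left_mono) auto
      also have "\<dots> = e * cm" using c by (simp add: \<eta>_def)
      finally have "\<bar>?y t - ?z t\<bar> / cm \<le> e" using cm by (simp add: pos_divide_le_eq)
      then show "\<bar>fl (lam \<epsilon>) t \<omega> - fl lbar t \<omega>\<bar> \<le> e"
        using le.Laminv_lip[of "?y t" "?z t"] by (simp add: fl_def le.flow_def[symmetric] le.inv)
    qed
  qed
qed

locale langevin_smooth = langevin M W l cm cp b Lb K
  for M :: "'a measure" and W l cm cp b Lb K +
  fixes \<rho> :: "real \<Rightarrow> real" and R q p :: real
  assumes l: "continuous_on UNIV l" "\<And>x. cm \<le> l x" "\<And>x. (primitive l has_real_derivative l x) (at x)"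
    and \<rho>: "smoothing_kernel \<rho>" and R: "\<bar>\<rho> x\<bar> \<le> R"
begin

text \<open>The integrated equation contains the increment of the mollified path from time 0, where
  this path, unlike \<open>W\<close>, need not vanish.\<close>

definition noise :: "real \<Rightarrow> 'a \<Rightarrow> real \<Rightarrow> real" where
  "noise \<delta> \<omega> r = mollified \<rho> \<delta> (\<lambda>s. W s \<omega>) r - mollified \<rho> \<delta> (\<lambda>s. W s \<omega>) 0"

text \<open>The limit of the Newton trajectories as \<mu> tends to 0: the solution of
  \<open>l(x) x' = b(x)\<close> plus the derivative of the mollified path.\<close>

definition smooth_flow :: "real \<Rightarrow> real \<Rightarrow> 'a \<Rightarrow> real" where
  "smooth_flow \<delta> t \<omega> = \<Lambda>inv (sol (\<lambda>r. \<Lambda> q + noise \<delta> \<omega> r) t)"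

lemma R_nonneg: "0 \<le> R"
  using R[of 0] by linarith

lemma mollified_W_deriv:
  assumes "0 < \<delta>" "\<omega> \<in> space M" "0 \<le> t"
  shows "(mollified \<rho> \<delta> (\<lambda>s. W s \<omega>) has_real_derivative deriv (mollified \<rho> \<delta> (\<lambda>s. W s \<omega>)) t) (at t)"
  using mollified_deriv[OF \<rho> assms(1) W_continuous[OF assms(2)] assms(3)] assms(3) by auto

lemma smooth_noise_continuous:
  assumes "0 < \<delta>" "\<omega> \<in> space M" shows "continuous_on {0..} (\<lambda>r. a + noise \<delta> \<omega> r)"
proof -
  have "continuous_on {0..} (mollified \<rho> \<delta> (\<lambda>s. W s \<omega>))"
    using mollified_W_deriv[OF assms] by (intro DERIV_continuous_on) (auto intro: DERIV_subset)
  then show ?thesis unfolding noise_def by (intro continuous_intros)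
qed

lemma noise_diff:
  assumes \<delta>: "0 < \<delta>" and \<omega>: "\<omega> \<in> space M" "\<omega>' \<in> space M" and r: "0 \<le> r" "r \<le> T"
    and e: "\<And>s. 0 \<le> s \<Longrightarrow> s \<le> T + \<delta> \<Longrightarrow> \<bar>W s \<omega> - W s \<omega>'\<bar> \<le> e"
  shows "\<bar>noise \<delta> \<omega> r - noise \<delta> \<omega>' r\<bar> \<le> 2 * R * e"
proof -
  have "\<bar>mollified \<rho> \<delta> (\<lambda>s. W s \<omega>) u - mollified \<rho> \<delta> (\<lambda>s. W s \<omega>') u\<bar> \<le> R * e" if "0 \<le> u" "u \<le> T" for u
    by (rule mollified_diff_le[OF \<rho> R \<delta> W_continuous[OF \<omega>(1)] W_continuous[OF \<omega>(2)] that e])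
  from this[of r] this[of 0] r show ?thesis by (simp add: noise_def)
qed

lemma shift_0_eq: "\<omega> \<in> space M \<Longrightarrow> 0 \<le> s \<Longrightarrow> s \<le> T \<Longrightarrow> shift 0 T \<omega> s = W s \<omega>"
  by (simp add: shift_def W_0)

lemma noise_measurable:
  assumes \<delta>: "0 < \<delta>" and r: "0 \<le> r" shows "(\<lambda>\<omega>. noise \<delta> \<omega> r) \<in> borel_measurable M"
proof (rule borel_measurable_path_dominated[where T="r + \<delta>" and C="2 * R" and F="shift 0 (r + \<delta>)"])
  show "shift 0 (r + \<delta>) \<in> measurable M (path_borel (r + \<delta>))" using \<delta> r by (intro shift_measurable) auto
  fix \<omega> \<omega>' e assume "\<omega> \<in> space M" "\<omega>' \<in> space M"
    "\<And>t. 0 \<le> t \<Longrightarrow> t \<le> r + \<delta> \<Longrightarrow> \<bar>shift 0 (r + \<delta>) \<omega> t - shift 0 (r + \<delta>) \<omega>' t\<bar> \<le> e"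
  then show "\<bar>noise \<delta> \<omega> r - noise \<delta> \<omega>' r\<bar> \<le> 2 * R * e"
    using r \<delta> by (intro noise_diff[where T=r]) (auto simp: shift_0_eq)
qed (use \<delta> r R_nonneg in auto)

lemma smooth_flow_continuous:
  "0 < \<delta> \<Longrightarrow> \<omega> \<in> space M \<Longrightarrow> continuous_on {0..} (\<lambda>t. smooth_flow \<delta> t \<omega>)"
  unfolding smooth_flow_def
  by (rule continuous_on_compose2[OF continuous_Laminv sol_props(1)[OF smooth_noise_continuous]]) auto

lemma smooth_flow_path_measurable:
  assumes \<delta>: "0 < \<delta>" and T: "0 < T"
  shows "(\<lambda>\<omega>. restrict (\<lambda>t. smooth_flow \<delta> t \<omega>) {0..T}) \<in> measurable M (path_borel T)"
proof (rule path_measurable[OF T smooth_flow_continuous[OF \<delta>]])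
  fix t :: real assume t: "0 \<le> t"
  have "(\<lambda>\<omega>. sol (\<lambda>r. \<Lambda> q + noise \<delta> \<omega> r) t) \<in> borel_measurable M"
    by (rule sol_measurable[OF t smooth_noise_continuous[OF \<delta>]])
      (auto intro!: borel_measurable_add noise_measurable \<delta>)
  from measurable_compose[OF this Lam_measurable(2)]
  show "smooth_flow \<delta> t \<in> borel_measurable M" by (simp add: smooth_flow_def[abs_def])
qed

lemma smooth_flow_tendsto:
  assumes \<omega>: "\<omega> \<in> space M" and e: "0 < e" and T: "0 \<le> T"
  shows "\<forall>\<^sub>F \<delta> in at_right 0. \<forall>t\<in>{0..T}. \<bar>smooth_flow \<delta> t \<omega> - flow q t \<omega>\<bar> \<le> e"
proof -
  define c where "c = exp (drift_rate * T)"
  \<comment> \<open>If the mollified path differs from \<open>W\<close> by at most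
    \<open>R * \<eta>\<close> at each time, the noise differs by at most
    \<open>2 * R * \<eta>\<close>. The summand 1 avoids division by zero; \<open>c\<close> and
    \<open>cm\<close> come from Gronwall's inequality and the inverse primitive.\<close>
  define \<eta> where "\<eta> = e * cm / (2 * (R + 1) * c)"
  have c: "0 < c" by (simp add: c_def)
  have \<eta>: "0 < \<eta>" using e cm c R_nonneg by (simp add: \<eta>_def)
  \<comment> \<open>The interval reaches beyond \<open>T\<close> because the kernel looks ahead by
    \<delta>, which is kept below 1.\<close>
  have "uniformly_continuous_on {0..T+1} (\<lambda>t. W t \<omega>)"
    by (intro compact_uniformly_continuous continuous_on_subset[OF W_continuous[OF \<omega>]]) auto
  then obtain d where d: "0 < d" "\<And>s t. s \<in> {0..T+1} \<Longrightarrow> t \<in> {0..T+1} \<Longrightarrow> \<bar>s - t\<bar> < d \<Longrightarrow> \<bar>W s \<omega> - W t \<omega>\<bar> < \<eta>"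
    unfolding uniformly_continuous_on_def dist_real_def using \<eta> by metis
  have "\<forall>\<^sub>F \<delta> in at_right 0. \<delta> \<in> {0<..<min d 1}"
    using d(1) unfolding eventually_at_right_field by (intro exI[of _ "min d 1"]) auto
  then show ?thesis
  proof eventually_elim
    case (elim \<delta>)
    then have \<delta>: "0 < \<delta>" "\<delta> < d" "\<delta> < 1" by auto
    have m: "\<bar>mollified \<rho> \<delta> (\<lambda>s. W s \<omega>) t - W t \<omega>\<bar> \<le> R * \<eta>" if "0 \<le> t" "t \<le> T" for t
    proof (rule mollified_approx[OF \<rho> R \<delta>(1) W_continuous[OF \<omega>] that(1)])
      fix s assume "t \<le> s" "s \<le> t + \<delta>"
      then have "\<bar>W s \<omega> - W t \<omega>\<bar> < \<eta>" using \<delta> that by (intro d(2)) auto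
      then show "\<bar>W s \<omega> - W t \<omega>\<bar> \<le> \<eta>" by simp
    qed
    show ?case
    proof
      fix t assume t: "t \<in> {0..T}"
      have "\<bar>sol (\<lambda>r. \<Lambda> q + noise \<delta> \<omega> r) t - sol (\<lambda>r. \<Lambda> q + W r \<omega>) t\<bar> \<le> (2 * (R + 1) * \<eta>) * exp (drift_rate * t)"
      proof (rule sol_stability[OF smooth_noise_continuous[OF \<delta>(1) \<omega>] noise_continuous[OF \<omega>]])
        fix s assume "0 \<le> s" "s \<le> t"
        then show "\<bar>\<Lambda> q + noise \<delta> \<omega> s - (\<Lambda> q + W s \<omega>)\<bar> \<le> 2 * (R + 1) * \<eta>"
          using m[of s] m[of 0] t \<eta> W_0[OF \<omega>] by (simp add: noise_def algebra_simps)
      qed (use t in auto)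
      also have "\<dots> \<le> (2 * (R + 1) * \<eta>) * c"
        unfolding c_def using t \<eta> R_nonneg L by (intro mult_left_mono) auto
      also have "\<dots> = e * cm" using c R_nonneg by (simp add: \<eta>_def)
      finally have "\<bar>sol (\<lambda>r. \<Lambda> q + noise \<delta> \<omega> r) t - sol (\<lambda>r. \<Lambda> q + W r \<omega>) t\<bar> / cm \<le> e"
        using cm by (simp add: pos_divide_le_eq)
      then show "\<bar>smooth_flow \<delta> t \<omega> - flow q t \<omega>\<bar> \<le> e"
        unfolding smooth_flow_def flow_def Y_def by (rule order_trans[OF Laminv_lip])
    qed
  qed
qed

lemma newton_integrated:
  assumes \<delta>: "0 < \<delta>" and \<mu>: "0 < \<mu>" and \<omega>: "\<omega> \<in> space M"
    and x: "newton_solution \<mu> b l (mollified \<rho> \<delta> (\<lambda>s. W s \<omega>)) q p x"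
  obtains x' where "continuous_on {0..} x" "continuous_on {0..} x'" "x 0 = q"
    "\<And>t. 0 \<le> t \<Longrightarrow> (x has_real_derivative x' t) (at t within {0..})"
    "\<And>t. 0 \<le> t \<Longrightarrow> \<mu> * x' t + \<Lambda> (x t) = (\<mu> * p + \<Lambda> q) + integral {0..t} (\<lambda>s. b (x s)) + noise \<delta> \<omega> t"
    "\<And>t T C. 0 \<le> t \<Longrightarrow> t \<le> T \<Longrightarrow> (\<And>s. 0 \<le> s \<Longrightarrow> s \<le> T \<Longrightarrow> \<bar>deriv (mollified \<rho> \<delta> (\<lambda>s. W s \<omega>)) s\<bar> \<le> C) \<Longrightarrow>
      \<bar>x' t\<bar> \<le> \<bar>p\<bar> + (K + C) / cm"
proof (rule newton_solution_integrated[OF x \<mu> l(3,1) b_continuous cm l(2) mollified_W_deriv[OF \<delta> \<omega>]])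
  fix x' assume x': "continuous_on {0..} x" "continuous_on {0..} x'" "x 0 = q" "x' 0 = p"
    "\<And>t. 0 \<le> t \<Longrightarrow> (x has_real_derivative x' t) (at t within {0..})"
    "\<And>t. 0 \<le> t \<Longrightarrow> \<mu> * x' t + \<Lambda> (x t) = \<mu> * p + \<Lambda> q + integral {0..t} (\<lambda>s. b (x s)) + (mollified \<rho> \<delta> (\<lambda>s. W s \<omega>) t - mollified \<rho> \<delta> (\<lambda>s. W s \<omega>) 0)"
    "\<And>t T C. 0 \<le> t \<Longrightarrow> t \<le> T \<Longrightarrow> (\<And>s. 0 \<le> s \<Longrightarrow> s \<le> T \<Longrightarrow> \<bar>b (x s) + deriv (mollified \<rho> \<delta> (\<lambda>s. W s \<omega>)) s\<bar> \<le> C) \<Longrightarrow> \<bar>x' t\<bar> \<le> \<bar>p\<bar> + C / cm"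
  show thesis
  proof (rule that[OF x'(1,2,3,5)])
    show "\<mu> * x' t + \<Lambda> (x t) = (\<mu> * p + \<Lambda> q) + integral {0..t} (\<lambda>s. b (x s)) + noise \<delta> \<omega> t" if "0 \<le> t" for t
      using x'(6)[OF that] by (simp add: noise_def)
    fix t T C assume "0 \<le> t" "t \<le> T" and C: "\<And>s. 0 \<le> s \<Longrightarrow> s \<le> T \<Longrightarrow> \<bar>deriv (mollified \<rho> \<delta> (\<lambda>s. W s \<omega>)) s\<bar> \<le> C"
    have "\<bar>b (x s) + deriv (mollified \<rho> \<delta> (\<lambda>s. W s \<omega>)) s\<bar> \<le> K + C" if "0 \<le> s" "s \<le> T" for s
      using C[OF that] b_bd[of "x s"] by linarith
    then show "\<bar>x' t\<bar> \<le> \<bar>p\<bar> + (K + C) / cm" by (rule x'(7)[OF \<open>0 \<le> t\<close> \<open>t \<le> T\<close>])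
  qed
qed

text \<open>The trajectories are given for each \<omega> separately. By
  \<open>newton_solution_stability\<close> the position at time \<open>t\<close> is a Lipschitz
  function of the path of \<open>W\<close> on \<open>{0..t + \<delta>}\<close>, hence
  measurable.\<close>

lemma newton_path_measurable:
  assumes \<delta>: "0 < \<delta>" and \<mu>: "0 < \<mu>" and T: "0 < T"
    and X: "\<And>\<omega>. \<omega> \<in> space M \<Longrightarrow> newton_solution \<mu> b l (mollified \<rho> \<delta> (\<lambda>s. W s \<omega>)) q p (\<lambda>t. X t \<omega>)"
  shows "(\<lambda>\<omega>. restrict (\<lambda>t. X t \<omega>) {0..T}) \<in> measurable M (path_borel T)"
proof (rule path_measurable[OF T])
  show "continuous_on {0..} (\<lambda>t. X t \<omega>)" if "\<omega> \<in> space M" for \<omega>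
    by (rule newton_integrated[OF \<delta> \<mu> that X[OF that]])
  fix t :: real assume t: "0 \<le> t"
  define C where "C = (t / \<mu> * (2 * R)) * exp ((cp + Lb * t) / \<mu> * t)"
  show "X t \<in> borel_measurable M"
  proof (rule borel_measurable_path_dominated[where T="t + \<delta>" and C=C and F="shift 0 (t + \<delta>)"])
    show "shift 0 (t + \<delta>) \<in> measurable M (path_borel (t + \<delta>))" using \<delta> t by (intro shift_measurable) auto
    show "0 \<le> C" using t \<mu> R_nonneg by (simp add: C_def)
    show "0 \<le> t + \<delta>" using t \<delta> by simp
    fix \<omega> \<omega>' e assume \<omega>: "\<omega> \<in> space M" "\<omega>' \<in> space M" and e: "0 \<le> e"
      "\<And>s. 0 \<le> s \<Longrightarrow> s \<le> t + \<delta> \<Longrightarrow> \<bar>shift 0 (t + \<delta>) \<omega> s - shift 0 (t + \<delta>) \<omega>' s\<bar> \<le> e"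
    obtain x' where x': "continuous_on {0..} (\<lambda>t. X t \<omega>)" "continuous_on {0..} x'" "X 0 \<omega> = q"
      "\<And>t. 0 \<le> t \<Longrightarrow> ((\<lambda>t. X t \<omega>) has_real_derivative x' t) (at t within {0..})"
      "\<And>t. 0 \<le> t \<Longrightarrow> \<mu> * x' t + \<Lambda> (X t \<omega>) = (\<mu> * p + \<Lambda> q) + integral {0..t} (\<lambda>s. b (X s \<omega>)) + noise \<delta> \<omega> t"
      by (rule newton_integrated[OF \<delta> \<mu> \<omega>(1) X[OF \<omega>(1)]]) blast
    obtain z' where z': "continuous_on {0..} (\<lambda>t. X t \<omega>')" "continuous_on {0..} z'" "X 0 \<omega>' = q"
      "\<And>t. 0 \<le> t \<Longrightarrow> ((\<lambda>t. X t \<omega>') has_real_derivative z' t) (at t within {0..})"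
      "\<And>t. 0 \<le> t \<Longrightarrow> \<mu> * z' t + \<Lambda> (X t \<omega>') = (\<mu> * p + \<Lambda> q) + integral {0..t} (\<lambda>s. b (X s \<omega>')) + noise \<delta> \<omega>' t"
      by (rule newton_integrated[OF \<delta> \<mu> \<omega>(2) X[OF \<omega>(2)]]) blast
    have "\<bar>X t \<omega> - X t \<omega>'\<bar> \<le> (t / \<mu> * (2 * R * e)) * exp ((cp + Lb * t) / \<mu> * t)"
    proof (rule newton_solution_stability[OF x' z' \<mu> Lb b_Lip primitive_bilip(2) b_continuous])
      show "0 \<le> 2 * R * e" using R_nonneg e by simp
      fix r assume "0 \<le> r" "r \<le> t"
      then show "\<bar>noise \<delta> \<omega> r - noise \<delta> \<omega>' r\<bar> \<le> 2 * R * e"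
        using e(2) \<omega> by (intro noise_diff[OF \<delta> \<omega>, where T=t]) (auto simp: shift_0_eq)
    qed (use t in auto)
    then show "\<bar>X t \<omega> - X t \<omega>'\<bar> \<le> C * e" by (simp add: C_def mult_ac)
  qed
qed

text \<open>The integrated Newton equation differs from the equation of \<open>smooth_flow\<close>
  by \<open>\<mu> * (p - x')\<close>, and the velocity bound for fixed \<delta> makes this of order
  \<mu>, also near time 0, where \<open>p\<close> need not be close to the limiting
  velocity.\<close>

lemma newton_tendsto:
  assumes \<delta>: "0 < \<delta>" and \<omega>: "\<omega> \<in> space M" and e: "0 < e" and T: "0 \<le> T"
    and X: "\<And>\<mu>. 0 < \<mu> \<Longrightarrow> newton_solution \<mu> b l (mollified \<rho> \<delta> (\<lambda>s. W s \<omega>)) q p (X \<mu>)"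
  shows "\<forall>\<^sub>F \<mu> in at_right 0. \<forall>t\<in>{0..T}. \<bar>X \<mu> t - smooth_flow \<delta> t \<omega>\<bar> \<le> e"
proof -
  obtain C where C: "\<And>s. 0 \<le> s \<Longrightarrow> s \<le> T \<Longrightarrow> \<bar>deriv (mollified \<rho> \<delta> (\<lambda>s. W s \<omega>)) s\<bar> \<le> C"
    using mollified_deriv[OF \<rho> \<delta> W_continuous[OF \<omega>] T] by (metis atLeastAtMost_iff)
  \<comment> \<open>A bound for \<open>\<bar>p - x'\<bar>\<close>: the initial velocity plus the
    velocity bound of \<open>newton_integrated\<close>.\<close>
  define D where "D = \<bar>p\<bar> + (\<bar>p\<bar> + (K + C) / cm)"
  have "0 \<le> C" using C[of 0] T by auto
  then have D: "0 \<le> D" using K_nonneg cm by (simp add: D_def)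
  define c where "c = exp (drift_rate * T)"
  have c: "0 < c" by (simp add: c_def)
  define m where "m = e * cm / ((D + 1) * c)"
  have m: "0 < m" using e cm c D by (simp add: m_def)
  have "\<forall>\<^sub>F \<mu> in at_right 0. \<mu> \<in> {0<..<m}"
    using m unfolding eventually_at_right_field by (intro exI[of _ m]) auto
  then show ?thesis
  proof eventually_elim
    case (elim \<mu>)
    then have \<mu>: "0 < \<mu>" "\<mu> < m" by auto
    obtain x' where x': "continuous_on {0..} (X \<mu>)"
      "\<And>t. 0 \<le> t \<Longrightarrow> \<mu> * x' t + \<Lambda> (X \<mu> t) = (\<mu> * p + \<Lambda> q) + integral {0..t} (\<lambda>s. b (X \<mu> s)) + noise \<delta> \<omega> t"
      "\<And>t. 0 \<le> t \<Longrightarrow> t \<le> T \<Longrightarrow> \<bar>x' t\<bar> \<le> \<bar>p\<bar> + (K + C) / cm"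
      by (rule newton_integrated[OF \<delta> \<mu>(1) \<omega> X[OF \<mu>(1)]]) (use C in blast)
    let ?w = "\<lambda>r. \<Lambda> q + noise \<delta> \<omega> r"
    show ?case
    proof
      fix t assume t: "t \<in> {0..T}"
      have "\<bar>\<Lambda> (X \<mu> t) - sol ?w t\<bar> \<le> (\<mu> * D) * exp (drift_rate * t)"
      proof (rule stability)
        show "continuous_on {0..T} (\<lambda>t. \<Lambda> (X \<mu> t))"
          by (rule continuous_on_compose2[OF continuous_Lam[of UNIV] continuous_on_subset[OF x'(1)]]) auto
        show "continuous_on {0..T} (sol ?w)"
          by (rule continuous_on_subset[OF sol_props(1)[OF smooth_noise_continuous[OF \<delta> \<omega>]]]) auto
        fix s assume s: "0 \<le> s" "s \<le> T"
        have "\<bar>\<mu> * (p - x' s)\<bar> \<le> \<mu> * D"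
          unfolding abs_mult using x'(3)[OF s] \<mu>(1) by (intro mult_mono) (auto simp: D_def)
        then show "\<bar>(\<Lambda> (X \<mu> s) - integral {0..s} (\<lambda>r. b (\<Lambda>inv (\<Lambda> (X \<mu> r))))) -
            (sol ?w s - integral {0..s} (\<lambda>r. b (\<Lambda>inv (sol ?w r))))\<bar> \<le> \<mu> * D"
          using x'(2)[OF s(1)] sol_props(2)[OF smooth_noise_continuous[OF \<delta> \<omega>] s(1), of "\<Lambda> q"]
          by (simp add: inv right_diff_distrib)
      qed (use t in auto)
      also have "\<dots> \<le> (\<mu> * D) * c"
        unfolding c_def using t D \<mu> L by (intro mult_left_mono) auto
      also have "\<dots> \<le> (m * (D + 1)) * c"
        using \<mu> D c by (intro mult_right_mono mult_mono) auto
      also have "\<dots> = e * cm" using c D by (simp add: m_def)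
      finally have "\<bar>\<Lambda> (X \<mu> t) - sol ?w t\<bar> / cm \<le> e" using cm by (simp add: pos_divide_le_eq)
      then show "\<bar>X \<mu> t - smooth_flow \<delta> t \<omega>\<bar> \<le> e"
        using Laminv_lip[of "\<Lambda> (X \<mu> t)" "sol ?w t"] by (simp add: smooth_flow_def inv)
    qed
  qed
qed

end


theorem theorem4p1:
  fixes b :: "real \<Rightarrow> real"
    and \<rho> :: "real \<Rightarrow> real"
    and M :: "'a measure"
    and W :: "real \<Rightarrow> 'a \<Rightarrow> real"
    and lam :: "real \<Rightarrow> real \<Rightarrow> real"
    and lbar :: "real \<Rightarrow> real"
    and cminus cplus q p :: real
    and X :: "real \<Rightarrow> real \<Rightarrow> real \<Rightarrow> real \<Rightarrow> 'a \<Rightarrow> real"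
  assumes "C1_bounded_deriv b" and "bounded (range b)"
    and "smoothing_kernel \<rho>"
    and "wiener_process M W"
    and "\<And>\<epsilon>. \<epsilon> \<in> {0<..1} \<Longrightarrow> C1_bounded_deriv (lam \<epsilon>)"
    and "0 < cminus"
    and "\<And>\<epsilon> x. \<epsilon> \<in> {0<..1} \<Longrightarrow> cminus \<le> lam \<epsilon> x \<and> lam \<epsilon> x \<le> cplus"
    and "\<And>\<mu> \<delta> \<epsilon> \<omega>. \<mu> > 0 \<Longrightarrow> \<delta> > 0 \<Longrightarrow> \<epsilon> \<in> {0<..1} \<Longrightarrow> \<omega> \<in> space M \<Longrightarrow>
           newton_solution \<mu> b (lam \<epsilon>) (mollified \<rho> \<delta> (\<lambda>s. W s \<omega>)) q p (\<lambda>t. X \<mu> \<delta> \<epsilon> t \<omega>)"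
    and "weakly_converges_on_intervals lam lbar"
  shows "\<exists>(N :: (real \<Rightarrow> real) measure) Y.
           diffusion_governed_by (v_fun b lbar) (u_fun b lbar) q N Y \<and>
           (\<forall>T>0. iterated_weak_conv T (\<lambda>\<mu> \<delta> \<epsilon>. path_law T M (X \<mu> \<delta> \<epsilon>)) (path_law T N Y))"
proof -
  let ?\<beta> = "\<lambda>l y. b (inv (primitive l) y)"
  let ?flow = "\<lambda>W l. diffusion.flow W (?\<beta> l) (primitive l) (inv (primitive l)) q"
  let ?sflow = "\<lambda>\<delta> l. langevin_smooth.smooth_flow W l b \<rho> q \<delta>"
  interpret W: wiener M W by (rule wiener.intro[OF assms(4)])
  obtain Lb where Lb: "0 \<le> Lb" "\<And>x y. \<bar>b x - b y\<bar> \<le> Lb * \<bar>x - y\<bar>"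
    using C1_bounded_deriv_Lipschitz[OF assms(1)] by blast
  obtain K where K: "\<And>x. \<bar>b x\<bar> \<le> K" using assms(2) by (auto simp: bounded_iff)
  obtain R where R: "\<And>x. \<bar>\<rho> x\<bar> \<le> R" using smoothing_kernel_bounded[OF assms(3)] by blast
  have cont: "continuous_on UNIV (lam \<epsilon>)" if "\<epsilon> \<in> {0<..1}" for \<epsilon>
    by (rule C1_bounded_deriv_continuous[OF assms(5)[OF that]])
  have lbar: "coefficient lbar cminus cplus"
    by (rule coefficient_weak_limit[OF cont assms(6,7,9)])
  have smooth: "langevin_smooth M W (lam \<epsilon>) cminus cplus b Lb K \<rho> R" if \<epsilon>: "\<epsilon> \<in> {0<..1}" for \<epsilon>
    using coefficient_continuous[OF cont[OF \<epsilon>] assms(6) assms(7)[OF \<epsilon>]] Lb K R cont[OF \<epsilon>] assms(3,4,7) \<epsilon>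
    by (intro langevin_smooth.intro langevin_smooth_axioms.intro langevin.intro wiener.intro langevin_axioms.intro) auto
  define N where "N = canonical_wiener M W"
  define Y where "Y = ?flow (\<lambda>t w. w t) lbar"
  interpret N: langevin N "\<lambda>t w. w t" lbar cminus cplus b Lb K
    using W.canonical_wiener_process lbar Lb K
    by (intro langevin.intro wiener.intro langevin_axioms.intro) (simp_all add: N_def)
  interpret lb: langevin M W lbar cminus cplus b Lb K
    using assms(4) lbar Lb K by (intro langevin.intro wiener.intro langevin_axioms.intro)
  have "diffusion_governed_by (v_fun b lbar) (u_fun b lbar) q N Y"
    unfolding Y_def using N.drift_axioms
    by (intro diffusion_governed[OF lbar N.wiener N.b_continuous])
  moreover have "iterated_weak_conv T (\<lambda>\<mu> \<delta> \<epsilon>. path_law T M (X \<mu> \<delta> \<epsilon>)) (path_law T N Y)" if T: "0 < T" for T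
  proof -
    \<comment> \<open>On the canonical space the driving path is the sample point itself. Evaluated
      at the transported path of \<open>W\<close>, its flow is the flow driven by \<open>W\<close>
      on \<open>M\<close>, so the two processes have the same law.\<close>
    have YW: "Y t (\<lambda>t. W (max 0 t) \<omega>) = lb.flow q t \<omega>" if "\<omega> \<in> space M" "0 \<le> t" for t \<omega>
    proof -
      have c: "continuous_on {0..} (\<lambda>r. primitive lbar q + W (max 0 r) \<omega>)"
        using lb.noise_continuous[OF that(1), of "primitive lbar q"] by (auto cong: continuous_on_cong_simp)
      have "N.sol (\<lambda>r. primitive lbar q + W (max 0 r) \<omega>) t = N.sol (\<lambda>r. primitive lbar q + W r \<omega>) t"
        by (rule N.sol_cong[OF c lb.noise_continuous[OF that(1)] that(2)]) simp
      then show ?thesis by (simp add: Y_def N.flow_def N.Y_def lb.flow_def lb.Y_def)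
    qed
    have "path_law T N Y = distr M (path_borel T) (\<lambda>\<omega>. restrict (\<lambda>t. Y t (\<lambda>t. W (max 0 t) \<omega>)) {0..T})"
      unfolding path_law_def N_def canonical_wiener_def
      using N.flow_path_measurable[OF T, of q] W.canonical_measurable
      by (subst distr_distr) (auto simp: o_def Y_def N_def canonical_wiener_def)
    also have "\<dots> = path_law T M (lb.flow q)"
      unfolding path_law_def by (intro distr_cong refl) (auto simp: YW intro!: restrict_ext)
    finally have N_law: "path_law T N Y = path_law T M (lb.flow q)" .
    show ?thesis
      unfolding iterated_weak_conv_def N_law
    \<comment> \<open>The intermediate laws are those of \<open>smooth_flow\<close> and of the flow
      driven by \<open>W\<close>, both with coefficient \<open>lam \<epsilon>\<close>.\<close>
    proof (intro exI conjI ballI allI impI)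
      fix \<epsilon> \<delta> :: real assume \<epsilon>: "\<epsilon> \<in> {0<..1}" and \<delta>: "0 < \<delta>"
      interpret s: langevin_smooth M W "lam \<epsilon>" cminus cplus b Lb K \<rho> R q p by (rule smooth[OF \<epsilon>])
      note m = s.smooth_flow_path_measurable[OF \<delta> T]
      show "path_law T M (?sflow \<delta> (lam \<epsilon>)) \<in> space (prob_algebra (path_borel T))"
        by (rule path_law_prob_algebra[OF W.prob_space_axioms m])
      show "weak_conv_law T (\<lambda>\<mu>. path_law T M (X \<mu> \<delta> \<epsilon>)) (path_law T M (?sflow \<delta> (lam \<epsilon>))) (at_right 0)"
      proof (rule weak_conv_law_pathwise[OF less_imp_le[OF T] W.prob_space_axioms _ m])
        fix \<mu> :: real assume \<mu>: "0 < \<mu>"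
        show "(\<lambda>\<omega>. restrict (\<lambda>t. X \<mu> \<delta> \<epsilon> t \<omega>) {0..T}) \<in> measurable M (path_borel T)"
          by (rule s.newton_path_measurable[OF \<delta> \<mu> T]) (rule assms(8)[OF \<mu> \<delta> \<epsilon>])
      next
        fix \<omega> and e :: real assume \<omega>: "\<omega> \<in> space M" and e: "0 < e"
        show "\<forall>\<^sub>F \<mu> in at_right 0. \<forall>t\<in>{0..T}. \<bar>X \<mu> \<delta> \<epsilon> t \<omega> - s.smooth_flow \<delta> t \<omega>\<bar> \<le> e"
          by (rule s.newton_tendsto[OF \<delta> \<omega> e less_imp_le[OF T]]) (rule assms(8)[OF _ \<delta> \<epsilon> \<omega>])
      qed
    next
      fix \<epsilon> :: real assume \<epsilon>: "\<epsilon> \<in> {0<..1}"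
      interpret s: langevin_smooth M W "lam \<epsilon>" cminus cplus b Lb K \<rho> R q p by (rule smooth[OF \<epsilon>])
      note m = s.flow_path_measurable[OF T, of q]
      show "path_law T M (?flow W (lam \<epsilon>)) \<in> space (prob_algebra (path_borel T))"
        by (rule path_law_prob_algebra[OF W.prob_space_axioms m])
      show "weak_conv_law T (\<lambda>\<delta>. path_law T M (?sflow \<delta> (lam \<epsilon>))) (path_law T M (?flow W (lam \<epsilon>))) (at_right 0)"
        using T by (intro weak_conv_law_pathwise[OF _ W.prob_space_axioms s.smooth_flow_path_measurable m]
            s.smooth_flow_tendsto) auto
    next
      have m: "(\<lambda>\<omega>. restrict (\<lambda>t. ?flow W (lam \<epsilon>) t \<omega>) {0..T}) \<in> measurable M (path_borel T)" if "0 < \<epsilon>" "\<epsilon> < 1" for \<epsilon>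
      proof -
        interpret s: langevin_smooth M W "lam \<epsilon>" cminus cplus b Lb K \<rho> R q p by (rule smooth) (use that in auto)
        show ?thesis by (rule s.flow_path_measurable[OF T])
      qed
      show "weak_conv_law T (\<lambda>\<epsilon>. path_law T M (?flow W (lam \<epsilon>))) (path_law T M (lb.flow q)) (at_right 0)"
        using T by (intro weak_conv_law_pathwise[OF _ W.prob_space_axioms m lb.flow_path_measurable]
            flow_tendsto[OF assms(4) cont assms(6,7,9) Lb K]) auto
    qed
  qed
  ultimately show ?thesis by blast
qed

end
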